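(* For every $\varepsilon>0$ there exists an offline algorithm $A$ for the up-down run generation problem with buffer size $M$ that writes an output $S$ with $R(S)\le(1+\varepsilon)\,\mathrm{OPT}$, with running time $O(\varphi^{1/\varepsilon}N\log N)$, where $N$ is the input length and $\varphi=(1+\sqrt5)/2$ is the golden ratio.
   Context: Up-down run generation problem: an input stream $I$ of $N$ elements from a totally ordered set is presented in order to an algorithm with a buffer of $M$ slots; the algorithm reads elements in order into the buffer and writes elements from the buffer to an output sequence $S$, each write freeing a slot that is filled by the next input element. In the offline version, the entire input is known in advance and the goal is to compute (in polynomial time) a strategy which, executed by such a buffer-$M$ algorithm, produces few runs. A run is a sorted or reverse-sorted sequence; $R(S)$ is the smallest $k$ such that $S$ is a concatenation of $k$ runs; $\mathrm{OPT}$ is the minimum of $R(S)$ over all outputs achievable on $I$ with buffer size $M$. *)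

theory Defs
  imports Complex_Main
begin

section \<open>Up-down run generation\<close>

definition is_run :: "'a::linorder list \<Rightarrow> bool" where
  "is_run xs \<longleftrightarrow> sorted xs \<or> sorted (rev xs)"

definition num_runs :: "'a::linorder list \<Rightarrow> nat" where
  "num_runs S = (LEAST k. \<exists>rs. length rs = k \<and> concat rs = S \<and> (\<forall>r\<in>set rs. is_run r))"

text \<open>
  The buffer holds positions of the input rather than elements, so that equal elements stay
  distinguishable. In \<open>writes N B r ps\<close> the input has length \<open>N\<close>, the buffer contents are \<open>B\<close>, the
  next unread position is \<open>r\<close>, and \<open>ps\<close> lists the positions written from now on until the input is
  exhausted and the buffer is empty. Each write frees a slot, which is refilled at once as long as
  there is unread input.
\<close>

inductive writes :: "nat \<Rightarrow> nat set \<Rightarrow> nat \<Rightarrow> nat list \<Rightarrow> bool" for N where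
  finished: "writes N {} N []"
| refill: "p \<in> B \<Longrightarrow> r < N \<Longrightarrow> writes N (insert r (B - {p})) (Suc r) ps \<Longrightarrow> writes N B r (p # ps)"
| drain: "p \<in> B \<Longrightarrow> writes N (B - {p}) N ps \<Longrightarrow> writes N B N (p # ps)"

definition strategies :: "nat \<Rightarrow> nat \<Rightarrow> nat list set" where
  "strategies M N = {ps. writes N {0..<min M N} (min M N) ps}"

definition output_of :: "'a list \<Rightarrow> nat list \<Rightarrow> 'a list" where
  "output_of I ps = map (\<lambda>p. I ! p) ps"

definition outputs :: "nat \<Rightarrow> 'a list \<Rightarrow> 'a list set" where
  "outputs M I = output_of I ` strategies M (length I)"

definition OPT :: "nat \<Rightarrow> 'a::linorder list \<Rightarrow> nat" where
  "OPT M I = (LEAST k. \<exists>S\<in>outputs M I. num_runs S = k)"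

definition golden_ratio :: real where
  "golden_ratio = (1 + sqrt 5) / 2"


section \<open>Comparison-based word RAM\<close>

text \<open>
  Programs are structured RAM programs. The memory consists of registers and of arrays with indirect
  addressing; register and array names are fixed in the program text. All cells hold natural numbers.
  The input elements are accessible only through the test \<open>Key_le i j\<close>, which compares the
  input elements at the positions stored in registers \<open>i\<close> and \<open>j\<close>. \<open>Write i\<close> appends
  the position in register \<open>i\<close> to the strategy that is being computed.
\<close>

datatype test = Less nat nat | Equal nat nat | Key_le nat nat

datatype cmd =
    Skip
  | Const nat nat
  | Copy nat nat
  | Add nat nat nat
  | Sub nat nat nat
  | Half nat nat
  | Load nat nat nat
  | Store nat nat nat
  | Write nat
  | Seq cmd cmd
  | Cond test cmd cmd
  | While test cmd

record state =
  reg :: "nat \<Rightarrow> nat"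
  arr :: "nat \<Rightarrow> nat \<Rightarrow> nat"
  out :: "nat list"

definition set_reg :: "nat \<Rightarrow> nat \<Rightarrow> state \<Rightarrow> state" where
  "set_reg i v s = s\<lparr>reg := (reg s)(i := v)\<rparr>"

definition set_arr :: "nat \<Rightarrow> nat \<Rightarrow> nat \<Rightarrow> state \<Rightarrow> state" where
  "set_arr a j v s = s\<lparr>arr := (arr s)(a := (arr s a)(j := v))\<rparr>"

fun test_defined :: "'a list \<Rightarrow> test \<Rightarrow> state \<Rightarrow> bool" where
  "test_defined I (Key_le i j) s \<longleftrightarrow> reg s i < length I \<and> reg s j < length I"
| "test_defined I _ s \<longleftrightarrow> True"

fun test_true :: "'a::linorder list \<Rightarrow> test \<Rightarrow> state \<Rightarrow> bool" where
  "test_true I (Less i j) s \<longleftrightarrow> reg s i < reg s j"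
| "test_true I (Equal i j) s \<longleftrightarrow> reg s i = reg s j"
| "test_true I (Key_le i j) s \<longleftrightarrow> I ! reg s i \<le> I ! reg s j"

text \<open>
  \<open>exec W I c s t s'\<close>: on input \<open>I\<close>, command \<open>c\<close> started in \<open>s\<close> terminates in \<open>s'\<close> after exactly
  \<open>t\<close> unit-cost steps, all words being smaller than \<open>W\<close>. The bound is checked where a word can grow;
  an overflow, like a comparison outside the input, leaves the machine without a successor state.
  Subtraction is truncated at 0.
\<close>

inductive exec :: "nat \<Rightarrow> 'a::linorder list \<Rightarrow> cmd \<Rightarrow> state \<Rightarrow> nat \<Rightarrow> state \<Rightarrow> bool"
  for W I where
  Skip: "exec W I Skip s 1 s"
| Const: "v < W \<Longrightarrow> exec W I (Const i v) s 1 (set_reg i v s)"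
| Copy: "exec W I (Copy i j) s 1 (set_reg i (reg s j) s)"
| Add: "reg s j + reg s k < W \<Longrightarrow> exec W I (Add i j k) s 1 (set_reg i (reg s j + reg s k) s)"
| Sub: "exec W I (Sub i j k) s 1 (set_reg i (reg s j - reg s k) s)"
| Half: "exec W I (Half i j) s 1 (set_reg i (reg s j div 2) s)"
| Load: "exec W I (Load i a j) s 1 (set_reg i (arr s a (reg s j)) s)"
| Store: "exec W I (Store a j i) s 1 (set_arr a (reg s j) (reg s i) s)"
| Write: "exec W I (Write i) s 1 (s\<lparr>out := out s @ [reg s i]\<rparr>)"
| Seq: "exec W I c s t s' \<Longrightarrow> exec W I d s' u s'' \<Longrightarrow> exec W I (Seq c d) s (t + u) s''"
| Cond_true: "test_defined I b s \<Longrightarrow> test_true I b s \<Longrightarrow> exec W I c s t s'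
    \<Longrightarrow> exec W I (Cond b c d) s (t + 1) s'"
| Cond_false: "test_defined I b s \<Longrightarrow> \<not> test_true I b s \<Longrightarrow> exec W I d s t s'
    \<Longrightarrow> exec W I (Cond b c d) s (t + 1) s'"
| While_true: "test_defined I b s \<Longrightarrow> test_true I b s \<Longrightarrow> exec W I c s t s'
    \<Longrightarrow> exec W I (While b c) s' u s'' \<Longrightarrow> exec W I (While b c) s (t + u + 1) s''"
| While_false: "test_defined I b s \<Longrightarrow> \<not> test_true I b s \<Longrightarrow> exec W I (While b c) s 1 s"

inductive_cases Skip_E: "exec W I Skip s t s'"
inductive_cases Const_E: "exec W I (Const i v) s t s'"
inductive_cases Copy_E: "exec W I (Copy i j) s t s'"
inductive_cases Add_E: "exec W I (Add i j k) s t s'"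
inductive_cases Sub_E: "exec W I (Sub i j k) s t s'"
inductive_cases Half_E: "exec W I (Half i j) s t s'"
inductive_cases Load_E: "exec W I (Load i a j) s t s'"
inductive_cases Store_E: "exec W I (Store a j i) s t s'"
inductive_cases Write_E: "exec W I (Write i) s t s'"
inductive_cases Seq_E: "exec W I (Seq c d) s t s'"
inductive_cases Cond_E: "exec W I (Cond b c d) s t s'"
inductive_cases While_E: "exec W I (While b c) s t s'"

lemma exec_deterministic:
  "exec W I c s t s' \<Longrightarrow> exec W I c s u s'' \<Longrightarrow> t = u \<and> s' = s''"
proof (induction arbitrary: u s'' rule: exec.induct)
  case (Seq c s t s1 d v s2)
  from Seq.prems obtain t' u' s' where
    1: "exec W I c s t' s'" and 2: "exec W I d s' u' s''" and 3: "u = t' + u'"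
    by (rule Seq_E)
  from Seq.IH(1)[OF 1] have 4: "t = t'" "s1 = s'" by simp_all
  from Seq.IH(2)[of u' s''] 2 3 4 show ?case by simp
next
  case (Cond_true b s c t s1 d)
  obtain t' where 1: "exec W I c s t' s''" and 2: "u = t' + 1"
    by (rule Cond_E[OF Cond_true.prems]) (use Cond_true.hyps(2) in simp_all)
  from Cond_true.IH[OF 1] 2 show ?case by simp
next
  case (Cond_false b s d t s1 c)
  obtain t' where 1: "exec W I d s t' s''" and 2: "u = t' + 1"
    by (rule Cond_E[OF Cond_false.prems]) (use Cond_false.hyps(2) in simp_all)
  from Cond_false.IH[OF 1] 2 show ?case by simp
next
  case (While_true b s c t s1 v s2)
  obtain t' s' u' where
    1: "exec W I c s t' s'" and 2: "exec W I (While b c) s' u' s''" and 3: "u = t' + u' + 1"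
    by (rule While_E[OF While_true.prems]) (use While_true.hyps(2) in simp_all)
  from While_true.IH(1)[OF 1] have 4: "t = t'" "s1 = s'" by simp_all
  from While_true.IH(2)[of u' s''] 2 3 4 show ?case by simp
next
  case (While_false b s c)
  show ?case
    by (rule While_E[OF While_false.prems]) (use While_false.hyps(2) in simp_all)
qed (elim Skip_E Const_E Copy_E Add_E Sub_E Half_E Load_E Store_E Write_E; simp)+

text \<open>Register 0 initially holds the input length and register 1 the buffer size.\<close>

definition init_state :: "nat \<Rightarrow> nat \<Rightarrow> state" where
  "init_state N M = \<lparr>reg = (\<lambda>_. 0)(0 := N, 1 := M), arr = (\<lambda>_ _. 0), out = []\<rparr>"

definition computes :: "nat \<Rightarrow> cmd \<Rightarrow> nat \<Rightarrow> 'a::linorder list \<Rightarrow> nat \<Rightarrow> nat list \<Rightarrow> bool" where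
  "computes W A M I t ps \<longleftrightarrow>
    (\<exists>s. exec W I A (init_state (length I) M) t s \<and> out s = ps)"

text \<open>
  Words of \<open>O(log (N + M + 1/\<epsilon>))\<close> bits: \<open>k\<close> is an absolute constant in the word-size bound.
\<close>

definition word_limit :: "nat \<Rightarrow> nat \<Rightarrow> nat \<Rightarrow> real \<Rightarrow> nat" where
  "word_limit k N M \<epsilon> = (N + M + nat \<lceil>1 / \<epsilon>\<rceil> + 2) ^ k"

end

theory Submission
  imports Defs
begin

text \<open>
  A position of the game is the set \<open>R\<close> of input positions still to be written; the buffer is formed by
  its first \<open>M\<close> elements. Restricting a strategy to a subset of \<open>R\<close> keeps it legal, so having fewer
  elements left is never worse, and a greedy maximal run leaves a subset of what any run in the same
  direction leaves. Hence only directions matter. One run writes the whole buffer, so it turns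
  a position that has written at least as much as another into one that dominates it. Therefore a phase
  that spends \<open>D = \<lceil>1/\<epsilon>\<rceil>\<close> runs on getting as far as possible, followed by one more run, keeps up with
  \<open>D\<close> optimal runs.

  The best \<open>D\<close> directions are found by exhaustive search, with one pruning rule: if a run in direction
  \<open>d\<close> is at least as long as one in direction \<open>d'\<close>, then \<open>d d\<close> dominates \<open>d' d\<close>, so the shorter run need only be
  continued in its own direction. This gives the recursion \<open>T(j) = T(j - 1) + T(j - 2)\<close> and thus the
  factor \<open>\<phi>\<^sup>D\<close>. Runs are generated with a tournament tree over all input positions.
\<close>

section \<open>Greedy runs\<close>

text \<open>Two obstacles shape the development. The first is time: searching about
  \<open>\<phi>^D\<close> branches over the whole input in each of many phases would be quadratic.
  What saves the bound is that no explored branch writes more elements than the best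
  \<open>D\<close> directions do, and the phase then commits directions that write exactly as many.
  So each simulated run is charged to the progress of its phase (\<open>gain\<close>), and these
  charges telescope to \<open>N\<close>. The search returns a value and no directions; it is
  repeated before each committed run with decreasing depth, which costs only a geometric sum. The
  second is the pruning rule, because the two runs leave buffers that are incomparable as sets. They
  are compared by counting instead: the longer run has written at least as many elements beyond
  every threshold, and threshold counts are exactly what a lock-step comparison of two runs can
  preserve. Finally, getting far is not enough in the last phase, where wasted runs could spoil the
  ratio.\<close>

definition rank :: "nat set \<Rightarrow> nat \<Rightarrow> nat" where
  "rank R p = card {q \<in> R. q < p}"

definition first :: "nat set \<Rightarrow> nat \<Rightarrow> nat set" where
  "first R k = {p \<in> R. rank R p < k}"

lemma first_subset: "first R k \<subseteq> R"
  by (auto simp: first_def)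

lemma first_mono: "k \<le> l \<Longrightarrow> first R k \<subseteq> first R l"
  by (auto simp: first_def)

lemma rank_mono: "finite R \<Longrightarrow> p \<le> q \<Longrightarrow> rank R p \<le> rank R q"
  unfolding rank_def by (rule card_mono) auto

lemma rank_strict_mono: "finite R \<Longrightarrow> p \<in> R \<Longrightarrow> p < q \<Longrightarrow> rank R p < rank R q"
  unfolding rank_def by (rule psubset_card_mono) auto

text \<open>Ranks beyond \<open>p\<close> drop by one and the others stay, so the window slides by
  one element: a write admits the next unread position and nothing else.\<close>

lemma first_remove:
  assumes "finite R" "p \<in> first R k"
  shows "insert p (first (R - {p}) k) = first R (Suc k)"
proof -
  have p: "p \<in> R" "rank R p < k" using assms by (auto simp: first_def)
  have gt: "rank R q = Suc (rank (R - {p}) q)" if "p < q" for q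
  proof -
    have "{r \<in> R. r < q} = insert p {r \<in> R - {p}. r < q}" using p that by auto
    then show ?thesis using assms(1) unfolding rank_def by simp
  qed
  have lt: "rank (R - {p}) q = rank R q" if "q \<le> p" for q
    unfolding rank_def using that by (intro arg_cong[of _ _ card]) auto
  have "q \<in> first (R - {p}) k \<longleftrightarrow> q \<in> first R (Suc k)" if "q \<noteq> p" for q
  proof (cases "p < q")
    case True
    then show ?thesis using gt[of q] that by (simp add: first_def)
  next
    case False
    then have "rank R q \<le> rank R p" using assms(1) by (intro rank_mono) auto
    then show ?thesis using lt[of q] that False p by (auto simp: first_def)
  qed
  then show ?thesis using p by (auto simp: first_def)
qed

lemma card_first_le: "finite R \<Longrightarrow> card (first R k) \<le> k"
proof (cases "first R k = {}")
  case False
  assume fin: "finite R"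
  then have fin': "finite (first R k)" by (meson first_subset finite_subset)
  define m where "m = Max (first R k)"
  have m: "m \<in> first R k" using False fin' by (simp add: m_def)
  have "first R k \<subseteq> insert m {q \<in> R. q < m}"
  proof
    fix q assume q: "q \<in> first R k"
    then have "q \<le> m" using fin' by (simp add: m_def)
    moreover have "q \<in> R" using q first_subset by blast
    ultimately show "q \<in> insert m {q \<in> R. q < m}" by auto
  qed
  then have "card (first R k) \<le> Suc (rank R m)"
    unfolding rank_def using fin card_mono[of "insert m {q \<in> R. q < m}" "first R k"]
    by (simp add: card_insert_if split: if_splits)
  then show ?thesis using m by (simp add: first_def)
qed simp

lemma first_Suc:
  assumes "finite R" "R - first R k \<noteq> {}"
  shows "first R (Suc k) = insert (Min (R - first R k)) (first R k)"
    and "card (first R k) = k"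
proof -
  define t where "t = Min (R - first R k)"
  have t: "t \<in> R" "t \<notin> first R k" using Min_in[OF _ assms(2)] assms(1) by (auto simp: t_def)
  have tmin: "t \<le> q" if "q \<in> R" "q \<notin> first R k" for q
    using that assms(1) by (auto simp: t_def)
  have "{q \<in> R. q < t} = first R k"
  proof (intro set_eqI iffI)
    fix q assume "q \<in> {q \<in> R. q < t}"
    then show "q \<in> first R k" using tmin[of q] by force
  next
    fix q assume q: "q \<in> first R k"
    then have "rank R q < rank R t" using t by (auto simp: first_def)
    then have "q < t" using rank_mono[OF assms(1), of t q] by (meson linorder_not_less)
    then show "q \<in> {q \<in> R. q < t}" using q by (simp add: first_def)
  qed
  then have rt: "rank R t = card (first R k)" by (simp add: rank_def)
  with t have rtk: "rank R t = k" using card_first_le[OF assms(1), of k] by (simp add: first_def)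
  then show "card (first R k) = k" using rt by simp
  have only: "q = t" if "q \<in> R" "q \<notin> first R k" "rank R q < Suc k" for q
  proof (rule ccontr)
    assume "q \<noteq> t"
    then have "t < q" using tmin[OF that(1,2)] by simp
    then show False using rank_strict_mono[OF assms(1) t(1)] that(3) rtk by fastforce
  qed
  then show "first R (Suc k) = insert (Min (R - first R k)) (first R k)"
    unfolding t_def[symmetric]
  proof (intro equalityI subsetI)
    fix q assume "q \<in> first R (Suc k)"
    then show "q \<in> insert t (first R k)" using only[of q] by (auto simp: first_def)
  next
    fix q assume "q \<in> insert t (first R k)"
    then show "q \<in> first R (Suc k)" using t(1) rtk by (auto simp: first_def)
  qed
qed

lemma card_first:
  assumes "finite R"
  shows "card (first R k) = min (card R) k"
proof (cases "R - first R k = {}")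
  case True
  then have "first R k = R" using first_subset[of R k] by auto
  then show ?thesis using card_first_le[OF assms, of k] by simp
next
  case False
  then show ?thesis
    using first_Suc(2)[OF assms False] card_mono[OF assms first_subset, of k] by simp
qed

section \<open>Legal writing sequences and greedy runs\<close>

locale run_game =
  fixes I :: "'a::linorder list" and M :: nat
  assumes M_pos: "M \<ge> 1"
begin

abbreviation N :: nat where "N \<equiv> length I"

definition le :: "nat \<Rightarrow> nat \<Rightarrow> nat \<Rightarrow> bool" where
  "le d p q \<longleftrightarrow> (if d = 0 then I ! p \<le> I ! q else I ! q \<le> I ! p)"

lemma le_refl [simp]: "le d p p" by (simp add: le_def)
lemma le_total: "le d p q \<or> le d q p" by (auto simp: le_def)
lemma le_trans: "le d p q \<Longrightarrow> le d q r \<Longrightarrow> le d p r" by (auto simp: le_def split: if_splits)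

abbreviation win :: "nat set \<Rightarrow> nat set" where "win R \<equiv> first R M"

text \<open>Nothing forces \<open>R\<close> to be exhausted, so a single run of a longer play is
  feasible by itself.\<close>

fun feas :: "nat set \<Rightarrow> nat list \<Rightarrow> bool" where
  "feas R [] \<longleftrightarrow> True"
| "feas R (p # ps) \<longleftrightarrow> p \<in> win R \<and> feas (R - {p}) ps"

lemma feas_append: "feas R (ps @ qs) \<longleftrightarrow> feas R ps \<and> feas (R - set ps) qs"
  by (induction ps arbitrary: R) (auto simp: Diff_insert2[symmetric])

lemma feas_subset: "feas R ps \<Longrightarrow> set ps \<subseteq> R"
  by (induction ps arbitrary: R) (use first_subset in fastforce)+

lemma feas_distinct: "feas R ps \<Longrightarrow> distinct ps"
  by (induction ps arbitrary: R) (use feas_subset in fastforce)+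

lemma win_restrict: "finite R \<Longrightarrow> S \<subseteq> R \<Longrightarrow> win R \<inter> S \<subseteq> win S"
proof
  fix p assume *: "finite R" "S \<subseteq> R" "p \<in> win R \<inter> S"
  then have "rank S p \<le> rank R p" unfolding rank_def by (intro card_mono) auto
  with * show "p \<in> win S" by (auto simp: first_def)
qed

text \<open>Deleting elements can only lower the ranks of those that stay, so whatever was in the
  buffer at some moment still is.\<close>

lemma feas_restrict: "finite R \<Longrightarrow> S \<subseteq> R \<Longrightarrow> feas R ps \<Longrightarrow> feas S (filter (\<lambda>p. p \<in> S) ps)"
proof (induction ps arbitrary: R S)
  case (Cons p ps)
  show ?case
  proof (cases "p \<in> S")
    case True
    have eq: "filter (\<lambda>q. q \<in> S) ps = filter (\<lambda>q. q \<in> S - {p}) ps"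
      using feas_distinct[OF Cons.prems(3)] by (intro filter_cong) auto
    have "feas (S - {p}) (filter (\<lambda>q. q \<in> S - {p}) ps)"
      using Cons.prems by (intro Cons.IH[of "R - {p}"]) auto
    then show ?thesis using True Cons.prems win_restrict[of R S] by (auto simp: eq)
  next
    case False
    then have "S \<subseteq> R - {p}" using Cons.prems by auto
    then show ?thesis using False Cons.prems Cons.IH[of "R - {p}" S] by simp
  qed
qed simp

text \<open>What has been seen depends only on how many writes took place, not on which ones. This
  allows runs of both directions to be compared inside one common initial segment.\<close>

lemma feas_seen:
  "finite R \<Longrightarrow> feas R ps \<Longrightarrow> first (R - set ps) M \<union> set ps = first R (M + length ps)"
proof -
  have "first (R - set ps) k \<union> set ps = first R (k + length ps)"
    if "finite R" "feas R ps" "M \<le> k" for k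
    using that
  proof (induction ps arbitrary: R)
    case (Cons p ps)
    then have p: "p \<in> first R k" using first_mono[of M k R] by auto
    have "first (R - set (p # ps)) k \<union> set (p # ps) = insert p (first (R - {p} - set ps) k \<union> set ps)"
      by (simp add: Diff_insert2[symmetric])
    also have "\<dots> = insert p (first (R - {p}) (k + length ps))"
      using Cons.IH[of "R - {p}"] Cons.prems by simp
    also have "\<dots> = first R (Suc (k + length ps))"
      using p Cons.prems(1) first_mono[of k "k + length ps" R] by (intro first_remove) auto
    finally show ?case by simp
  qed simp
  then show "finite R \<Longrightarrow> feas R ps \<Longrightarrow> first (R - set ps) M \<union> set ps = first R (M + length ps)"
    by simp
qed

text \<open>\<open>A\<close> is the part of the buffer that the current run can still write.\<close>

inductive greedy :: "nat \<Rightarrow> nat set \<Rightarrow> nat set \<Rightarrow> nat list \<Rightarrow> nat set \<Rightarrow> nat set \<Rightarrow> bool" for d where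
  greedy_Nil: "greedy d A R [] A R"
| greedy_Cons: "p \<in> A \<Longrightarrow> \<forall>q\<in>A. le d p q \<Longrightarrow>
    greedy d (A - {p} \<union> {e \<in> win (R - {p}) - win R. le d p e}) (R - {p}) ps A' R' \<Longrightarrow>
    greedy d A R (p # ps) A' R'"

text \<open>\<open>greedy\<close> grows at the front, which suits rule induction; the loop of the
  machine extends a run at its end.\<close>

lemma greedy_snoc:
  assumes "greedy d A R ps A' R'" "p \<in> A'" "\<forall>q\<in>A'. le d p q"
  shows "greedy d A R (ps @ [p]) (A' - {p} \<union> {e \<in> win (R' - {p}) - win R'. le d p e}) (R' - {p})"
  using assms
proof induction
  case (greedy_Nil A R)
  then show ?case unfolding append_Nil by (rule greedy.greedy_Cons[OF _ _ greedy.greedy_Nil])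
next
  case (greedy_Cons q A R ps A' R')
  then show ?case by (simp add: greedy.greedy_Cons)
qed

lemma win_step:
  assumes "finite R" "p \<in> win R"
  shows "win (R - {p}) = first R (Suc M) - {p}"
  using first_remove[OF assms] first_subset[of "R - {p}" M] by blast

lemma greedy_remaining: "greedy d A R ps A' R' \<Longrightarrow> R' = R - set ps"
  by (induction rule: greedy.induct) auto

lemma greedy_active: "greedy d A R ps A' R' \<Longrightarrow> finite R \<Longrightarrow> A \<subseteq> win R \<Longrightarrow> A' \<subseteq> win R'"
proof (induction rule: greedy.induct)
  case (greedy_Cons p A R ps A' R')
  have "A - {p} \<subseteq> win (R - {p})"
    using greedy_Cons.prems greedy_Cons.hyps(1) win_step[of R p] first_mono[of M "Suc M" R] by auto
  then show ?case using greedy_Cons by auto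
qed simp

lemma greedy_feas: "greedy d A R ps A' R' \<Longrightarrow> finite R \<Longrightarrow> A \<subseteq> win R \<Longrightarrow> feas R ps"
proof (induction rule: greedy.induct)
  case (greedy_Cons p A R ps A' R')
  have "A - {p} \<subseteq> win (R - {p})"
    using greedy_Cons.prems greedy_Cons.hyps(1) win_step[of R p] first_mono[of M "Suc M" R] by auto
  then show ?case using greedy_Cons by auto
qed simp

lemma greedy_writes_active: "greedy d A R ps {} R' \<Longrightarrow> A \<subseteq> set ps"
  by (induction A R ps "{}::nat set" R' rule: greedy.induct) auto

lemma greedy_sorted:
  "greedy d A R ps A' R' \<Longrightarrow> finite R \<Longrightarrow> A \<subseteq> win R \<Longrightarrow>
    sorted_wrt (le d) ps \<and> (ps \<noteq> [] \<longrightarrow> hd ps \<in> A)"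
proof (induction rule: greedy.induct)
  case (greedy_Cons p A R ps A' R')
  let ?A = "A - {p} \<union> {e \<in> win (R - {p}) - win R. le d p e}"
  have "A - {p} \<subseteq> win (R - {p})"
    using greedy_Cons.prems greedy_Cons.hyps(1) win_step[of R p] first_mono[of M "Suc M" R] by auto
  then have *: "sorted_wrt (le d) ps" "ps \<noteq> [] \<longrightarrow> hd ps \<in> ?A" using greedy_Cons by auto
  have "le d p q" if "q \<in> set ps" for q
  proof -
    have "le d p (hd ps)" using * that greedy_Cons.hyps(2) by (cases ps) auto
    moreover have "hd ps = q \<or> le d (hd ps) q" using *(1) that by (cases ps) auto
    ultimately show ?thesis using le_trans by blast
  qed
  with * greedy_Cons.hyps show ?case by auto
qed simp

text \<open>A complete run writes everything that ever becomes active. An element left over was thus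
  blocked when it was read, and the run has only moved further away since; the last premise excludes
  those blocked from the start.\<close>

lemma greedy_maximal:
  "greedy d A R ps {} R' \<Longrightarrow> finite R \<Longrightarrow> A \<subseteq> win R \<Longrightarrow> i \<le> length ps \<Longrightarrow>
    e \<in> win (R - set (take i ps)) \<Longrightarrow> e \<notin> set ps \<Longrightarrow> e \<notin> win R - A \<Longrightarrow>
    i > 0 \<and> \<not> le d (ps ! (i - 1)) e"
proof (induction A R ps "{}::nat set" R' arbitrary: i rule: greedy.induct)
  case (greedy_Nil R)
  then show ?case by auto
next
  case (greedy_Cons p A R ps R')
  let ?A = "A - {p} \<union> {e \<in> win (R - {p}) - win R. le d p e}"
  have A: "?A \<subseteq> win (R - {p})"
    using greedy_Cons.prems greedy_Cons.hyps(1) win_step[of R p] first_mono[of M "Suc M" R] by auto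
  have all: "A \<subseteq> set (p # ps)"
    by (rule greedy_writes_active[OF greedy.greedy_Cons[OF greedy_Cons.hyps(1-3)]])
  show ?case
  proof (cases i)
    case 0
    then show ?thesis using greedy_Cons.prems all by auto
  next
    case (Suc j)
    have e: "e \<in> win (R - {p} - set (take j ps))" using greedy_Cons.prems(4) Suc by (simp add: Diff_insert2[symmetric])
    show ?thesis
    proof (cases "e \<in> win (R - {p}) - ?A")
      case False
      have "j > 0 \<and> \<not> le d (ps ! (j - 1)) e"
        by (rule greedy_Cons.hyps(4)) (use A e greedy_Cons.prems Suc False in auto)
      then show ?thesis using Suc by (cases j) auto
    next
      case True
      have "\<not> le d p e"
      proof
        assume "le d p e"
        with True have "e \<in> win R" "e \<notin> A" using greedy_Cons.prems(5) by auto
        then show False using greedy_Cons.prems(6) by auto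
      qed
      moreover have "le d p ((p # ps) ! j)"
      proof -
        have "sorted_wrt (le d) (p # ps)"
          using greedy_sorted[OF greedy.greedy_Cons[OF greedy_Cons.hyps(1-3)]] greedy_Cons.prems by auto
        then show ?thesis using greedy_Cons.prems(3) Suc by (cases j) auto
      qed
      ultimately show ?thesis using Suc le_trans by (metis diff_Suc_1 zero_less_Suc)
    qed
  qed
qed

text \<open>Lock-step comparison with an arbitrary run \<open>xs\<close> in the same direction: the greedy run has at
  least as many writable elements below every threshold, and its blocked elements are also
  blocked for \<open>xs\<close>.\<close>

lemma greedy_dominates:
  assumes "greedy d A R ps {} R'" "finite R" "A \<subseteq> win R"
    and "finite R2" "A2 \<subseteq> win R2" "feas R2 xs" "sorted_wrt (le d) xs" "set xs \<inter> win R2 \<subseteq> A2"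
    and "R - win R = R2 - win R2" "win R - A \<subseteq> win R2 - A2"
    and "\<forall>y. card {a \<in> A2. le d a y} \<le> card {a \<in> A. le d a y}"
  shows "R' \<subseteq> R2 - set xs"
  using assms
proof (induction A R ps "{}::nat set" R' arbitrary: R2 A2 xs rule: greedy.induct)
  case (greedy_Nil R)
  have "finite A2" using greedy_Nil.prems by (meson finite_subset first_subset)
  have "A2 = {}"
  proof (rule ccontr)
    assume "A2 \<noteq> {}"
    then obtain y where "y \<in> A2" by auto
    then have "card {a \<in> A2. le d a y} > 0" using \<open>finite A2\<close> by (auto simp: card_gt_0_iff)
    moreover have "card {a \<in> A2. le d a y} \<le> card {a \<in> {}. le d a y}" using greedy_Nil.prems(10) by blast
    ultimately show False by simp
  qed
  then have "xs = []" using greedy_Nil.prems by (cases xs) auto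
  moreover have "R \<subseteq> R2"
    using greedy_Nil.prems(8,9) first_subset[of R2 M] by blast
  ultimately show ?case by simp
next
  case (greedy_Cons p A R ps R')
  note H = greedy_Cons.prems
  have G: "greedy d A R (p # ps) {} R'" by (rule greedy.greedy_Cons[OF greedy_Cons.hyps(1-3)])
  have finA: "finite A" "finite A2" using H by (meson finite_subset first_subset)+
  show ?case
  proof (cases xs)
    case Nil
    have "R' \<subseteq> R - A" using greedy_writes_active[OF G] greedy_remaining[OF G] by auto
    also have "\<dots> \<subseteq> R2" using H(8,9) first_subset[of R2 M] by blast
    finally show ?thesis using Nil by simp
  next
    case (Cons x xs')
    have xw: "x \<in> win R2" and xA: "x \<in> A2" and pw: "p \<in> win R" and pA: "p \<in> A"
      using H Cons greedy_Cons.hyps(1) by auto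
    let ?F = "R - win R"
    \<comment> \<open>The unread parts agree, so both sides read the same next element.
      \<open>E\<close> holds it, and is empty at the end of the input.\<close>
    define E where "E = (if ?F = {} then {} else {Min ?F})"
    have fS: "first R (Suc M) = win R \<union> E"
      using first_Suc(1)[OF H(1), of M] first_mono[of M "Suc M" R] first_subset[of R "Suc M"] by (auto simp: E_def)
    have fS2: "first R2 (Suc M) = win R2 \<union> E"
      using first_Suc(1)[OF H(3), of M] first_mono[of M "Suc M" R2] first_subset[of R2 "Suc M"] H(8)
      by (auto simp: E_def)
    have EF: "E \<subseteq> ?F" using Min_in[of ?F] H(1) by (auto simp: E_def)
    have disj: "E \<inter> win R = {}" "E \<inter> win R2 = {}" using EF H(8) by auto
    have w1: "win (R - {p}) = win R - {p} \<union> E" using win_step[OF H(1) pw] fS disj pw by auto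
    have w2: "win (R2 - {x}) = win R2 - {x} \<union> E" using win_step[OF H(3) xw] fS2 disj xw by auto
    let ?A = "A - {p} \<union> {e \<in> win (R - {p}) - win R. le d p e}"
    \<comment> \<open>The rival need not write its best element first: active elements before
      \<open>x\<close> are lost to it and leave its active set.\<close>
    let ?A2 = "{a \<in> A2 - {x}. le d x a} \<union> {e \<in> E. le d x e}"
    have A': "?A = A - {p} \<union> {e \<in> E. le d p e}" using w1 disj by auto
    \<comment> \<open>The threshold count at \<open>x\<close> yields an active element of the greedy
      side at or before \<open>x\<close>, and \<open>p\<close> is at or before that one.\<close>
    have px: "le d p x"
    proof -
      have "card {a \<in> A2. le d a x} > 0" using xA finA by (auto simp: card_gt_0_iff)
      then have "card {a \<in> A. le d a x} > 0" using H(10) by (meson order.strict_trans2)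
      then obtain a where "a \<in> A" "le d a x" by (auto simp: card_gt_0_iff)
      then show ?thesis using greedy_Cons.hyps(2) le_trans by blast
    qed
    have "R' \<subseteq> (R2 - {x}) - set xs'"
    proof (rule greedy_Cons.hyps(4))
      show "finite (R - {p})" "finite (R2 - {x})" using H by auto
      show "?A \<subseteq> win (R - {p})" using w1 H(2) by auto
      show "?A2 \<subseteq> win (R2 - {x})" using w2 H(4) by auto
      show "feas (R2 - {x}) xs'" "sorted_wrt (le d) xs'" using H Cons by auto
      show "set xs' \<inter> win (R2 - {x}) \<subseteq> ?A2"
        using H(6,7) Cons w2 by auto
      show "R - {p} - win (R - {p}) = R2 - {x} - win (R2 - {x})" using w1 w2 H(8) pw xw by auto
      show "win (R - {p}) - ?A \<subseteq> win (R2 - {x}) - ?A2"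
      proof
        fix k assume "k \<in> win (R - {p}) - ?A"
        then consider "k \<in> win R - A" "k \<notin> E" | "k \<in> E" "\<not> le d p k"
          using w1 A' disj pA by auto
        then show "k \<in> win (R2 - {x}) - ?A2"
        proof cases
          case 1
          then have "k \<in> win R2 - A2" using H(9) by auto
          then show ?thesis using 1 w2 xA by auto
        next
          case 2
          then have "\<not> le d x k" using le_trans[OF px] by blast
          then show ?thesis using 2 w2 H(4) disj by auto
        qed
      qed
      show "\<forall>y. card {a \<in> ?A2. le d a y} \<le> card {a \<in> ?A. le d a y}"
      proof
        fix y
        show "card {a \<in> ?A2. le d a y} \<le> card {a \<in> ?A. le d a y}"
        proof (cases "le d x y")
          case False
          then have "{a \<in> ?A2. le d a y} = {}" using le_trans by blast
          then show ?thesis by (metis card.empty le0)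
        next
          case True
          \<comment> \<open>Up to \<open>y\<close> each side loses one element, \<open>x\<close> and
            \<open>p\<close>, and an element of \<open>E\<close> that is accepted after
            \<open>x\<close> is accepted after \<open>p\<close> as well.\<close>
          have finE: "finite E" by (simp add: E_def)
          have "card {a \<in> ?A2. le d a y} \<le> card (({a \<in> A2. le d a y} - {x}) \<union> {e \<in> E. le d x e \<and> le d e y})"
            using finA finE by (intro card_mono) auto
          also have "\<dots> \<le> card ({a \<in> A2. le d a y} - {x}) + card {e \<in> E. le d x e \<and> le d e y}"
            by (rule card_Un_le)
          also have "card ({a \<in> A2. le d a y} - {x}) = card {a \<in> A2. le d a y} - 1"
            using xA True finA by (subst card_Diff_singleton) auto
          also have "\<dots> \<le> card {a \<in> A. le d a y} - 1" using H(10) by (simp add: diff_le_mono)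
          also have "\<dots> = card ({a \<in> A. le d a y} - {p})"
            using pA le_trans[OF px True] finA by (subst card_Diff_singleton) auto
          also have "card {e \<in> E. le d x e \<and> le d e y} \<le> card {e \<in> E. le d p e \<and> le d e y}"
            using finE le_trans[OF px] by (intro card_mono) auto
          also have "card ({a \<in> A. le d a y} - {p}) + card {e \<in> E. le d p e \<and> le d e y} =
              card (({a \<in> A. le d a y} - {p}) \<union> {e \<in> E. le d p e \<and> le d e y})"
            using finA finE disj H(2) by (subst card_Un_disjoint) auto
          also have "({a \<in> A. le d a y} - {p}) \<union> {e \<in> E. le d p e \<and> le d e y} = {a \<in> ?A. le d a y}"
            unfolding A' by auto
          finally show ?thesis by simp
        qed
      qed
    qed
    then show ?thesis using Cons by auto
  qed
qed

end

section \<open>Comparing the two greedy runs\<close>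

lemma first_less: "finite R \<Longrightarrow> a \<in> first R k \<Longrightarrow> b \<in> R - first R k \<Longrightarrow> a < b"
  using rank_mono[of R b a] by (fastforce simp: first_def)

lemma sorted_split:
  assumes "sorted_wrt r xs" "\<And>a b. r a b \<Longrightarrow> P b \<Longrightarrow> P a"
  shows "set (takeWhile P xs) = {a \<in> set xs. P a}" "set (dropWhile P xs) = {a \<in> set xs. \<not> P a}"
  using assms(1) by (induction xs) (auto dest: assms(2))

context run_game
begin

section \<open>Greedy runs as a function on positions\<close>

lemma ex_extremal: "finite A \<Longrightarrow> A \<noteq> {} \<Longrightarrow> \<exists>p\<in>A. \<forall>q\<in>A. le d p q"
proof (induction rule: finite_ne_induct)
  case (insert x F)
  then obtain p where p: "p \<in> F" "\<forall>q\<in>F. le d p q" by auto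
  show ?case
  proof (cases "le d p x")
    case True
    then show ?thesis using p by auto
  next
    case False
    then have "le d x p" using le_total by blast
    then show ?thesis using p le_trans by (metis insertE insertI1 le_refl)
  qed
qed simp

lemma greedy_exists: "finite R \<Longrightarrow> A \<subseteq> win R \<Longrightarrow> \<exists>ps R'. greedy d A R ps {} R'"
proof (induction "card R" arbitrary: R A)
  case 0
  then have "A = {}" using first_subset[of R M] by auto
  then show ?case using greedy_Nil by blast
next
  case (Suc n)
  show ?case
  proof (cases "A = {}")
    case True
    then show ?thesis using greedy_Nil by blast
  next
    case False
    have "finite A" using Suc.prems by (meson finite_subset first_subset)
    then obtain p where p: "p \<in> A" "\<forall>q\<in>A. le d p q" using ex_extremal False by blast
    have pw: "p \<in> win R" "p \<in> R" using p Suc.prems first_subset by blast+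
    have "A - {p} \<union> {e \<in> win (R - {p}) - win R. le d p e} \<subseteq> win (R - {p})"
      using Suc.prems p win_step[of R p] first_mono[of M "Suc M" R] by auto
    moreover have "n = card (R - {p})" using Suc.hyps(2) Suc.prems pw by simp
    ultimately obtain ps R' where
      "greedy d (A - {p} \<union> {e \<in> win (R - {p}) - win R. le d p e}) (R - {p}) ps {} R'"
      using Suc.hyps(1)[of "R - {p}"] Suc.prems by blast
    then show ?thesis using greedy_Cons p by blast
  qed
qed

text \<open>With equal keys the greedy sequence is not unique, but \<open>greedy_least\<close>
  applied both ways shows that the set it leaves is. Only this set is kept.\<close>

definition nxt :: "nat \<Rightarrow> nat set \<Rightarrow> nat set" where
  "nxt d R = (THE R'. \<exists>ps. greedy d (win R) R ps {} R')"

lemma greedy_least: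
  assumes "finite R" "greedy d (win R) R ps {} R'" "feas R xs" "sorted_wrt (le d) xs"
  shows "R' \<subseteq> R - set xs"
  by (rule greedy_dominates[OF assms(2,1) order_refl assms(1) order_refl assms(3,4)]) auto

lemma nxt_eq:
  assumes "finite R" "greedy d (win R) R ps {} R'"
  shows "nxt d R = R'"
  unfolding nxt_def
proof (rule the_equality)
  have least: "A \<subseteq> B" if "greedy d (win R) R ps {} A" "greedy d (win R) R qs {} B" for ps qs A B
    using greedy_least[OF assms(1) that(1) greedy_feas[OF that(2) assms(1) order_refl]]
      greedy_sorted[OF that(2) assms(1) order_refl] greedy_remaining[OF that(2)] by simp
  show "\<exists>ps. greedy d (win R) R ps {} R'" using assms(2) by blast
  show "\<And>R''. \<exists>ps. greedy d (win R) R ps {} R'' \<Longrightarrow> R'' = R'"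
    using least assms(2) by (meson subset_antisym)
qed

lemma nxt_greedy:
  assumes "finite R"
  obtains ps where "greedy d (win R) R ps {} (nxt d R)" "nxt d R = R - set ps"
    "feas R ps" "sorted_wrt (le d) ps" "distinct ps" "set ps \<subseteq> R"
proof -
  obtain ps R' where g: "greedy d (win R) R ps {} R'" using greedy_exists[OF assms order_refl] by blast
  show ?thesis
    using that[of ps] g nxt_eq[OF assms g] greedy_feas[OF g assms order_refl]
      greedy_sorted[OF g assms order_refl] greedy_remaining[OF g] feas_distinct feas_subset by blast
qed

lemma nxt_least: "finite R \<Longrightarrow> feas R xs \<Longrightarrow> sorted_wrt (le d) xs \<Longrightarrow> nxt d R \<subseteq> R - set xs"
  by (metis greedy_least nxt_greedy)

lemma nxt_subset: "finite R \<Longrightarrow> nxt d R \<subseteq> R - win R"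
  by (rule nxt_greedy[of R d]) (use greedy_writes_active in blast)+

text \<open>The greedy run from \<open>R\<close>, thinned out to \<open>S\<close>, is a legal run
  from \<open>S\<close> whose leftover lies in that of \<open>R\<close>, and \<open>nxt d S\<close>
  is the least leftover.\<close>

lemma nxt_mono:
  assumes "finite R" "S \<subseteq> R"
  shows "nxt d S \<subseteq> nxt d R"
proof -
  obtain ps where ps: "nxt d R = R - set ps" "feas R ps" "sorted_wrt (le d) ps"
    using nxt_greedy[OF assms(1)] by metis
  have "nxt d S \<subseteq> S - set (filter (\<lambda>p. p \<in> S) ps)"
    using assms ps feas_restrict[OF assms ps(2)] finite_subset
    by (intro nxt_least) (auto intro: sorted_wrt_filter)
  then show ?thesis using ps assms by auto
qed

lemma feas_take: "feas R ps \<Longrightarrow> feas R (take i ps)"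
  by (metis append_take_drop_id feas_append)

text \<open>The last element written was in the buffer before that write, hence the
  decrement.\<close>

lemma feas_subset_first:
  assumes "finite R" "feas R xs" "xs \<noteq> []"
  shows "set xs \<subseteq> first R (M + (length xs - 1))"
proof -
  obtain ys z where xs: "xs = ys @ [z]" using assms(3) by (metis rev_exhaust)
  have "z \<in> win (R - set ys)" "feas R ys" using assms(2) by (simp_all add: xs feas_append)
  then show ?thesis using feas_seen[of R ys] assms(1) by (auto simp: xs)
qed

text \<open>If the other run wrote more elements beyond \<open>x\<close>, then it would do so before it passes \<open>x\<close>, while
  all the elements up to \<open>x\<close> that the first run writes wait in its buffer. It would write these as
  well and be the longer run.\<close>

lemma high_count:
  assumes fin: "finite R" and G: "greedy d (win R) R ps {} R1" and G': "greedy d' (win R) R qs {} R2"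
    and opp: "\<And>p q. le d' p q \<longleftrightarrow> le d q p" and len: "length qs \<le> length ps"
  shows "card {e \<in> set qs. \<not> le d e x} \<le> card {e \<in> set ps. \<not> le d e x}"
proof (rule ccontr)
  assume neg: "\<not> ?thesis"
  let ?low = "\<lambda>e. le d e x" and ?high = "\<lambda>e. \<not> le d e x"
  have fps: "feas R ps" "distinct ps" "sorted_wrt (le d) ps"
    using greedy_feas[OF G fin order_refl] greedy_sorted[OF G fin order_refl] feas_distinct by auto
  have fqs: "feas R qs" "distinct qs" "sorted_wrt (le d') qs"
    using greedy_feas[OF G' fin order_refl] greedy_sorted[OF G' fin order_refl] feas_distinct by auto
  define p where "p = length (takeWhile ?low ps)"
  define q where "q = length (takeWhile ?high qs)"
  have tp: "take p ps = takeWhile ?low ps" unfolding p_def by (metis takeWhile_eq_take)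
  have tq: "take q qs = takeWhile ?high qs" unfolding q_def by (metis takeWhile_eq_take)
  have lowps: "set (takeWhile ?low ps) = {e \<in> set ps. ?low e}"
    using sorted_split(1)[OF fps(3), of ?low] le_trans by blast
  have highps: "set (dropWhile ?low ps) = {e \<in> set ps. ?high e}"
    using sorted_split(2)[OF fps(3), of ?low] le_trans by blast
  have highqs: "set (takeWhile ?high qs) = {e \<in> set qs. ?high e}"
    using sorted_split(1)[OF fqs(3), of ?high] opp le_trans by blast
  have lowqs: "set (dropWhile ?high qs) = {e \<in> set qs. ?low e}"
    using sorted_split(2)[OF fqs(3), of ?high] opp le_trans by blast
  have p_le: "p \<le> length ps" "q \<le> length qs" by (simp_all add: p_def q_def length_takeWhile_le)
  have cp: "card {e \<in> set ps. ?high e} = length ps - p"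
    using distinct_card[OF distinct_dropWhile[OF fps(2), of ?low]] highps
    by (metis add_diff_cancel_left' length_append p_def takeWhile_dropWhile_id)
  have cq: "card {e \<in> set qs. ?high e} = q"
    using distinct_card[OF distinct_takeWhile[OF fqs(2), of ?high]] highqs by (simp add: q_def)
  have cq': "card {e \<in> set qs. ?low e} = length qs - q"
    using distinct_card[OF distinct_dropWhile[OF fqs(2), of ?high]] lowqs
    by (metis add_diff_cancel_left' length_append q_def takeWhile_dropWhile_id)
  have lt: "length ps - p < q" using neg cp cq by simp
  let ?V = "\<lambda>k. first R (M + k)"
  have finV: "finite (?V k)" for k using fin by (meson finite_subset first_subset)
  have Vp: "win (R - set (take p ps)) \<union> set (take p ps) = ?V p"
    using feas_seen[OF fin feas_take[OF fps(1)]] p_le by (simp add: min_def)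
  have Vq: "win (R - set (take q qs)) \<union> set (take q qs) = ?V q"
    using feas_seen[OF fin feas_take[OF fqs(1)]] p_le by (simp add: min_def)
  \<comment> \<open>The \<open>p\<close>-th write of \<open>ps\<close> is still low, so it has
    passed no high element, and a high one seen by then cannot be left over.\<close>
  have "{e \<in> ?V p. ?high e} \<subseteq> {e \<in> set ps. ?high e}"
  proof (rule subsetI, rule ccontr)
    fix e assume e: "e \<in> {e \<in> ?V p. ?high e}" and "e \<notin> {e \<in> set ps. ?high e}"
    then have ne: "e \<notin> set ps" by auto
    then have "e \<in> win (R - set (take p ps))" using e Vp by (auto dest: in_set_takeD)
    then have *: "p > 0" "\<not> le d (ps ! (p - 1)) e"
      using greedy_maximal[OF G fin order_refl p_le(1) _ ne] by auto
    have "ps ! (p - 1) \<in> set (take p ps)"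
      using * p_le by (auto simp: in_set_conv_nth intro!: exI[of _ "p - 1"])
    then have "le d (ps ! (p - 1)) x" using tp lowps by auto
    then show False using *(2) e le_total le_trans by blast
  qed
  then have Hp: "card {e \<in> ?V p. ?high e} \<le> length ps - p"
    unfolding cp[symmetric] by (intro card_mono) auto
  have "q > 0" using lt by simp
  have lq: "length (take q qs) = q" using p_le by simp
  then have "take q qs \<noteq> []" using \<open>q > 0\<close> by fastforce
  then have "set (take q qs) \<subseteq> ?V (q - 1)"
    using feas_subset_first[OF fin feas_take[OF fqs(1), of q]] unfolding lq by blast
  then have "set (take q qs) \<subseteq> {e \<in> ?V (q - 1). ?high e}" using tq highqs by auto
  then have "q \<le> card {e \<in> ?V (q - 1). ?high e}"
    using card_mono[OF finite_subset[OF _ finV[of "q - 1"]], of "{e \<in> ?V (q - 1). ?high e}" "set (take q qs)"]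
      distinct_card[OF distinct_take[OF fqs(2), of q]] p_le by auto
  then have lt2: "card {e \<in> ?V p. ?high e} < card {e \<in> ?V (q - 1). ?high e}" using Hp lt by simp
  \<comment> \<open>Just before its \<open>q\<close>-th write, \<open>qs\<close> has seen more high
    elements than \<open>ps\<close> had after \<open>p\<close> writes. Seen sets are nested, so
    \<open>ps\<close> had seen less.\<close>
  have "p \<le> q"
  proof (rule ccontr)
    assume "\<not> p \<le> q"
    then have "?V (q - 1) \<subseteq> ?V p" by (intro first_mono) simp
    then have "{e \<in> ?V (q - 1). ?high e} \<subseteq> {e \<in> ?V p. ?high e}" by auto
    then have "card {e \<in> ?V (q - 1). ?high e} \<le> card {e \<in> ?V p. ?high e}"
      using finV[of p] by (intro card_mono) auto
    then show False using lt2 by simp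
  qed
  \<comment> \<open>The low elements of \<open>ps\<close> are seen by time \<open>q\<close>. The
    last write of \<open>qs\<close> is then still high, so it has not passed them and must write
    them in its remaining \<open>length qs - q\<close> steps. This makes it longer than
    \<open>ps\<close>.\<close>
  have "set (take p ps) \<subseteq> {e \<in> set qs. ?low e}"
  proof (rule subsetI, rule ccontr)
    fix e assume e: "e \<in> set (take p ps)" "e \<notin> {e \<in> set qs. ?low e}"
    then have le: "le d e x" and ne: "e \<notin> set qs" using tp lowps by auto
    have "e \<in> ?V q" using e Vp first_mono[of "M + p" "M + q" R] \<open>p \<le> q\<close> by auto
    then have "e \<in> win (R - set (take q qs))" using Vq ne by (auto dest: in_set_takeD)
    then have *: "\<not> le d' (qs ! (q - 1)) e"
      using greedy_maximal[OF G' fin order_refl p_le(2) _ ne] by auto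
    have "qs ! (q - 1) \<in> set (take q qs)"
      using \<open>q > 0\<close> p_le by (auto simp: in_set_conv_nth intro!: exI[of _ "q - 1"])
    then have "\<not> le d (qs ! (q - 1)) x" using tq highqs by auto
    then show False using * le opp le_total le_trans by blast
  qed
  then have "card (set (take p ps)) \<le> length qs - q" unfolding cq'[symmetric] by (intro card_mono) auto
  then have "p \<le> length qs - q" using distinct_card[OF distinct_take[OF fps(2), of p]] p_le by simp
  then show False using lt len p_le \<open>q > 0\<close> by linarith
qed

text \<open>The last \<open>m\<close> elements of \<open>T\<close> in direction \<open>d\<close>,
  collected one at a time as first elements in the opposite direction.\<close>

lemma extremal_subset:
  "finite T \<Longrightarrow> m \<le> card T \<Longrightarrow> \<exists>S\<subseteq>T. card S = m \<and> (\<forall>s\<in>S. \<forall>t\<in>T - S. le d t s)"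
proof (induction m)
  case 0
  then show ?case by (intro exI[of _ "{}"]) auto
next
  case (Suc m)
  then obtain S where S: "S \<subseteq> T" "card S = m" "\<forall>s\<in>S. \<forall>t\<in>T - S. le d t s" by auto
  have fS: "finite S" using S Suc by (meson finite_subset)
  have "T - S \<noteq> {}" using S Suc card_mono[OF fS, of T] by auto
  then obtain u where u: "u \<in> T - S" "\<forall>t\<in>T - S. le (if d = 0 then 1 else 0) u t"
    using ex_extremal[of "T - S" "if d = 0 then 1 else 0"] Suc by auto
  have "\<forall>t\<in>T - S. le d t u" using u(2) by (auto simp: le_def)
  then show ?case using S u fS by (intro exI[of _ "insert u S"]) auto
qed

lemma win_tail:
  assumes fin: "finite R" and f: "feas R ps"
  shows "win (R - set ps) = first R (M + length ps) - set ps"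
    and "R - set ps - win (R - set ps) = R - first R (M + length ps)"
proof -
  have "win (R - set ps) \<inter> set ps = {}" using first_subset by blast
  then show "win (R - set ps) = first R (M + length ps) - set ps"
    "R - set ps - win (R - set ps) = R - first R (M + length ps)"
    using feas_seen[OF fin f] feas_subset[OF f] by auto
qed

text \<open>Needed for a position that no run produces: a chosen part of the seen elements, followed
  by the original unread part.\<close>

lemma win_tail_union:
  assumes fin: "finite R" and S: "S \<subseteq> first R k" "card S \<le> M" "R - first R k \<noteq> {} \<longrightarrow> card S = M"
  shows "win (S \<union> (R - first R k)) = S"
proof -
  have fS: "finite S" using S fin by (meson finite_subset first_subset)
  show ?thesis
  proof (cases "R - first R k = {}")
    case True
    then show ?thesis unfolding True Un_empty_right
      using card_first[OF fS, of M] S fS first_subset by (metis card_subset_eq min.absorb1)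
  next
    case False
    then have cS: "card S = M" using S by simp
    let ?Q = "S \<union> (R - first R k)"
    have lt: "a < b" if "a \<in> S" "b \<in> R - first R k" for a b
      using first_less[OF fin, of a k b] S that by auto
    have fQ: "finite ?Q" using fS fin by auto
    have "rank ?Q p < M" if "p \<in> S" for p
    proof -
      have "{q \<in> ?Q. q < p} \<subseteq> S - {p}" using lt[OF that] by fastforce
      then have "rank ?Q p \<le> card (S - {p})" unfolding rank_def using fS by (intro card_mono) auto
      then show ?thesis using that fS cS M_pos by simp
    qed
    moreover have "\<not> rank ?Q p < M" if "p \<in> R - first R k" for p
    proof -
      have "S \<subseteq> {q \<in> ?Q. q < p}" using lt that by auto
      then have "card S \<le> rank ?Q p" unfolding rank_def using fQ by (intro card_mono) auto
      then show ?thesis using cS by simp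
    qed
    ultimately show ?thesis by (auto simp: first_def)
  qed
qed

lemma card_win_full: "finite R \<Longrightarrow> R - win R \<noteq> {} \<Longrightarrow> card (win R) = M"
  using first_Suc(2) .

text \<open>Both leftovers are viewed inside the segment seen by the longer run. By
  \<open>high_count\<close> this run leaves there at most as many elements beyond any threshold,
  which is the hypothesis of \<open>greedy_dominates\<close> once the buffers have equal size.
  Cutting the other leftover down to that size only helps the other side, by
  \<open>nxt_mono\<close>.\<close>

theorem repeat_longer_run:
  assumes fin: "finite R" and opp: "(d = 0) \<noteq> (d' = 0)" and longer: "card (nxt d R) \<le> card (nxt d' R)"
  shows "nxt d (nxt d R) \<subseteq> nxt d (nxt d' R)"
proof -
  obtain ps where ps: "greedy d (win R) R ps {} (nxt d R)" "nxt d R = R - set ps" "feas R ps"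
    "distinct ps" "set ps \<subseteq> R"
    using nxt_greedy[OF fin] by metis
  obtain qs where qs: "greedy d' (win R) R qs {} (nxt d' R)" "nxt d' R = R - set qs" "feas R qs"
    "distinct qs" "set qs \<subseteq> R"
    using nxt_greedy[OF fin] by metis
  have len: "length qs \<le> length ps"
    using longer ps qs fin distinct_card[OF ps(4)] distinct_card[OF qs(4)]
      card_mono[OF fin ps(5)] card_mono[OF fin qs(5)] by (simp add: card_Diff_subset)
  let ?V = "first R (M + length ps)" and ?R1 = "R - set ps"
  let ?T = "?V - set qs"
  have finV: "finite ?V" using fin by (meson finite_subset first_subset)
  have psV: "set ps \<subseteq> ?V" using feas_seen[OF fin ps(3)] by auto
  have qsV: "set qs \<subseteq> ?V"
    using feas_seen[OF fin qs(3)] first_mono[of "M + length qs" "M + length ps" R] len by auto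
  have w1: "win ?R1 = ?V - set ps" and t1: "?R1 - win ?R1 = R - ?V"
    using win_tail[OF fin ps(3)] by auto
  have cT: "card (win ?R1) \<le> card ?T"
    unfolding w1 using psV qsV finV len distinct_card[OF ps(4)] distinct_card[OF qs(4)]
    by (simp add: card_Diff_subset)
  \<comment> \<open>Of what the shorter run leaves among the elements seen, keep only the part \<open>S\<close> that is worst for
    a run in direction \<open>d\<close>: the buffer left by the longer run is still at least as good.\<close>
  then obtain S where S: "S \<subseteq> ?T" "card S = card (win ?R1)" "\<forall>s\<in>S. \<forall>t\<in>?T - S. le d t s"
    using extremal_subset[of ?T "card (win ?R1)" d] finV by auto
  have fS: "finite S" using S(1) finV by (meson finite_Diff finite_subset)
  let ?Q = "S \<union> (R - ?V)"
  have wQ: "win ?Q = S"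
    using S fin card_first_le[of ?R1 M] card_win_full[of ?R1] t1
    by (intro win_tail_union) auto
  have Qsub: "?Q \<subseteq> R - set qs" using S(1) qsV first_subset[of R "M + length ps"] by auto
  have finQ: "finite ?Q" using Qsub fin by (meson finite_Diff finite_subset)
  obtain xs where xs: "nxt d ?Q = ?Q - set xs" "feas ?Q xs" "sorted_wrt (le d) xs" "set xs \<subseteq> ?Q"
    using nxt_greedy[OF finQ] by metis
  obtain rs where rs: "greedy d (win ?R1) ?R1 rs {} (nxt d ?R1)"
    using nxt_greedy[of ?R1 d] fin finite_Diff by metis
  have "nxt d ?R1 \<subseteq> ?Q - set xs"
  proof (rule greedy_dominates[OF rs _ order_refl finQ order_refl xs(2,3)])
    show "finite ?R1" using fin by simp
    show "set xs \<inter> win ?Q \<subseteq> win ?Q" by auto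
    show "?R1 - win ?R1 = ?Q - win ?Q" unfolding t1 wQ using S(1) by auto
    show "win ?R1 - win ?R1 \<subseteq> win ?Q - win ?Q" by auto
    show "\<forall>y. card {a \<in> win ?Q. le d a y} \<le> card {a \<in> win ?R1. le d a y}"
    proof
      fix y
      let ?h = "\<lambda>A. {a \<in> A. \<not> le d a y}" and ?l = "\<lambda>A. {a \<in> A. le d a y}"
      have split: "card (?l A) = card A - card (?h A)" "card (?h A) \<le> card A" if "finite A" for A
      proof -
        have "?l A = A - ?h A" by auto
        then show "card (?l A) = card A - card (?h A)" using that by (simp add: card_Diff_subset)
        show "card (?h A) \<le> card A" using that by (intro card_mono) auto
      qed
      \<comment> \<open>If an element of \<open>?T\<close> outside \<open>S\<close> lies beyond
        \<open>y\<close>, then all of \<open>S\<close> does and the left side is 0. Otherwise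
        \<open>S\<close> contains everything of \<open>?T\<close> beyond \<open>y\<close>, and
        \<open>high_count\<close> bounds that number from below.\<close>
      show "card (?l (win ?Q)) \<le> card (?l (win ?R1))"
      proof (cases "\<exists>t\<in>?T - S. \<not> le d t y")
        case True
        then have "\<not> le d s y" if "s \<in> S" for s using S(3) that le_trans by blast
        then have "?l S = {}" by auto
        then show ?thesis unfolding wQ by (metis card.empty le0)
      next
        case False
        then have "?h S = ?h ?T" using S(1) by auto
        moreover have "?h ?T = ?h ?V - ?h (set qs)" "?h (win ?R1) = ?h ?V - ?h (set ps)"
          using w1 by auto
        moreover have "?h (set qs) \<subseteq> ?h ?V" "?h (set ps) \<subseteq> ?h ?V" using psV qsV by auto
        moreover have "card (?h (set qs)) \<le> card (?h (set ps))"
          by (rule high_count[OF fin ps(1) qs(1) _ len]) (use opp in \<open>auto simp: le_def\<close>)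
        ultimately have "card (?h (win ?R1)) \<le> card (?h S)"
          using finV by (simp add: card_Diff_subset finite_subset)
        moreover have "finite (win ?R1)" unfolding w1 using finV by simp
        ultimately show ?thesis unfolding wQ using split[OF fS] split[of "win ?R1"] S(2) by simp
      qed
    qed
  qed
  also have "\<dots> \<subseteq> nxt d (R - set qs)" using nxt_mono[OF _ Qsub] fin unfolding xs(1)[symmetric] by simp
  finally show ?thesis using ps(2) qs(2) by simp
qed

end

section \<open>Values of positions and optimal play\<close>

context run_game
begin

text \<open>The number of elements written after the best \<open>j\<close> runs, except that a
  position emptied with \<open>i\<close> runs to spare counts \<open>N + i\<close>. The bonus makes
  an earlier finish worth more.\<close>

fun Val :: "nat \<Rightarrow> nat set \<Rightarrow> nat" where
  "Val 0 R = N - card R"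
| "Val (Suc j) R = (if R = {} then N + Suc j else max (Val j (nxt 0 R)) (Val j (nxt 1 R)))"

lemma finite_nxt: "finite R \<Longrightarrow> finite (nxt d R)"
  using nxt_subset finite_subset by (metis finite_Diff)

lemma nxt_le: "finite R \<Longrightarrow> nxt d R \<subseteq> R"
  using nxt_subset by blast

lemma nxt_empty [simp]: "nxt d {} = {}"
  using nxt_subset[of "{}" d] by simp

lemma nxt_cong: "(d = 0) = (d' = 0) \<Longrightarrow> nxt d R = nxt d' R"
proof -
  assume "(d = 0) = (d' = 0)"
  then have "le d = le d'" by (intro ext) (simp add: le_def)
  moreover have "greedy d A R ps B R'" if "greedy d' A R ps B R'" "le d = le d'" for d d' A ps B R R'
    using that by (induction) (auto intro: greedy.intros)
  ultimately have "greedy d = greedy d'" by (intro ext iffI) auto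
  then show ?thesis by (simp add: nxt_def)
qed

lemma Val_le: "Val j R \<le> N + j"
  by (induction j arbitrary: R) (auto simp: le_SucI)

lemma Val_empty [simp]: "Val j {} = N + j"
  by (cases j) auto

lemma Val_antimono: "finite R \<Longrightarrow> S \<subseteq> R \<Longrightarrow> Val j R \<le> Val j S"
proof (induction j arbitrary: R S)
  case 0
  then show ?case using card_mono[of R S] by (simp add: diff_le_mono2)
next
  case (Suc j)
  show ?case
  proof (cases "S = {}")
    case True
    then show ?thesis using Val_le[of "Suc j" R] by simp
  next
    case False
    then have "R \<noteq> {}" using Suc.prems by auto
    moreover have "Val j (nxt d R) \<le> Val j (nxt d S)" for d
      using Suc by (intro Suc.IH finite_nxt nxt_mono)
    ultimately show ?thesis unfolding Val.simps(2) using False by (simp only: if_False) (intro max.mono)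
  qed
qed

lemma Val_longer_1:
  assumes "finite R" "R \<noteq> {}" "card (nxt d R) \<le> card (nxt d' R)" "(d = 0) \<noteq> (d' = 0)"
  shows "Val (Suc 0) R = Val 0 (nxt d R)"
proof -
  have "nxt d R = nxt 0 R \<and> nxt d' R = nxt 1 R \<or> nxt d R = nxt 1 R \<and> nxt d' R = nxt 0 R"
    using assms(4) nxt_cong by (metis zero_neq_one)
  then show ?thesis using assms by auto
qed

text \<open>Of the two continuations of the shorter run, \<open>d' d\<close> is dominated by
  \<open>d d\<close>, which the first argument already covers. If the longer run empties the
  position, its value is the largest possible.\<close>

lemma Val_longer:
  assumes "finite R" "R \<noteq> {}" "card (nxt d R) \<le> card (nxt d' R)" "(d = 0) \<noteq> (d' = 0)"
  shows "Val (Suc (Suc j)) R = max (Val (Suc j) (nxt d R)) (Val j (nxt d' (nxt d' R)))"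
proof -
  have fin: "finite (nxt e R)" for e using finite_nxt assms(1) by blast
  have two: "Val (Suc i) S = max (Val i (nxt d S)) (Val i (nxt d' S))" if "S \<noteq> {}" for i S
  proof -
    have "nxt d S = nxt 0 S \<and> nxt d' S = nxt 1 S \<or> nxt d S = nxt 1 S \<and> nxt d' S = nxt 0 S"
      using assms(4) nxt_cong by (metis zero_neq_one)
    then show ?thesis using that by auto
  qed
  show ?thesis
  proof (cases "nxt d R = {}")
    case True
    then show ?thesis using two[OF assms(2), of "Suc j"] Val_le[of j "nxt d' (nxt d' R)"]
        Val_le[of "Suc j" "nxt d' R"] by (simp add: max_def)
  next
    case False
    then have ne: "nxt d' R \<noteq> {}" using assms(3) fin[of d] by (auto simp: card_gt_0_iff)
    have "Val j (nxt d (nxt d' R)) \<le> Val j (nxt d (nxt d R))"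
      by (intro Val_antimono finite_nxt fin repeat_longer_run assms)
    also have "\<dots> \<le> Val (Suc j) (nxt d R)"
      unfolding two[OF False, of j] by (rule max.cobounded1)
    finally show ?thesis
      unfolding two[OF assms(2), of "Suc j"] two[OF ne, of j] by (simp only: max.assoc[symmetric] max.absorb1)
  qed
qed

section \<open>Plays and solvability\<close>

inductive plays :: "nat set \<Rightarrow> nat list list \<Rightarrow> nat set \<Rightarrow> bool" where
  plays_Nil: "plays R [] R"
| plays_Cons: "feas R ps \<Longrightarrow> sorted_wrt (le d) ps \<Longrightarrow> plays (R - set ps) rs R' \<Longrightarrow> plays R (ps # rs) R'"

lemma plays_append: "plays R rs R' \<Longrightarrow> plays R' rs' R'' \<Longrightarrow> plays R (rs @ rs') R''"
  by (induction rule: plays.induct) (auto intro: plays.intros)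

lemma plays_feas: "plays R rs R' \<Longrightarrow> feas R (concat rs) \<and> R' = R - set (concat rs)"
  by (induction rule: plays.induct) (auto simp: feas_append)

text \<open>Solvability by greedy runs alone; \<open>plays_solvable\<close> shows that this loses
  nothing, so optimality becomes a statement about directions.\<close>

fun solvable :: "nat \<Rightarrow> nat set \<Rightarrow> bool" where
  "solvable 0 R \<longleftrightarrow> R = {}"
| "solvable (Suc m) R \<longleftrightarrow> R = {} \<or> solvable m (nxt 0 R) \<or> solvable m (nxt 1 R)"

lemma solvable_empty [simp]: "solvable m {}"
  by (cases m) auto

lemma solvable_mono: "finite R \<Longrightarrow> S \<subseteq> R \<Longrightarrow> solvable m R \<Longrightarrow> solvable m S"
proof (induction m arbitrary: R S)
  case (Suc m)
  have "solvable m (nxt d S)" if "solvable m (nxt d R)" for d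
    by (rule Suc.IH[OF finite_nxt[OF Suc.prems(1)] nxt_mono[OF Suc.prems(1,2)] that])
  then show ?case using Suc.prems by auto
qed simp

lemma plays_solvable: "plays R rs R' \<Longrightarrow> finite R \<Longrightarrow> R' = {} \<Longrightarrow> solvable (length rs) R"
proof (induction rule: plays.induct)
  case (plays_Cons R ps d rs R')
  have "nxt (if d = 0 then 0 else 1) R = nxt d R" by (intro nxt_cong) auto
  moreover have "solvable (length rs) (nxt d R)"
  proof (rule solvable_mono[OF _ nxt_least[OF plays_Cons.prems(1) plays_Cons.hyps(1,2)]])
    show "solvable (length rs) (R - set ps)" using plays_Cons.IH plays_Cons.prems by simp
  qed (use plays_Cons.prems in simp)
  ultimately show ?case by (cases "d = 0") simp_all
qed simp

text \<open>Finishing with \<open>m\<close> of \<open>j\<close> runs earns a bonus of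
  \<open>j - m\<close>. In reverse, a value below \<open>N\<close> excludes every solution with at
  most \<open>j\<close> runs.\<close>

lemma solvable_Val: "solvable m R \<Longrightarrow> m \<le> j \<Longrightarrow> N + j - m \<le> Val j R"
proof (induction m arbitrary: j R)
  case (Suc m)
  show ?case
  proof (cases "R = {}")
    case False
    obtain i where i: "j = Suc i" using Suc.prems by (cases j) auto
    obtain d where "solvable m (nxt d R)" "d = 0 \<or> d = 1" using Suc.prems False by auto
    then show ?thesis using Suc.IH[of "nxt d R" i] Suc.prems i False by (auto simp: le_max_iff_disj)
  qed simp
qed simp

text \<open>An invariant of the positions that can occur in a game, not literal reachability.\<close>

definition reachable :: "nat set \<Rightarrow> bool" where
  "reachable R \<longleftrightarrow> R \<subseteq> {..<N} \<and> (\<exists>r\<le>N. R - win R = {r..<N})"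

lemma reachable_finite: "reachable R \<Longrightarrow> finite R"
  unfolding reachable_def using finite_subset by blast

lemma tail_step:
  assumes "finite R" "p \<in> win R" "R - win R = {r..<N}"
  shows "win (R - {p}) = win R - {p} \<union> (if r < N then {r} else {})"
    and "R - {p} - win (R - {p}) = {Suc r..<N}"
proof -
  have fS: "first R (Suc M) = win R \<union> (if r < N then {r} else {})"
  proof (cases "r < N")
    case True
    then have ne: "R - win R \<noteq> {}" using assms(3) by auto
    have "Min {r..<N} = r" using True by (intro Min_eqI) auto
    then show ?thesis using first_Suc(1)[OF assms(1) ne] True by (simp add: assms(3))
  next
    case False
    then have "win R = R" using assms(3) first_subset[of R M] by auto
    then show ?thesis using False first_mono[of M "Suc M" R] first_subset[of R "Suc M"] by auto
  qed
  have "r \<notin> win R \<and> r \<in> R" if "r < N" using assms(3) that by (metis Diff_iff atLeastLessThan_iff order_refl)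
  then show "win (R - {p}) = win R - {p} \<union> (if r < N then {r} else {})"
    using win_step[OF assms(1,2)] fS assms(2) by auto
  have "R - {p} - win (R - {p}) = R - first R (Suc M)"
    unfolding win_step[OF assms(1,2)] using assms(2) fS by blast
  also have "\<dots> = (R - win R) - (if r < N then {r} else {})" unfolding fS by blast
  also have "\<dots> = {Suc r..<N}" unfolding assms(3) by auto
  finally show "R - {p} - win (R - {p}) = {Suc r..<N}" .
qed

lemma reachable_step:
  assumes "reachable R" "p \<in> win R"
  shows "reachable (R - {p})"
proof -
  obtain r where r: "r \<le> N" "R - win R = {r..<N}" using assms(1) unfolding reachable_def by blast
  have "R - {p} - win (R - {p}) = {min N (Suc r)..<N}"
    unfolding tail_step(2)[OF reachable_finite[OF assms(1)] assms(2) r(2)] by (auto simp: min_def)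
  then show ?thesis using assms(1) unfolding reachable_def by (metis Diff_subset min.cobounded1 order_trans)
qed

lemma reachable_feas: "reachable R \<Longrightarrow> feas R ps \<Longrightarrow> reachable (R - set ps)"
proof (induction ps arbitrary: R)
  case (Cons p ps)
  then show ?case using Cons.IH[of "R - {p}"] reachable_step by (simp add: Diff_insert2[symmetric])
qed simp

lemma reachable_nxt: "reachable R \<Longrightarrow> reachable (nxt d R)"
  using reachable_feas reachable_finite nxt_greedy by metis

lemma reachable_card_N: "reachable R \<Longrightarrow> card R \<le> N"
  using card_mono[of "{..<N}" R] unfolding reachable_def by auto

text \<open>If \<open>R\<close> has unread input, then its buffer is full, so having at most as many
  elements as \<open>S\<close> forces its unread part into that of \<open>S\<close>. Any run,
  whatever its direction, empties the present buffer and leaves only a part of the unread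
  rest.\<close>

lemma catch_up:
  assumes R: "reachable R" and S: "reachable S" and le: "card R \<le> card S"
  shows "nxt d R \<subseteq> S"
proof -
  obtain r where r: "r \<le> N" "R - win R = {r..<N}" using R unfolding reachable_def by blast
  obtain s where s: "s \<le> N" "S - win S = {s..<N}" using S unfolding reachable_def by blast
  have fin: "finite R" "finite S" using R S reachable_finite by auto
  have card: "card T = card (win T) + (N - t)" if "finite T" "T - win T = {t..<N}" for T t
  proof -
    have "card T = card (win T) + card (T - win T)"
      using card_Diff_subset[OF _ first_subset, of T M] that card_mono[OF that(1) first_subset, of M]
        finite_subset[OF first_subset that(1)] by simp
    then show ?thesis using that by simp
  qed
  show ?thesis
  proof (cases "r < N")
    case True
    then have "card (win R) = M" using r card_win_full[OF fin(1)] by auto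
    then have "M + (N - r) \<le> M + (N - s)"
      using card[OF fin(1) r(2)] card[OF fin(2) s(2)] le card_first_le[OF fin(2), of M] by simp
    then have "s \<le> r" using True by simp
    then have "R - win R \<subseteq> S - win S" unfolding r(2) s(2) by simp
    then show ?thesis using nxt_subset[OF fin(1), of d] by blast
  next
    case False
    then have "R - win R = {}" using r by simp
    then show ?thesis using nxt_subset[OF fin(1), of d] by blast
  qed
qed

text \<open>\<open>S\<close> is where the first \<open>j\<close> directions of a solution lead. A
  position that is emptied earlier stays empty.\<close>

lemma solvable_split:
  "reachable R \<Longrightarrow> solvable m R \<Longrightarrow> j \<le> m \<Longrightarrow>
    \<exists>S. reachable S \<and> solvable (m - j) S \<and> N - card S \<le> Val j R"
proof (induction j arbitrary: m R)
  case (Suc j)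
  obtain n where m: "m = Suc n" using Suc.prems by (cases m) auto
  show ?case
  proof (cases "R = {}")
    case True
    then show ?thesis using Suc.prems by (intro exI[of _ "{}"]) auto
  next
    case False
    obtain d where d: "solvable n (nxt d R)" "d = 0 \<or> d = 1" using Suc.prems False m by auto
    then obtain S where "reachable S" "solvable (n - j) S" "N - card S \<le> Val j (nxt d R)"
      using Suc.IH[of "nxt d R" n] Suc.prems m reachable_nxt by auto
    then show ?thesis using d(2) False m by (intro exI[of _ S]) (auto simp: le_max_iff_disj)
  qed
qed auto

lemma commit_catch_up:
  assumes "reachable R" "solvable m R" "j \<le> m" "reachable R'" "Val j R = N - card R'"
  shows "solvable (m - j) (nxt d R')"
proof -
  obtain S where S: "reachable S" "solvable (m - j) S" "N - card S \<le> Val j R"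
    using solvable_split assms by blast
  then have "card R' \<le> card S"
    using assms(5) reachable_card_N[OF S(1)] reachable_card_N[OF assms(4)] by linarith
  then show ?thesis
    using catch_up[OF assms(4) S(1)] solvable_mono[OF reachable_finite[OF S(1)] _ S(2)] by blast
qed

section \<open>Correspondence with strategies, run counts and \<open>OPT\<close>\<close>

lemma writes_feas:
  "reachable R \<Longrightarrow> R - win R = {r..<N} \<Longrightarrow> r \<le> N \<Longrightarrow>
    writes N (win R) r ps \<longleftrightarrow> feas R ps \<and> set ps = R"
proof (induction ps arbitrary: R r)
  case Nil
  have fin: "finite R" using Nil.prems reachable_finite by blast
  have "writes N (win R) r [] \<longleftrightarrow> win R = {} \<and> r = N" by (auto elim: writes.cases intro: writes.intros)
  also have "\<dots> \<longleftrightarrow> R = {}"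
  proof
    assume "win R = {} \<and> r = N"
    then show "R = {}" using Nil.prems by auto
  next
    assume "R = {}"
    then show "win R = {} \<and> r = N" using Nil.prems first_subset[of R M] by auto
  qed
  finally show ?case by auto
next
  case (Cons p ps)
  have fin: "finite R" using Cons.prems reachable_finite by blast
  have sub: "set (p # ps) = R \<longleftrightarrow> set ps = R - {p}" if "p \<in> R" "feas (R - {p}) ps"
    using feas_subset[OF that(2)] that(1) by auto
  \<comment> \<open>\<open>min N (Suc r)\<close> treats \<open>refill\<close> and
    \<open>drain\<close> alike: the read position advances by one until it stops at
    \<open>N\<close>.\<close>
  have IH: "writes N (win (R - {p})) (min N (Suc r)) ps \<longleftrightarrow> feas (R - {p}) ps \<and> set ps = R - {p}"
    if p: "p \<in> win R"
  proof (rule Cons.IH)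
    show "reachable (R - {p})" using reachable_step[OF Cons.prems(1) p] .
    show "R - {p} - win (R - {p}) = {min N (Suc r)..<N}"
      unfolding tail_step(2)[OF fin p Cons.prems(2)] by (auto simp: min_def)
  qed simp
  have step: "writes N (win R) r (p # ps) \<longleftrightarrow> p \<in> win R \<and> writes N (win (R - {p})) (min N (Suc r)) ps"
  proof (cases "r < N")
    case True
    have "writes N (win R) r (p # ps) \<longleftrightarrow> p \<in> win R \<and> writes N (insert r (win R - {p})) (Suc r) ps"
      using True by (auto elim: writes.cases intro: writes.intros)
    moreover have "min N (Suc r) = Suc r" using True by simp
    ultimately show ?thesis using tail_step(1)[OF fin _ Cons.prems(2)] True by auto
  next
    case False
    then have "r = N" using Cons.prems by simp
    then have "writes N (win R) r (p # ps) \<longleftrightarrow> p \<in> win R \<and> writes N (win R - {p}) N ps"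
      by (auto elim: writes.cases intro: writes.intros)
    then show ?thesis using tail_step(1)[OF fin _ Cons.prems(2)] \<open>r = N\<close> by (auto simp: min_def)
  qed
  show ?case using step IH sub first_subset[of R M] by auto
qed

lemma win_initial: "win {..<n} = {..<min M n}"
proof -
  have "rank {..<n} p = p" if "p < n" for p
  proof -
    have "{q \<in> {..<n}. q < p} = {..<p}" using that by auto
    then show ?thesis by (simp add: rank_def)
  qed
  then show ?thesis by (auto simp: first_def)
qed

lemma reachable_initial: "reachable {..<N}" "{..<N} - win {..<N} = {min M N..<N}"
  unfolding reachable_def win_initial by (auto intro!: exI[of _ "min M N"])

lemma strategies_feas: "ps \<in> strategies M N \<longleftrightarrow> feas {..<N} ps \<and> set ps = {..<N}"
  using writes_feas[OF reachable_initial, of ps]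
  by (simp add: strategies_def win_initial atLeast0LessThan)

lemma is_run_map: "is_run (map (\<lambda>p. I ! p) ps) \<longleftrightarrow> (\<exists>d. sorted_wrt (le d) ps)"
proof -
  have "le 0 = (\<lambda>p q. I ! p \<le> I ! q)" and d: "d \<noteq> 0 \<Longrightarrow> le d = (\<lambda>p q. I ! q \<le> I ! p)" for d
    by (auto simp: le_def fun_eq_iff)
  then have 0: "sorted_wrt (le 0) ps \<longleftrightarrow> sorted (map (\<lambda>p. I ! p) ps)"
    and 1: "d \<noteq> 0 \<Longrightarrow> sorted_wrt (le d) ps \<longleftrightarrow> sorted (rev (map (\<lambda>p. I ! p) ps))" for d
    by (simp_all add: sorted_wrt_map sorted_wrt_rev)
  show ?thesis unfolding is_run_def using 0 1 by (metis zero_neq_one)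
qed

lemma num_runs_plays:
  assumes "plays R rs {}"
  shows "num_runs (output_of I (concat rs)) \<le> length rs"
proof -
  have "\<forall>ps\<in>set rs. \<exists>d. sorted_wrt (le d) ps" using assms
    by (induction R rs "{}::nat set" rule: plays.induct) auto
  then show ?thesis unfolding num_runs_def output_of_def
    by (intro Least_le exI[of _ "map (map (\<lambda>p. I ! p)) rs"]) (auto simp: is_run_map map_concat)
qed

lemma num_runs_split:
  obtains rs where "length rs = num_runs S" "concat rs = S" "\<forall>r\<in>set rs. is_run r"
proof -
  \<comment> \<open>Cutting into single elements shows that the \<open>LEAST\<close> in
    \<open>num_runs\<close> ranges over a nonempty set.\<close>
  have "\<exists>rs. length rs = length S \<and> concat rs = S \<and> (\<forall>r\<in>set rs. is_run r)"
    by (intro exI[of _ "map (\<lambda>x. [x]) S"]) (auto simp: is_run_def)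
  then have "\<exists>rs. length rs = num_runs S \<and> concat rs = S \<and> (\<forall>r\<in>set rs. is_run r)"
    unfolding num_runs_def by (rule LeastI)
  then show ?thesis using that by blast
qed

text \<open>Runs cut a sequence of elements, whereas plays consist of positions; the cut has to be
  pulled back along the map.\<close>

lemma map_eq_concat: "map f ps = concat rs \<Longrightarrow> \<exists>pss. concat pss = ps \<and> map (map f) pss = rs"
proof (induction rs arbitrary: ps)
  case (Cons r rs)
  then obtain us vs where "ps = us @ vs" "map f us = r" "map f vs = concat rs"
    by (auto simp: map_eq_append_conv)
  moreover from this obtain pss where "concat pss = vs" "map (map f) pss = rs" using Cons.IH by blast
  ultimately show ?case by (intro exI[of _ "us # pss"]) auto
qed simp

lemma plays_concat:
  "feas R (concat rs) \<Longrightarrow> \<forall>ps\<in>set rs. \<exists>d. sorted_wrt (le d) ps \<Longrightarrow> plays R rs (R - set (concat rs))"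
proof (induction rs arbitrary: R)
  case (Cons ps rs)
  then obtain d where "sorted_wrt (le d) ps" by auto
  moreover have "R - set (concat (ps # rs)) = R - set ps - set (concat rs)" by auto
  ultimately show ?case using Cons.prems by (simp only:) (intro plays_Cons Cons.IH, auto simp: feas_append)
qed (auto intro: plays.intros)

lemma solvable_num_runs:
  assumes "ps \<in> strategies M N"
  shows "solvable (num_runs (output_of I ps)) {..<N}"
proof -
  obtain rs where rs: "length rs = num_runs (output_of I ps)" "concat rs = output_of I ps"
    "\<forall>r\<in>set rs. is_run r" using num_runs_split by blast
  obtain pss where pss: "concat pss = ps" "map (map (\<lambda>p. I ! p)) pss = rs"
    using map_eq_concat[of "\<lambda>p. I ! p" ps rs] rs(2) unfolding output_of_def by metis
  have "\<forall>ps\<in>set pss. \<exists>d. sorted_wrt (le d) ps" using rs(3) pss(2) is_run_map by auto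
  then have "plays {..<N} pss {}" using plays_concat[of "{..<N}" pss] assms pss(1) strategies_feas by simp
  then have "solvable (length pss) {..<N}" using plays_solvable by blast
  then show ?thesis using pss(2) rs(1) by auto
qed

text \<open>Existence of a strategy makes the \<open>LEAST\<close> in \<open>OPT\<close> attained;
  in the end the computed output itself supplies one.\<close>

lemma solvable_OPT:
  assumes "strategies M N \<noteq> {}"
  shows "solvable (OPT M I) {..<N}"
proof -
  have "\<exists>k. \<exists>S\<in>outputs M I. num_runs S = k" using assms by (auto simp: outputs_def)
  then have "\<exists>S\<in>outputs M I. num_runs S = OPT M I" unfolding OPT_def by (rule LeastI_ex)
  then obtain ps where "ps \<in> strategies M N" "num_runs (output_of I ps) = OPT M I"
    by (auto simp: outputs_def)
  then show ?thesis using solvable_num_runs by metis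
qed

end

section \<open>Budgeted execution\<close>

text \<open>Budgeted execution: the postcondition also receives what is left of the time budget.\<close>

definition bexec :: "nat \<Rightarrow> 'a::linorder list \<Rightarrow> cmd \<Rightarrow> state \<Rightarrow> nat \<Rightarrow> (nat \<Rightarrow> state \<Rightarrow> bool) \<Rightarrow> bool" where
  "bexec W I c s T Q \<longleftrightarrow> (\<exists>t s' T'. exec W I c s t s' \<and> t + T' \<le> T \<and> Q T' s')"

text \<open>Charges a command its full bound \<open>K\<close> instead of its actual time, so that
  the remaining budget is known exactly.\<close>

lemma bexec_weaken:
  assumes "bexec W I c s K P" "K \<le> T" "\<And>T' s'. P T' s' \<Longrightarrow> Q (T - K) s'"
  shows "bexec W I c s T Q"
proof -
  obtain t s' T' where *: "exec W I c s t s'" "t + T' \<le> K" "P T' s'"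
    using assms(1) unfolding bexec_def by blast
  then have "t + (T - K) \<le> T" "Q (T - K) s'" using assms(2,3) by auto
  then show ?thesis using * unfolding bexec_def by blast
qed

lemma bexec_Seq: "bexec W I c s T (\<lambda>T' s'. bexec W I d s' T' Q) \<Longrightarrow> bexec W I (Seq c d) s T Q"
  unfolding bexec_def
proof (elim exE conjE)
  fix t s' T' t' s'' T''
  assume "exec W I c s t s'" "exec W I d s' t' s''" "t + T' \<le> T" "t' + T'' \<le> T'" "Q T'' s''"
  then show "\<exists>t s' T'. exec W I (Seq c d) s t s' \<and> t + T' \<le> T \<and> Q T' s'"
    by (intro exI[of _ "t + t'"] exI[of _ s''] exI[of _ T'']) (auto intro: exec.Seq)
qed

lemma bexec_1: "exec W I c s 1 s' \<Longrightarrow> 1 \<le> T \<Longrightarrow> Q (T - 1) s' \<Longrightarrow> bexec W I c s T Q"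
  unfolding bexec_def by (intro exI[of _ 1] exI[of _ s'] exI[of _ "T - 1"]) auto

lemma bexec_Skip: "1 \<le> T \<Longrightarrow> Q (T - 1) s \<Longrightarrow> bexec W I Skip s T Q"
  by (rule bexec_1[OF exec.Skip])

lemma bexec_Const: "v < W \<Longrightarrow> 1 \<le> T \<Longrightarrow> Q (T - 1) (set_reg i v s) \<Longrightarrow> bexec W I (Const i v) s T Q"
  by (rule bexec_1[OF exec.Const])

lemma bexec_Copy: "1 \<le> T \<Longrightarrow> Q (T - 1) (set_reg i (reg s j) s) \<Longrightarrow> bexec W I (Copy i j) s T Q"
  by (rule bexec_1[OF exec.Copy])

lemma bexec_Add: "reg s j + reg s k < W \<Longrightarrow> 1 \<le> T \<Longrightarrow> Q (T - 1) (set_reg i (reg s j + reg s k) s) \<Longrightarrow>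
    bexec W I (Add i j k) s T Q"
  by (rule bexec_1[OF exec.Add])

lemma bexec_Sub: "1 \<le> T \<Longrightarrow> Q (T - 1) (set_reg i (reg s j - reg s k) s) \<Longrightarrow> bexec W I (Sub i j k) s T Q"
  by (rule bexec_1[OF exec.Sub])

lemma bexec_Half: "1 \<le> T \<Longrightarrow> Q (T - 1) (set_reg i (reg s j div 2) s) \<Longrightarrow> bexec W I (Half i j) s T Q"
  by (rule bexec_1[OF exec.Half])

lemma bexec_Load: "1 \<le> T \<Longrightarrow> Q (T - 1) (set_reg i (arr s a (reg s j)) s) \<Longrightarrow> bexec W I (Load i a j) s T Q"
  by (rule bexec_1[OF exec.Load])

lemma bexec_Store: "1 \<le> T \<Longrightarrow> Q (T - 1) (set_arr a (reg s j) (reg s i) s) \<Longrightarrow> bexec W I (Store a j i) s T Q"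
  by (rule bexec_1[OF exec.Store])

lemma bexec_Write: "1 \<le> T \<Longrightarrow> Q (T - 1) (s\<lparr>out := out s @ [reg s i]\<rparr>) \<Longrightarrow> bexec W I (Write i) s T Q"
  by (rule bexec_1[OF exec.Write])

lemma bexec_Cond:
  assumes "test_defined I b s" "1 \<le> T"
    "test_true I b s \<Longrightarrow> bexec W I c s (T - 1) Q" "\<not> test_true I b s \<Longrightarrow> bexec W I d s (T - 1) Q"
  shows "bexec W I (Cond b c d) s T Q"
proof (cases "test_true I b s")
  case True
  then obtain t s' T' where "exec W I c s t s'" "t + T' \<le> T - 1" "Q T' s'"
    using assms(3) unfolding bexec_def by blast
  then show ?thesis unfolding bexec_def using exec.Cond_true[OF assms(1) True] assms(2)
    by (intro exI[of _ "t + 1"] exI[of _ s'] exI[of _ T']) auto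
next
  case False
  then obtain t s' T' where "exec W I d s t s'" "t + T' \<le> T - 1" "Q T' s'"
    using assms(4) unfolding bexec_def by blast
  then show ?thesis unfolding bexec_def using exec.Cond_false[OF assms(1) False] assms(2)
    by (intro exI[of _ "t + 1"] exI[of _ s'] exI[of _ T']) auto
qed

lemma bexec_While_true:
  assumes "test_defined I b s" "test_true I b s" "1 \<le> T"
    "bexec W I c s (T - 1) (\<lambda>T' s'. bexec W I (While b c) s' T' Q)"
  shows "bexec W I (While b c) s T Q"
proof -
  obtain t s' T' t' s'' T'' where *: "exec W I c s t s'" "t + T' \<le> T - 1"
    "exec W I (While b c) s' t' s''" "t' + T'' \<le> T'" "Q T'' s''"
    using assms(4) unfolding bexec_def by blast
  then show ?thesis unfolding bexec_def using exec.While_true[OF assms(1,2) *(1,3)] assms(3)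
    by (intro exI[of _ "t + t' + 1"] exI[of _ s''] exI[of _ T'']) auto
qed

lemma bexec_While_false:
  "test_defined I b s \<Longrightarrow> \<not> test_true I b s \<Longrightarrow> 1 \<le> T \<Longrightarrow> Q (T - 1) s \<Longrightarrow> bexec W I (While b c) s T Q"
  by (rule bexec_1[OF exec.While_false])

fun block :: "cmd list \<Rightarrow> cmd" where
  "block [] = Skip"
| "block [c] = c"
| "block (c # cs) = Seq c (block cs)"

lemmas bexec_intros = bexec_Seq bexec_Skip bexec_Const bexec_Copy bexec_Add bexec_Sub bexec_Half
  bexec_Load bexec_Store bexec_Write bexec_Cond

lemma reg_set_reg [simp]: "reg (set_reg i v s) k = (if k = i then v else reg s k)"
  by (simp add: set_reg_def)
lemma arr_set_reg [simp]: "arr (set_reg i v s) = arr s"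
  by (simp add: set_reg_def)
lemma out_set_reg [simp]: "out (set_reg i v s) = out s"
  by (simp add: set_reg_def)
lemma reg_set_arr [simp]: "reg (set_arr a j v s) = reg s"
  by (simp add: set_arr_def)
lemma arr_set_arr [simp]: "arr (set_arr a j v s) b = (if b = a then (arr s a)(j := v) else arr s b)"
  by (simp add: set_arr_def)
lemma out_set_arr [simp]: "out (set_arr a j v s) = out s"
  by (simp add: set_arr_def)


section \<open>The search program\<close>

abbreviation (input) rN :: nat where "rN \<equiv> 0"
abbreviation (input) rM :: nat where "rM \<equiv> 1"
abbreviation (input) rZero :: nat where "rZero \<equiv> 2"
abbreviation (input) rOne :: nat where "rOne \<equiv> 3"
abbreviation (input) rDir :: nat where "rDir \<equiv> 4"
abbreviation (input) rPos :: nat where "rPos \<equiv> 5"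
abbreviation (input) rEntry :: nat where "rEntry \<equiv> 6"
abbreviation (input) rNode :: nat where "rNode \<equiv> 7"
abbreviation (input) rChild :: nat where "rChild \<equiv> 8"
abbreviation (input) rX :: nat where "rX \<equiv> 9"
abbreviation (input) rY :: nat where "rY \<equiv> 10"
abbreviation (input) rKeyX :: nat where "rKeyX \<equiv> 11"
abbreviation (input) rKeyY :: nat where "rKeyY \<equiv> 12"
abbreviation (input) rRoot :: nat where "rRoot \<equiv> 13"
abbreviation (input) rLast :: nat where "rLast \<equiv> 14"
abbreviation (input) rJ :: nat where "rJ \<equiv> 15"
abbreviation (input) rNew :: nat where "rNew \<equiv> 16"
abbreviation (input) rVal :: nat where "rVal \<equiv> 17"
abbreviation (input) rDown :: nat where "rDown \<equiv> 18"
abbreviation (input) rUp :: nat where "rUp \<equiv> 19"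

text \<open>Level \<open>l\<close> of the search keeps its buffer in array \<open>Suc l\<close>, the buffer size in \<open>rSize l\<close>, the
  next unread position in \<open>rRead l\<close>, and two more registers. Array 0 holds the tournament tree.\<close>

definition rSize :: "nat \<Rightarrow> nat" where "rSize l = 20 + 4 * l"
definition rRead :: "nat \<Rightarrow> nat" where "rRead l = 21 + 4 * l"
definition rSave :: "nat \<Rightarrow> nat" where "rSave l = 22 + 4 * l"
definition rLong :: "nat \<Rightarrow> nat" where "rLong l = 23 + 4 * l"

lemma level_regs [simp]:
  "rSize l = rSize m \<longleftrightarrow> l = m" "rRead l = rRead m \<longleftrightarrow> l = m"
  "rSave l = rSave m \<longleftrightarrow> l = m" "rLong l = rLong m \<longleftrightarrow> l = m"
  "rSize l \<noteq> rRead m" "rRead m \<noteq> rSize l" "rSize l \<noteq> rSave m" "rSave m \<noteq> rSize l"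
  "rSize l \<noteq> rLong m" "rLong m \<noteq> rSize l" "rRead l \<noteq> rSave m" "rSave m \<noteq> rRead l"
  "rRead l \<noteq> rLong m" "rLong m \<noteq> rRead l" "rSave l \<noteq> rLong m" "rLong m \<noteq> rSave l"
  unfolding rSize_def rRead_def rSave_def rLong_def by presburger+

lemma level_regs_ge [simp]:
  "n < 20 \<Longrightarrow> rSize l \<noteq> n" "n < 20 \<Longrightarrow> rRead l \<noteq> n" "n < 20 \<Longrightarrow> rSave l \<noteq> n" "n < 20 \<Longrightarrow> rLong l \<noteq> n"
  "n < 20 \<Longrightarrow> n \<noteq> rSize l" "n < 20 \<Longrightarrow> n \<noteq> rRead l" "n < 20 \<Longrightarrow> n \<noteq> rSave l" "n < 20 \<Longrightarrow> n \<noteq> rLong l"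
  "n < 20 \<Longrightarrow> \<not> rSize l \<le> n" "n < 20 \<Longrightarrow> \<not> rRead l \<le> n" "n < 20 \<Longrightarrow> \<not> rSave l \<le> n" "n < 20 \<Longrightarrow> \<not> rLong l \<le> n"
  unfolding rSize_def rRead_def rSave_def rLong_def by simp_all

text \<open>The direction is a run-time value because the search computes it.\<close>

definition branch_key :: "nat \<Rightarrow> nat \<Rightarrow> cmd \<Rightarrow> cmd \<Rightarrow> cmd" where
  "branch_key i j c d = Cond (Equal rDir rZero) (Cond (Key_le i j) c d) (Cond (Key_le j i) c d)"

text \<open>A tree node holds 0 if its subtree has no active position, and otherwise the successor of
  the best one. The leaf of position \<open>p\<close> is node \<open>N + p\<close>, and the initial memory is the empty tree.\<close>

definition update_node :: cmd where
  "update_node = block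
    [Add rChild rNode rNode, Load rX 0 rChild, Add rChild rChild rOne, Load rY 0 rChild,
     Cond (Equal rX rZero) (Store 0 rNode rY) (Cond (Equal rY rZero) (Store 0 rNode rX)
       (block [Sub rKeyX rX rOne, Sub rKeyY rY rOne,
         branch_key rKeyX rKeyY (Store 0 rNode rX) (Store 0 rNode rY)]))]"

definition update_path :: cmd where
  "update_path = While (Less rOne rNode) (Seq (Half rNode rNode) update_node)"

definition update :: cmd where
  "update = block [Add rNode rN rPos, Store 0 rNode rEntry, update_path]"

definition insert_all :: "nat \<Rightarrow> cmd" where
  "insert_all l = While (Less rJ (rSize l))
     (block [Load rPos (Suc l) rJ, Add rEntry rPos rOne, update, Add rJ rJ rOne])"

text \<open>An element that the current run cannot take waits in the array, which in this way grows
  into the buffer of the next position.\<close>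

definition refill :: "nat \<Rightarrow> cmd" where
  "refill l = Cond (Less (rRead l) rN)
     (block [Copy rNew (rRead l), Add (rRead l) (rRead l) rOne,
       branch_key rLast rNew
         (block [Copy rPos rNew, Add rEntry rPos rOne, update])
         (block [Store (Suc l) (rSize l) rNew, Add (rSize l) (rSize l) rOne])])
     Skip"

definition write_all :: "bool \<Rightarrow> nat \<Rightarrow> cmd" where
  "write_all wr l = While (Less rZero rRoot)
     (block [Sub rPos rRoot rOne, Copy rEntry rZero, update, Copy rLast rPos,
       (if wr then Write rPos else Skip), refill l, Load rRoot 0 rOne])"

text \<open>The whole buffer moves into the tree before level \<open>l'\<close> is overwritten, so
  \<open>l' = l\<close> is possible as well; committed runs use this.\<close>

definition do_run :: "bool \<Rightarrow> nat \<Rightarrow> nat \<Rightarrow> cmd" where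
  "do_run wr l l' = block
    [Copy rJ rZero, insert_all l, Copy (rRead l') (rRead l), Copy (rSize l') rZero,
     Load rRoot 0 rOne, write_all wr l']"

text \<open>Positions read minus positions buffered is the number of elements written so far. A tie
  selects direction 0.\<close>

definition probe :: "nat \<Rightarrow> cmd" where
  "probe l = block
    [Copy rDir rOne, do_run False l (Suc l), Sub rDown (rRead (Suc l)) (rSize (Suc l)),
     Copy rDir rZero, do_run False l (Suc l), Sub rUp (rRead (Suc l)) (rSize (Suc l)),
     Cond (Less rUp rDown) (Copy (rLong l) rOne) (Copy (rLong l) rZero)]"

text \<open>\<open>probe\<close> overwrites level \<open>Suc l\<close>, so the longer run is
  simulated again before the search descends. The shorter run is followed at once by another one in
  its own direction, which is why that branch continues two levels down with depth
  \<open>j\<close>.\<close>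

fun explore :: "nat \<Rightarrow> nat \<Rightarrow> cmd" where
  "explore 0 l = Sub rVal (rRead l) (rSize l)"
| "explore (Suc 0) l = Cond (Equal (rSize l) rZero) (block [Const rVal 1, Add rVal rVal rN])
     (block [probe l, Copy rDir (rLong l), do_run False l (Suc l), explore 0 (Suc l)])"
| "explore (Suc (Suc j)) l = Cond (Equal (rSize l) rZero) (block [Const rVal (Suc (Suc j)), Add rVal rVal rN])
     (block [probe l, Copy rDir (rLong l), do_run False l (Suc l), explore (Suc j) (Suc l),
       Copy (rSave l) rVal, Sub rDir rOne (rLong l), do_run False l (Suc l),
       do_run False (Suc l) (Suc (Suc l)), explore j (Suc (Suc l)),
       Cond (Less rVal (rSave l)) (Copy rVal (rSave l)) Skip])"

fun commit :: "nat \<Rightarrow> cmd" where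
  "commit 0 = Skip"
| "commit (Suc j) = Cond (Equal (rSize 0) rZero) Skip
     (block [Copy rDir rOne, do_run False 0 1, explore j 1, Copy (rSave 0) rVal,
       Copy rDir rZero, do_run False 0 1, explore j 1,
       Cond (Less rVal (rSave 0)) (Copy rDir rOne) (Copy rDir rZero),
       do_run True 0 0, commit j])"

text \<open>The direction of the extra run is arbitrary, since \<open>catch_up\<close> holds for
  both.\<close>

definition phases :: "nat \<Rightarrow> cmd" where
  "phases D = While (Less rZero (rSize 0)) (block [commit D, Copy rDir rZero, do_run True 0 0])"

definition fill_buffer :: cmd where
  "fill_buffer = While (Less rJ (rSize 0)) (block [Store 1 rJ rJ, Add rJ rJ rOne])"

definition program :: "nat \<Rightarrow> cmd" where
  "program D = block
    [Const rOne 1, Cond (Less rM rN) (Copy (rSize 0) rM) (Copy (rSize 0) rN),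
     Copy (rRead 0) (rSize 0), Copy rJ rZero, fill_buffer, phases D]"


section \<open>The tournament tree\<close>

fun height :: "nat \<Rightarrow> nat" where
  "height n = (if n \<le> 1 then 0 else Suc (height (n div 2)))"

declare height.simps [simp del]

lemma height_mono: "m \<le> n \<Longrightarrow> height m \<le> height n"
proof (induction n arbitrary: m rule: less_induct)
  case (less n)
  show ?case
  proof (cases "m \<le> 1")
    case False
    then have "height (m div 2) \<le> height (n div 2)" using less.prems by (intro less.IH div_le_mono) auto
    then show ?thesis using False less.prems height.simps[of m] height.simps[of n] by simp
  qed (simp add: height.simps)
qed

text \<open>\<open>W_bound\<close> covers the largest words: tree indices stay below
  \<open>2 * N\<close>, and values are at most \<open>N + D\<close>.\<close>

locale machine = run_game I M for I :: "'a::linorder list" and M +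
  fixes W D :: nat
  assumes W_bound: "2 * length I + D + 4 \<le> W"
begin

abbreviation "bx \<equiv> bexec W I"

definition better :: "nat \<Rightarrow> nat \<Rightarrow> nat \<Rightarrow> nat" where
  "better d x y = (if x = 0 then y else if y = 0 then x else if le d (x - 1) (y - 1) then x else y)"

text \<open>Node \<open>m\<close> may disagree with its children: it is the pending node while an
  update climbs to the root. The zeros outside the tree make the empty tree equal to the zero array.
  Any \<open>N\<close> is allowed, not only powers of two.\<close>

definition tree_upto :: "nat \<Rightarrow> nat set \<Rightarrow> nat \<Rightarrow> (nat \<Rightarrow> nat) \<Rightarrow> bool" where
  "tree_upto d A m a \<longleftrightarrow> a 0 = 0 \<and> (\<forall>k\<ge>2 * N. a k = 0) \<and> (\<forall>k. a k \<le> N) \<and>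
    (\<forall>p<N. a (N + p) = (if p \<in> A then Suc p else 0)) \<and>
    (\<forall>k. 1 \<le> k \<longrightarrow> k < N \<longrightarrow> k \<noteq> m \<longrightarrow> a k = better d (a (2 * k)) (a (Suc (2 * k))))"

text \<open>The node 0 does not exist, so nothing is exempt from consistency in a \<open>tree\<close>.\<close>

abbreviation tree :: "nat \<Rightarrow> nat set \<Rightarrow> (nat \<Rightarrow> nat) \<Rightarrow> bool" where
  "tree d A \<equiv> tree_upto d A 0"

lemma tree_member:
  assumes "tree d A a" "a k \<noteq> 0"
  shows "a k - 1 \<in> A"
  using assms(2)
proof (induction "2 * N - k" arbitrary: k rule: less_induct)
  case less
  then have k: "0 < k" "k < 2 * N" using assms(1) unfolding tree_upto_def by (metis gr0I, metis linorder_not_le)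
  show ?case
  proof (cases "k < N")
    case True
    then have "a k = better d (a (2 * k)) (a (Suc (2 * k)))" using assms(1) k unfolding tree_upto_def by auto
    then have "a k = a (2 * k) \<or> a k = a (Suc (2 * k))" by (auto simp: better_def split: if_splits)
    then show ?thesis using less.hyps[of "2 * k"] less.hyps[of "Suc (2 * k)"] less.prems k True by auto
  next
    case False
    then obtain p where p: "k = N + p" by (metis le_add_diff_inverse linorder_not_le)
    then have "p < N" using k by simp
    then have "a (N + p) = (if p \<in> A then Suc p else 0)" using assms(1) unfolding tree_upto_def by blast
    then show ?thesis using less.prems p by (simp split: if_splits)
  qed
qed

text \<open>Each step to the parent keeps an entry at least as good.\<close>

lemma tree_root:
  assumes "tree d A a" "a k \<noteq> 0"
  shows "a 1 \<noteq> 0 \<and> le d (a 1 - 1) (a k - 1)"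
  using assms(2)
proof (induction k rule: less_induct)
  case (less k)
  then have k: "0 < k" "k < 2 * N" using assms(1) unfolding tree_upto_def by (metis gr0I, metis linorder_not_le)
  show ?case
  proof (cases "k = 1")
    case False
    let ?m = "k div 2"
    have m: "1 \<le> ?m" "?m < N" "?m < k" "k = 2 * ?m \<or> k = Suc (2 * ?m)" using k False by auto
    then have "a ?m = better d (a (2 * ?m)) (a (Suc (2 * ?m)))" using assms(1) unfolding tree_upto_def by auto
    then have "a ?m \<noteq> 0 \<and> le d (a ?m - 1) (a k - 1)"
      using m(4) less.prems le_total le_refl by (metis better_def)
    then show ?thesis using less.IH[OF m(3)] le_trans by blast
  qed (use less.prems in simp)
qed

lemma tree_active:
  assumes "tree d A a" "q \<in> A" "A \<subseteq> {..<N}"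
  shows "a 1 \<noteq> 0 \<and> le d (a 1 - 1) q"
proof -
  have "a (N + q) = Suc q" using assms unfolding tree_upto_def by auto
  then show ?thesis using tree_root[OF assms(1), of "N + q"] by simp
qed

text \<open>The right side mentions no direction: a completed run leaves a tree that can serve a run
  in either direction without being cleared.\<close>

lemma tree_empty: "tree d {} a \<longleftrightarrow> a = (\<lambda>_. 0)"
proof
  assume "tree d {} a"
  then show "a = (\<lambda>_. 0)" using tree_member by blast
next
  assume "a = (\<lambda>_. 0)"
  then show "tree d {} a" by (simp add: tree_upto_def better_def)
qed

definition frame :: "nat set \<Rightarrow> nat set \<Rightarrow> state \<Rightarrow> state \<Rightarrow> bool" where
  "frame Rs As s s' \<longleftrightarrow> (\<forall>k. k \<notin> Rs \<longrightarrow> reg s' k = reg s k) \<and> (\<forall>a. a \<notin> As \<longrightarrow> arr s' a = arr s a)"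

lemma frame_refl: "frame Rs As s s" by (simp add: frame_def)
lemma frame_trans: "frame Rs As s s' \<Longrightarrow> frame Rs' As' s' s'' \<Longrightarrow> Rs \<subseteq> Rs'' \<Longrightarrow> Rs' \<subseteq> Rs'' \<Longrightarrow>
    As \<subseteq> As'' \<Longrightarrow> As' \<subseteq> As'' \<Longrightarrow> frame Rs'' As'' s s''"
  unfolding frame_def by (metis subsetD)
lemma frame_reg: "frame Rs As s s' \<Longrightarrow> k \<notin> Rs \<Longrightarrow> reg s' k = reg s k"
  by (simp add: frame_def)
lemma frame_arr: "frame Rs As s s' \<Longrightarrow> a \<notin> As \<Longrightarrow> arr s' a = arr s a"
  by (simp add: frame_def)

definition std_regs :: "state \<Rightarrow> bool" where
  "std_regs s \<longleftrightarrow> reg s rN = N \<and> reg s rZero = 0 \<and> reg s rOne = 1"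

lemma bexec_branch_key:
  assumes "reg s rZero = 0" "reg s i < N" "reg s j < N" "2 \<le> T"
    and "le (reg s rDir) (reg s i) (reg s j) \<Longrightarrow> bx c s (T - 2) Q"
    and "\<not> le (reg s rDir) (reg s i) (reg s j) \<Longrightarrow> bx d s (T - 2) Q"
  shows "bx (branch_key i j c d) s T Q"
  unfolding branch_key_def
  by (intro bexec_Cond) (use assms in \<open>auto simp: le_def numeral_2_eq_2\<close>)

text \<open>Repairing a node hands the exemption on to its parent. The parent of the root is 0, so
  then every node is consistent.\<close>

lemma update_node_correct:
  assumes c: "std_regs s" and t: "tree_upto d A (reg s rNode) (arr s 0)" and d: "reg s rDir = d"
    and i: "1 \<le> reg s rNode" "reg s rNode < N"
  shows "bx update_node s 12 (\<lambda>_ s'. frame {8..12} {0} s s' \<and> out s' = out s \<and>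
    tree_upto d A (reg s rNode div 2) (arr s' 0))"
proof -
  let ?i = "reg s rNode" and ?a = "arr s 0"
  have tr: "tree_upto d A (?i div 2) (?a(?i := better d (?a (2 * ?i)) (?a (Suc (2 * ?i)))))"
    (is "tree_upto d A _ ?a'")
  proof -
    have b: "better d (?a (2 * ?i)) (?a (Suc (2 * ?i))) \<le> N" using t by (auto simp: tree_upto_def better_def)
    have "?a' k = better d (?a' (2 * k)) (?a' (Suc (2 * k)))" if "1 \<le> k" "k < N" "k \<noteq> ?i div 2" for k
    proof -
      have "2 * k \<noteq> ?i" "Suc (2 * k) \<noteq> ?i" using that(3) by auto
      then show ?thesis using that t i by (cases "k = ?i") (auto simp: tree_upto_def)
    qed
    then show ?thesis using t b i unfolding tree_upto_def by auto
  qed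
  have le: "?a k \<le> N" for k using t by (simp add: tree_upto_def)
  have lt: "?a k - Suc 0 < N" if "?a k \<noteq> 0" for k using le[of k] that by linarith
  have two: "?i + ?i = 2 * ?i" by simp
  show ?thesis unfolding update_node_def block.simps
    apply (intro bexec_intros bexec_branch_key)
    using c d i W_bound le lt tr
    by (simp_all add: std_regs_def frame_def better_def two split: if_splits)
qed

end

section \<open>Runs on the machine\<close>

lemma bexec_use:
  "bexec W I c s0 K P \<Longrightarrow> s = s0 \<Longrightarrow> K \<le> T \<Longrightarrow> (\<And>T' s'. P T' s' \<Longrightarrow> Q (T - K) s') \<Longrightarrow>
    bexec W I c s T Q"
  by (simp add: bexec_weaken)

lemma bexec_start: "bexec W I c s0 K Q \<Longrightarrow> s = s0 \<Longrightarrow> K \<le> T \<Longrightarrow> bexec W I c s T Q"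
  unfolding bexec_def by (meson order_trans)

lemma bexec_call:
  "bexec W I c s0 K P \<Longrightarrow> s = s0 \<Longrightarrow> K \<le> T \<Longrightarrow>
    (\<And>T' s'. P T' s' \<Longrightarrow> bexec W I d s' (T - K) Q) \<Longrightarrow> bexec W I (Seq c d) s T Q"
  by (rule bexec_Seq) (rule bexec_use)

context machine
begin

lemma std_regs_frame: "std_regs s \<Longrightarrow> frame Rs As s s' \<Longrightarrow> 0 \<notin> Rs \<Longrightarrow> 2 \<notin> Rs \<Longrightarrow> 3 \<notin> Rs \<Longrightarrow> std_regs s'"
  by (simp add: std_regs_def frame_def)

lemma update_path_correct:
  assumes "std_regs s" "reg s rDir = d" "tree_upto d A (reg s rNode div 2) (arr s 0)"
    "1 \<le> reg s rNode" "reg s rNode < 2 * N"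
  shows "bx update_path s (16 * height (reg s rNode) + 1)
    (\<lambda>_ s'. frame {7..12} {0} s s' \<and> out s' = out s \<and> tree d A (arr s' 0))"
  using assms
proof (induction "reg s rNode" arbitrary: s rule: less_induct)
  case less
  note c = less.prems(1) and d = less.prems(2) and t = less.prems(3) and i = less.prems(4,5)
  show ?case
  proof (cases "reg s rNode = 1")
    case True
    then show ?thesis unfolding update_path_def
      by (intro bexec_While_false) (use c t in \<open>auto simp: std_regs_def frame_refl\<close>)
  next
    case False
    let ?s = "set_reg rNode (reg s rNode div 2) s" and ?i = "reg s rNode"
    have h: "height ?i = Suc (height (?i div 2))" using False i by (simp add: height.simps[of ?i])
    have node: "bx update_node ?s 12 (\<lambda>_ s'. frame {8..12} {0} ?s s' \<and> out s' = out ?s \<and>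
        tree_upto d A (reg ?s rNode div 2) (arr s' 0))"
      by (rule update_node_correct) (use c d t i False in \<open>auto simp: std_regs_def\<close>)
    show ?thesis
      unfolding update_path_def
    proof (rule bexec_While_true)
      show "bx (Seq (Half rNode rNode) update_node) s (16 * height ?i + 1 - 1)
        (\<lambda>T' s'. bx (While (Less rOne rNode) (Seq (Half rNode rNode) update_node)) s' T'
          (\<lambda>_ s'. frame {7..12} {0} s s' \<and> out s' = out s \<and> tree d A (arr s' 0)))"
      proof (intro bexec_Seq bexec_Half, simp add: h, rule bexec_weaken[OF node])
        fix T' s'
        assume s': "frame {8..12} {0} ?s s' \<and> out s' = out ?s \<and> tree_upto d A (reg ?s rNode div 2) (arr s' 0)"
        then have r: "reg s' rNode = ?i div 2" "reg s' rDir = d" "std_regs s'"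
          using d c by (auto simp: frame_def std_regs_def)
        have "bx update_path s' (16 * height (reg s' rNode) + 1)
            (\<lambda>_ s''. frame {7..12} {0} s' s'' \<and> out s'' = out s' \<and> tree d A (arr s'' 0))"
          by (rule less.hyps) (use r s' i False in auto)
        then show "bx (While (Less rOne rNode) (Seq (Half rNode rNode) update_node)) s'
          (16 * height ?i + 1 - 1 - 1 - 12)
          (\<lambda>_ s'. frame {7..12} {0} s s' \<and> out s' = out s \<and> tree d A (arr s' 0))"
          unfolding update_path_def
        proof (rule bexec_weaken)
          show "16 * height (reg s' rNode) + 1 \<le> 16 * height ?i + 1 - 1 - 1 - 12" using r h by simp
          fix s'' assume "frame {7..12} {0} s' s'' \<and> out s'' = out s' \<and> tree d A (arr s'' 0)"
          then show "frame {7..12} {0} s s'' \<and> out s'' = out s \<and> tree d A (arr s'' 0)"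
            using s' by (auto simp: frame_def)
        qed
      qed (simp add: h)
    qed (use c i False in \<open>auto simp: std_regs_def\<close>)
  qed
qed

definition update_time :: nat where "update_time = 16 * height (2 * N) + 3"

lemma update_correct:
  assumes c: "std_regs s" and d: "reg s rDir = d" and t: "tree d A (arr s 0)" and p: "reg s rPos < N"
    and v: "reg s rEntry = (if ins then Suc (reg s rPos) else 0)"
  shows "bx update s update_time
    (\<lambda>_ s'. frame {7..12} {0} s s' \<and> out s' = out s \<and>
      tree d (if ins then insert (reg s rPos) A else A - {reg s rPos}) (arr s' 0))"
proof -
  let ?p = "reg s rPos" and ?A = "if ins then insert (reg s rPos) A else A - {reg s rPos}"
  let ?a = "(arr s 0)(N + ?p := reg s rEntry)"
  let ?s = "set_arr 0 (N + ?p) (reg s rEntry) (set_reg rNode (N + ?p) s)"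
  have tree: "tree_upto d ?A ((N + ?p) div 2) ?a"
  proof -
    have "?a k = better d (?a (2 * k)) (?a (Suc (2 * k)))" if "1 \<le> k" "k < N" "k \<noteq> (N + ?p) div 2" for k
    proof -
      have "2 * k \<noteq> N + ?p" "Suc (2 * k) \<noteq> N + ?p" using that(3) by auto
      then show ?thesis using that t by (auto simp: tree_upto_def)
    qed
    then show ?thesis using t p v unfolding tree_upto_def by auto
  qed
  have "height (N + ?p) \<le> height (2 * N)" using p by (intro height_mono) auto
  moreover have "bx update_path ?s (16 * height (reg ?s rNode) + 1)
      (\<lambda>_ s'. frame {7..12} {0} ?s s' \<and> out s' = out ?s \<and> tree d ?A (arr s' 0))"
    by (rule update_path_correct) (use c d tree p in \<open>auto simp: std_regs_def\<close>)
  ultimately have path: "bx update_path ?s (16 * height (2 * N) + 1)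
      (\<lambda>_ s'. frame {7..12} {0} s s' \<and> out s' = out s \<and> tree d ?A (arr s' 0))"
    by - (erule bexec_weaken, auto simp: frame_def)
  show ?thesis unfolding update_def block.simps update_time_def
    by (intro bexec_Seq bexec_Add bexec_Store)
      (use c p W_bound path in \<open>simp_all add: std_regs_def split del: if_split\<close>)
qed

definition stored :: "nat \<Rightarrow> nat list \<Rightarrow> state \<Rightarrow> bool" where
  "stored l ys s \<longleftrightarrow> reg s (rSize l) = length ys \<and> (\<forall>j<length ys. arr s (Suc l) j = ys ! j)"

lemma insert_all_correct:
  assumes "std_regs s" "reg s rDir = d" "stored l xs s" "set xs \<subseteq> {..<N}" "length xs \<le> N"
    "reg s rJ \<le> length xs" "tree d (set (take (reg s rJ) xs)) (arr s 0)"
  shows "bx (insert_all l) s ((length xs - reg s rJ) * (update_time + 4) + 1)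
    (\<lambda>_ s'. frame {5..16} {0} s s' \<and> out s' = out s \<and> tree d (set xs) (arr s' 0))"
  using assms
proof (induction "length xs - reg s rJ" arbitrary: s)
  case 0
  then show ?case unfolding insert_all_def
    by (intro bexec_While_false) (auto simp: stored_def frame_refl)
next
  case (Suc n)
  let ?j = "reg s rJ"
  note H = Suc.prems
  have j: "?j < length xs" using Suc.hyps(2) by simp
  then have p: "xs ! ?j < N" using H(4) by (metis lessThan_iff nth_mem subsetD)
  let ?s = "set_reg rEntry (Suc (xs ! ?j)) (set_reg rPos (xs ! ?j) s)"
  have up: "bx update ?s update_time (\<lambda>_ s'. frame {7..12} {0} ?s s' \<and> out s' = out ?s \<and>
      tree d (if True then insert (reg ?s rPos) (set (take ?j xs)) else set (take ?j xs) - {reg ?s rPos}) (arr s' 0))"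
    by (rule update_correct) (use H p in \<open>auto simp: std_regs_def\<close>)
  let ?T = "(length xs - ?j) * (update_time + 4) + 1"
  have T: "?T = n * (update_time + 4) + 1 + update_time + 4" using Suc.hyps(2)[symmetric] by simp
  show ?case
    unfolding insert_all_def block.simps
  proof (rule bexec_While_true, goal_cases)
    case 4
    show ?case
      apply (intro bexec_Seq bexec_Load bexec_Add)
      subgoal unfolding T by simp
      subgoal using H j p W_bound by (simp add: std_regs_def stored_def)
      subgoal unfolding T by simp
      apply (rule bexec_use[OF up])
      subgoal using H j by (simp add: std_regs_def stored_def)
      subgoal unfolding T by simp
      subgoal premises u for T' s'
      proof -
        have u': "frame {7..12} {0} ?s s'" "out s' = out s" "tree d (insert (xs ! ?j) (set (take ?j xs))) (arr s' 0)"
          using u by simp_all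
        let ?s' = "set_reg rJ (Suc ?j) s'"
        have r: "reg s' rJ = ?j" "reg s' rOne = 1" using u'(1) H by (auto simp: frame_def std_regs_def)
        have IH: "bx (insert_all l) ?s' ((length xs - reg ?s' rJ) * (update_time + 4) + 1)
          (\<lambda>_ s''. frame {5..16} {0} ?s' s'' \<and> out s'' = out ?s' \<and> tree d (set xs) (arr s'' 0))"
        proof (rule Suc.hyps(1))
          show "n = length xs - reg ?s' rJ" using Suc.hyps(2) by simp
          show "tree d (set (take (reg ?s' rJ) xs)) (arr ?s' 0)"
            using u'(3) j by (simp add: take_Suc_conv_app_nth)
        qed (use H j u'(1) in \<open>auto simp: frame_def std_regs_def stored_def\<close>)
        show ?thesis
          apply (intro bexec_Add)
          subgoal using r H j W_bound by simp
          subgoal unfolding T by simp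
          apply (rule bexec_use[OF IH[unfolded insert_all_def block.simps]])
          subgoal by (simp add: r)
          subgoal unfolding T using Suc.hyps(2) by simp
          subgoal using u' by (auto simp: frame_def)
          done
      qed
      done
  qed (use j H in \<open>auto simp: stored_def\<close>)
qed

lemma refill_correct:
  assumes c: "std_regs s" and d: "reg s rDir = d" and t: "tree d B (arr s 0)" and p: "reg s rLast = p" "p < N"
    and r: "reg s (rRead l) = r" "r \<le> N" and ys: "stored l ys s" "length ys \<le> N"
  shows "bx (refill l) s (update_time + 7)
    (\<lambda>_ s'. frame ({5..16} \<union> {rSize l, rRead l}) {0, Suc l} s s' \<and> out s' = out s \<and>
      reg s' (rRead l) = min N (Suc r) \<and>
      stored l (if r < N \<and> \<not> le d p r then ys @ [r] else ys) s' \<and>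
      tree d (B \<union> (if r < N \<and> le d p r then {r} else {})) (arr s' 0))"
proof (cases "r < N")
  case False
  then show ?thesis unfolding refill_def
    by (intro bexec_Cond bexec_Skip) (use c r t ys in \<open>auto simp: std_regs_def frame_refl\<close>)
next
  case True
  let ?s = "set_reg (rRead l) (Suc r) (set_reg rNew r s)"
  let ?sa = "set_reg rEntry (Suc r) (set_reg rPos r ?s)"
  have up: "bx update ?sa update_time (\<lambda>_ s'. frame {7..12} {0} ?sa s' \<and> out s' = out ?sa \<and>
      tree d (if True then insert (reg ?sa rPos) B else B - {reg ?sa rPos}) (arr s' 0))"
    by (rule update_correct) (use c d t True in \<open>auto simp: std_regs_def\<close>)
  show ?thesis unfolding refill_def block.simps
    apply (intro bexec_Cond bexec_Seq bexec_Copy bexec_Add bexec_Skip bexec_branch_key bexec_Store)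
    using c d p r ys True W_bound
                        apply (simp_all add: std_regs_def)
    subgoal
      apply (rule bexec_weaken[OF up])
       apply simp
      apply (auto simp: frame_def stored_def)
      done
    using t by (auto simp: frame_def stored_def nth_append)
qed

text \<open>The order within the array is left open, because each run begins by moving the buffer
  into the tree.\<close>

definition holds :: "nat \<Rightarrow> nat set \<Rightarrow> state \<Rightarrow> bool" where
  "holds l R s \<longleftrightarrow> R \<subseteq> {..<N} \<and> (\<exists>ys. distinct ys \<and> set ys = win R \<and> stored l ys s) \<and>
    reg s (rRead l) \<le> N \<and> R - win R = {reg s (rRead l)..<N}"

lemma holds_frame:
  "holds l R s \<Longrightarrow> frame Rs As s s' \<Longrightarrow> rSize l \<notin> Rs \<Longrightarrow> rRead l \<notin> Rs \<Longrightarrow> Suc l \<notin> As \<Longrightarrow> holds l R s'"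
  by (auto simp: holds_def stored_def frame_def)

lemma holds_reachable: "holds l R s \<Longrightarrow> reachable R"
  unfolding holds_def reachable_def by blast

lemma greedy_append: "greedy d A R ps B R' \<Longrightarrow> greedy d B R' qs C R'' \<Longrightarrow> greedy d A R (ps @ qs) C R''"
  by (induction rule: greedy.induct) (auto intro: greedy.intros)

text \<open>The hypotheses are the loop invariant: a partial greedy run \<open>ps\<close> from the
  fixed start \<open>R\<close> has reached \<open>R'\<close>, its active set is in the tree, and the
  blocked part of the buffer is in the array. With \<open>R\<close> fixed, uniqueness identifies the
  final position as \<open>nxt d R\<close>. Each write pays for one deletion and at most one
  insertion.\<close>

lemma write_all_correct:
  assumes "reachable R" "greedy d (win R) R ps A R'"
    "std_regs s" "reg s rDir = d" "tree d A (arr s 0)" "reg s rRoot = arr s 0 1"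
    "distinct ys" "set ys = win R' - A" "stored l ys s"
    "reg s (rRead l) \<le> N" "R' - win R' = {reg s (rRead l)..<N}"
  shows "bx (write_all wr l) s ((card R' - card (nxt d R)) * (2 * update_time + 13) + 1)
    (\<lambda>_ s'. frame ({5..16} \<union> {rSize l, rRead l}) {0, Suc l} s s' \<and> holds l (nxt d R) s' \<and>
      arr s' 0 = (\<lambda>_. 0) \<and>
      (\<exists>qs. greedy d (win R) R (ps @ qs) {} (nxt d R) \<and> out s' = out s @ (if wr then qs else [])))"
  using assms
proof (induction "card R'" arbitrary: R' s ps A ys rule: less_induct)
  case less
  note H = less.prems
  let ?r = "reg s (rRead l)"
  have fin: "finite R" using H(1) reachable_finite by blast
  have feas: "feas R ps" "R' = R - set ps" "A \<subseteq> win R'"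
    using greedy_feas[OF H(2) fin order_refl] greedy_remaining[OF H(2)]
      greedy_active[OF H(2) fin order_refl] by auto
  then have R': "reachable R'" "finite R'" using reachable_feas H(1) reachable_finite by auto
  have sub: "R' \<subseteq> {..<N}" "win R' \<subseteq> {..<N}" using R'(1) first_subset[of R' M] unfolding reachable_def by auto
  obtain qs where qs: "greedy d A R' qs {} (nxt d R)"
    using greedy_exists[OF R'(2) feas(3)] nxt_eq[OF fin] greedy_append[OF H(2)] by metis
  have nx: "nxt d R \<subseteq> R' - A" using greedy_remaining[OF qs] greedy_writes_active[OF qs] by auto
  show ?case
  proof (cases "arr s 0 1 = 0")
    case True
    \<comment> \<open>An empty root means that nothing is active, so the partial run is
      complete.\<close>
    then have A: "A = {}" using tree_active[OF H(5)] feas(3) sub by blast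
    then have "nxt d R = R'" using nxt_eq[OF fin] H(2) by blast
    moreover have "arr s 0 = (\<lambda>_. 0)" using H(5) A tree_empty by simp
    moreover have "holds l R' s" using H A sub unfolding holds_def by auto
    ultimately show ?thesis unfolding write_all_def
      by (intro bexec_While_false) (use H A True in \<open>auto simp: std_regs_def frame_refl intro!: exI[of _ "[]"]\<close>)
  next
    case False
    let ?p = "arr s 0 1 - 1"
    have pA: "?p \<in> A" using tree_member[OF H(5) False] .
    have pmin: "\<forall>q\<in>A. le d ?p q" using tree_active[OF H(5)] feas(3) sub by blast
    have pw: "?p \<in> win R'" "?p \<in> R'" "?p < N" using pA feas(3) first_subset[of R' M] sub by blast+
    let ?A' = "A - {?p} \<union> {e \<in> win (R' - {?p}) - win R'. le d ?p e}"
    have g: "greedy d (win R) R (ps @ [?p]) ?A' (R' - {?p})" by (rule greedy_snoc[OF H(2) pA pmin])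
    have w: "win (R' - {?p}) = win R' - {?p} \<union> (if ?r < N then {?r} else {})"
      "R' - {?p} - win (R' - {?p}) = {Suc ?r..<N}"
      using tail_step[OF R'(2) pw(1) H(11)] by auto
    have rw: "?r \<notin> win R'" if "?r < N" using H(11) that by (metis Diff_iff atLeastLessThan_iff order_refl)
    have A': "?A' = A - {?p} \<union> (if ?r < N \<and> le d ?p ?r then {?r} else {})"
      using w(1) rw by auto
    let ?ys = "if ?r < N \<and> \<not> le d ?p ?r then ys @ [?r] else ys"
    have ys': "distinct ?ys" "set ?ys = win (R' - {?p}) - ?A'"
      using H(7,8) rw w(1) feas(3) pA unfolding A' by auto
    have lys: "length ys \<le> N"
    proof -
      have "card (set ys) \<le> card {..<N}" using H(8) sub by (intro card_mono) auto
      then show ?thesis using distinct_card[OF H(7)] by simp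
    qed
    have cR: "card (R' - {?p}) < card R'" by (rule card_Diff1_less[OF R'(2) pw(2)])
    have cnx: "card (nxt d R) < card R'"
    proof -
      have "nxt d R \<subset> R'" using nx pA pw by blast
      then show ?thesis using R'(2) by (intro psubset_card_mono)
    qed
    let ?T = "(card R' - card (nxt d R)) * (2 * update_time + 13) + 1"
    let ?T' = "(card (R' - {?p}) - card (nxt d R)) * (2 * update_time + 13) + 1"
    have T: "?T = ?T' + (2 * update_time + 13)"
    proof -
      have "card R' - card (nxt d R) = Suc (card (R' - {?p}) - card (nxt d R))"
        using cnx pw R'(2) by simp
      then show ?thesis by simp
    qed
    let ?s1 = "set_reg rEntry 0 (set_reg rPos ?p s)"
    have up: "bx update ?s1 update_time (\<lambda>_ s'. frame {7..12} {0} ?s1 s' \<and> out s' = out ?s1 \<and>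
        tree d (if False then insert (reg ?s1 rPos) A else A - {reg ?s1 rPos}) (arr s' 0))"
      by (rule update_correct) (use H pw in \<open>auto simp: std_regs_def\<close>)
    let ?Q = "\<lambda>_ s'. frame ({5..16} \<union> {rSize l, rRead l}) {0, Suc l} s s' \<and> holds l (nxt d R) s' \<and>
      arr s' 0 = (\<lambda>_. 0) \<and>
      (\<exists>qs. greedy d (win R) R (ps @ qs) {} (nxt d R) \<and> out s' = out s @ (if wr then qs else []))"
    have rest: "bx (Seq (refill l) (Load rRoot 0 rOne)) sa (Ta + update_time + 8) (\<lambda>T' s'. bx (write_all wr l) s' T' ?Q)"
      if sa: "frame {5..14} {0} s sa" "reg sa rLast = ?p" "tree d (A - {?p}) (arr sa 0)"
        "out sa = out s @ (if wr then [?p] else [])" "?T' \<le> Ta" for sa Ta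
    proof (rule bexec_call)
      show "bx (refill l) sa (update_time + 7)
        (\<lambda>_ s'. frame ({5..16} \<union> {rSize l, rRead l}) {0, Suc l} sa s' \<and> out s' = out sa \<and>
          reg s' (rRead l) = min N (Suc ?r) \<and> stored l ?ys s' \<and>
          tree d (A - {?p} \<union> (if ?r < N \<and> le d ?p ?r then {?r} else {})) (arr s' 0))"
        by (rule refill_correct)
          (use sa H pw lys in \<open>auto simp: frame_def std_regs_def stored_def\<close>)
      show "sa = sa" ..
      show "update_time + 7 \<le> Ta + update_time + 8" by simp
      fix T' s3
      assume s3: "frame ({5..16} \<union> {rSize l, rRead l}) {0, Suc l} sa s3 \<and> out s3 = out sa \<and>
          reg s3 (rRead l) = min N (Suc ?r) \<and> stored l ?ys s3 \<and>
          tree d (A - {?p} \<union> (if ?r < N \<and> le d ?p ?r then {?r} else {})) (arr s3 0)"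
      let ?s4 = "set_reg rRoot (arr s3 0 1) s3"
      have f: "frame ({5..16} \<union> {rSize l, rRead l}) {0, Suc l} s ?s4"
        using sa(1) s3 by (auto simp: frame_def)
      have c4: "std_regs ?s4" "reg ?s4 rDir = d" "reg s3 rOne = 1"
        using H(3,4) frame_reg[OF f, of 0] frame_reg[OF f, of 2] frame_reg[OF f, of 3] frame_reg[OF f, of 4]
        by (simp_all add: std_regs_def)
      have "bx (write_all wr l) ?s4 ?T'
        (\<lambda>_ s'. frame ({5..16} \<union> {rSize l, rRead l}) {0, Suc l} ?s4 s' \<and> holds l (nxt d R) s' \<and>
          arr s' 0 = (\<lambda>_. 0) \<and>
          (\<exists>qs. greedy d (win R) R ((ps @ [?p]) @ qs) {} (nxt d R) \<and> out s' = out ?s4 @ (if wr then qs else [])))"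
      proof (rule less.hyps[OF cR H(1) g])
        show "R' - {?p} - win (R' - {?p}) = {reg ?s4 (rRead l)..<N}" using w(2) s3 by (auto simp: min_def)
        show "tree d ?A' (arr ?s4 0)" using s3 A' by simp
        show "distinct ?ys" "set ?ys = win (R' - {?p}) - ?A'" by (rule ys')+
        show "stored l ?ys ?s4" using s3 by (simp add: stored_def)
      qed (use c4 s3 in auto)
      then have "bx (write_all wr l) ?s4 Ta ?Q"
      proof (rule bexec_weaken)
        show "?T' \<le> Ta" by (rule sa)
        fix s'
        assume s': "frame ({5..16} \<union> {rSize l, rRead l}) {0, Suc l} ?s4 s' \<and> holds l (nxt d R) s' \<and>
          arr s' 0 = (\<lambda>_. 0) \<and>
          (\<exists>qs. greedy d (win R) R ((ps @ [?p]) @ qs) {} (nxt d R) \<and> out s' = out ?s4 @ (if wr then qs else []))"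
        then obtain qs where "greedy d (win R) R (ps @ ?p # qs) {} (nxt d R)"
          "out s' = out s @ (if wr then ?p # qs else [])"
          using s3 sa(4) by auto
        moreover have "frame ({5..16} \<union> {rSize l, rRead l}) {0, Suc l} s s'"
          using f s' frame_trans by blast
        ultimately show "?Q 0 s'" using s' by blast
      qed
      then show "bx (Load rRoot 0 rOne) s3 (Ta + update_time + 8 - (update_time + 7))
          (\<lambda>T' s'. bx (write_all wr l) s' T' ?Q)"
        by (intro bexec_Load) (simp_all add: c4)
    qed
    have wr: "bx (Seq (if wr then Write rPos else Skip) (Seq (refill l) (Load rRoot 0 rOne))) sa
        (Ta + update_time + 9) (\<lambda>T' s'. bx (write_all wr l) s' T' ?Q)"
      if "frame {5..14} {0} s sa" "reg sa rLast = ?p" "reg sa rPos = ?p" "tree d (A - {?p}) (arr sa 0)"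
        "out sa = out s" "?T' \<le> Ta" for sa Ta
    proof (cases wr)
      case True
      then have eq: "(if wr then Write rPos else Skip) = Write rPos" by simp
      show ?thesis unfolding eq
        apply (intro bexec_Seq[of _ _ "Write rPos"] bexec_Write)
        subgoal by simp
        apply (rule bexec_start[OF rest[of "sa\<lparr>out := out sa @ [reg sa rPos]\<rparr>" Ta]])
        using that True by (auto simp: frame_def)
    next
      case False
      then have eq: "(if wr then Write rPos else Skip) = Skip" by simp
      show ?thesis unfolding eq
        apply (intro bexec_Seq[of _ _ Skip] bexec_Skip)
        subgoal by simp
        apply (rule bexec_start[OF rest[of sa Ta]])
        using that False by (auto simp: frame_def)
    qed
    have body: "bx (block [Sub rPos rRoot rOne, Copy rEntry rZero, update, Copy rLast rPos,
       (if wr then Write rPos else Skip), refill l, Load rRoot 0 rOne]) s (?T - 1)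
       (\<lambda>T' s'. bx (write_all wr l) s' T' ?Q)"
      unfolding block.simps
      apply (rule bexec_Seq, rule bexec_Sub)
      subgoal unfolding T by simp
      apply (rule bexec_Seq, rule bexec_Copy)
      subgoal unfolding T by simp
      apply (rule bexec_call[OF up])
      subgoal using H by (simp add: std_regs_def)
      subgoal unfolding T by simp
      subgoal premises u for T' s'
        apply (rule bexec_Seq, rule bexec_Copy)
        subgoal unfolding T by simp
        apply (rule bexec_start[OF wr[of "set_reg rLast (reg s' rPos) s'" ?T']])
        using u T by (auto simp: frame_def)
      done
    show ?thesis
      unfolding write_all_def
      apply (rule bexec_While_true)
         apply simp
      subgoal using H False by (simp add: std_regs_def)
      subgoal by simp
      using body unfolding write_all_def .
  qed
qed

end

section \<open>Search\<close>

lemma rSave_le [simp]: "rSave l \<le> rLong l" "rSave l \<le> rSize (Suc l)" "rSave l \<le> rRead (Suc l)" "rSave l \<le> rSave (Suc l)"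
  "\<not> rSave l \<le> rSize l" "\<not> rSave l \<le> rRead l" "\<not> rSave (Suc l) \<le> rSave l" "\<not> rSave (Suc l) \<le> rLong l"
  "rSave l \<le> rSize (Suc (Suc l))" "rSave l \<le> rRead (Suc (Suc l))" "rSave l \<le> rSave (Suc (Suc l))"
  "\<not> rSave (Suc l) \<le> rSize l" "\<not> rSave (Suc l) \<le> rRead l"
  "\<not> rSave (Suc (Suc l)) \<le> rSave l" "\<not> rSave (Suc (Suc l)) \<le> rLong l"
  "\<not> rSave (Suc (Suc l)) \<le> rSize l" "\<not> rSave (Suc (Suc l)) \<le> rRead l" "n < 20 \<Longrightarrow> \<not> rSave l \<le> n"
  unfolding rSize_def rRead_def rSave_def rLong_def by simp_all

text \<open>The unit is the time budget of one run. The summand 6 consists of the two runs of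
  \<open>probe\<close>, the three runs leading into the branches, and one unit for all constant-time
  steps.\<close>

fun explore_cost :: "nat \<Rightarrow> nat" where
  "explore_cost 0 = 1"
| "explore_cost (Suc 0) = 5"
| "explore_cost (Suc (Suc j)) = explore_cost (Suc j) + explore_cost j + 6"

text \<open>The summand 4 is two simulated runs, one committed run and one unit for the
  constant-time steps.\<close>

fun commit_cost :: "nat \<Rightarrow> nat" where
  "commit_cost 0 = 1"
| "commit_cost (Suc j) = 2 * explore_cost j + commit_cost j + 4"

context machine
begin

definition run_time :: nat where "run_time = 3 * update_time + 30"

definition clean :: "state \<Rightarrow> bool" where
  "clean s \<longleftrightarrow> std_regs s \<and> arr s 0 = (\<lambda>_. 0)"

lemma do_run_correct:
  assumes h: "holds l R s" and c: "clean s" and d: "reg s rDir = d" and G: "card R - card (nxt d R) \<le> G"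
  shows "bx (do_run wr l l') s (run_time * (G + 1)) (\<lambda>_ s'. holds l' (nxt d R) s' \<and> clean s' \<and>
    frame ({5..16} \<union> {rSize l', rRead l'}) {0, Suc l'} s s' \<and>
    (\<exists>ps. feas R ps \<and> sorted_wrt (le d) ps \<and> nxt d R = R - set ps \<and> out s' = out s @ (if wr then ps else [])))"
    (is "bx _ _ _ ?Q")
proof -
  obtain xs where xs: "distinct xs" "set xs = win R" "stored l xs s" using h by (auto simp: holds_def)
  have R: "reachable R" "finite R" using h holds_reachable reachable_finite by auto
  let ?r = "reg s (rRead l)"
  have r: "?r \<le> N" "R - win R = {?r..<N}" "R \<subseteq> {..<N}" using h by (auto simp: holds_def)
  have sub: "set xs \<subseteq> {..<N}" using xs(2) r(3) first_subset[of R M] by auto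
  have len: "length xs \<le> N" using card_mono[OF _ sub] distinct_card[OF xs(1)] by simp
  \<comment> \<open>A run writes its entire initial buffer, so filling the tree is paid for by the
    writes.\<close>
  have "nxt d R \<subseteq> R - win R" by (rule nxt_subset[OF R(2)])
  then have "card (nxt d R) \<le> card R - card (win R)"
    using card_mono[of "R - win R" "nxt d R"] R(2) card_Diff_subset[OF _ first_subset, of R M]
      finite_subset[OF first_subset R(2)] by auto
  moreover have "card (win R) \<le> card R" using R(2) first_subset by (rule card_mono)
  ultimately have lenl: "length xs \<le> card R - card (nxt d R)"
    using distinct_card[OF xs(1), unfolded xs(2)] by linarith
  let ?s1 = "set_reg rJ 0 s"
  have ins: "bx (insert_all l) ?s1 ((length xs - reg ?s1 rJ) * (update_time + 4) + 1)
    (\<lambda>_ s'. frame {5..16} {0} ?s1 s' \<and> out s' = out ?s1 \<and> tree d (set xs) (arr s' 0))"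
    by (rule insert_all_correct)
      (use c d xs sub len in \<open>auto simp: clean_def std_regs_def stored_def tree_empty\<close>)
  have wri: "bx (write_all wr l') s4 ((card R - card (nxt d R)) * (2 * update_time + 13) + 1) ?Q"
    if s2: "frame {5..16} {0} ?s1 s2" "out s2 = out s" "tree d (set xs) (arr s2 0)"
      and s4: "s4 = set_reg rRoot (arr s2 0 1) (set_reg (rSize l') 0 (set_reg (rRead l') ?r s2))" for s2 s4
  proof (rule bexec_weaken[OF write_all_correct[where ys = "[]" and ps = "[]" and A = "win R" and d = d, OF R(1) greedy_Nil]])
    have f: "frame ({5..16} \<union> {rSize l', rRead l'}) {0, Suc l'} s s4"
      using s2(1) by (auto simp: frame_def s4)
    show sr: "std_regs s4" using c std_regs_frame[OF _ f] by (simp add: clean_def)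
    show "reg s4 rDir = d" using frame_reg[OF f, of 4] d by simp
    show "tree d (win R) (arr s4 0)" using s2(3) xs(2) by (simp add: s4)
    show "reg s4 rRoot = arr s4 0 1" by (simp add: s4)
    show "stored l' [] s4" by (simp add: stored_def s4)
    show "reg s4 (rRead l') \<le> N" "R - win R = {reg s4 (rRead l')..<N}" using r by (simp_all add: s4)
    fix s'
    assume s': "frame ({5..16} \<union> {rSize l', rRead l'}) {0, Suc l'} s4 s' \<and> holds l' (nxt d R) s' \<and>
      arr s' 0 = (\<lambda>_. 0) \<and>
      (\<exists>qs. greedy d (win R) R ([] @ qs) {} (nxt d R) \<and> out s' = out s4 @ (if wr then qs else []))"
    then obtain qs where qs: "greedy d (win R) R qs {} (nxt d R)" "out s' = out s @ (if wr then qs else [])"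
      using s2(2) s4 by auto
    have "frame ({5..16} \<union> {rSize l', rRead l'}) {0, Suc l'} s s'" using f s' frame_trans by blast
    moreover have "clean s'" using s' std_regs_frame[OF sr] by (auto simp: clean_def)
    moreover have "feas R qs" "sorted_wrt (le d) qs" "nxt d R = R - set qs"
      using greedy_feas[OF qs(1) R(2)] greedy_sorted[OF qs(1) R(2)] greedy_remaining[OF qs(1)] by auto
    ultimately show "?Q 0 s'" using s' qs(2) by blast
  qed auto
  have "length xs * (update_time + 4) \<le> (card R - card (nxt d R)) * (update_time + 4)"
    using lenl by (rule mult_le_mono1)
  moreover have "run_time * (card R - card (nxt d R) + 1) \<le> run_time * (G + 1)"
    using G by (intro mult_le_mono2) simp
  ultimately have time: "length xs * (update_time + 4) + (card R - card (nxt d R)) * (2 * update_time + 13) + 20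
      \<le> run_time * (G + 1)"
    unfolding run_time_def by (simp add: algebra_simps)
  show ?thesis
    unfolding do_run_def block.simps
    apply (rule bexec_Seq, rule bexec_Copy)
    subgoal using time by simp
    apply (rule bexec_call[OF ins])
    subgoal using c by (simp add: clean_def std_regs_def)
    subgoal using time by simp
    subgoal premises u for T' s2
      apply (rule bexec_Seq, rule bexec_Copy)
      subgoal using time by simp
      apply (rule bexec_Seq, rule bexec_Copy)
      subgoal using time by simp
      apply (rule bexec_Seq, rule bexec_Load)
      subgoal using time by simp
      apply (rule bexec_start[OF wri[of s2, OF _ _ _ refl]])
      subgoal using u by simp
      subgoal using u by simp
      subgoal using u by simp
      subgoal using u c by (auto simp: frame_def clean_def std_regs_def)
      subgoal using time by simp
      done
    done
qed

lemma holds_value: "holds l R s \<Longrightarrow> reg s (rRead l) - reg s (rSize l) = N - card R"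
proof -
  assume h: "holds l R s"
  then obtain xs where xs: "distinct xs" "set xs = win R" "stored l xs s" by (auto simp: holds_def)
  have fin: "finite R" using h holds_reachable reachable_finite by auto
  have "card R = card (win R) + card (R - win R)"
    using card_Diff_subset[OF _ first_subset, of R M] fin card_mono[OF fin first_subset, of M]
      finite_subset[OF first_subset fin] by simp
  then show ?thesis using xs distinct_card[OF xs(1)] h by (auto simp: holds_def stored_def)
qed

lemma win_empty: "finite R \<Longrightarrow> win R = {} \<longleftrightarrow> R = {}"
  using card_first[of R M] M_pos first_subset[of R M] by (cases "R = {}") (auto simp: min_def split: if_splits)

lemma holds_size: "holds l R s \<Longrightarrow> reg s (rSize l) = 0 \<longleftrightarrow> R = {}"
  using win_empty[of R] holds_reachable[of l R s] reachable_finite[of R] by (auto simp: holds_def stored_def)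

text \<open>The search at level \<open>l\<close> leaves all levels up to \<open>l\<close> intact.\<close>

abbreviation lframe :: "nat \<Rightarrow> state \<Rightarrow> state \<Rightarrow> bool" where
  "lframe l \<equiv> frame ({4..19} \<union> {rSave l..}) ({0} \<union> {Suc (Suc l)..})"

text \<open>Relates the start \<open>s0\<close> of a search at level \<open>l\<close> to the states
  between its steps. Registers are numbered level by level, so \<open>{rSave l..}\<close> contains
  all those of the deeper levels.\<close>

definition sim :: "nat \<Rightarrow> state \<Rightarrow> state \<Rightarrow> bool" where
  "sim l s0 s \<longleftrightarrow> clean s \<and> lframe l s0 s \<and> out s = out s0"

lemma sim_refl: "clean s \<Longrightarrow> sim l s s"
  by (simp add: sim_def frame_refl)

lemma sim_holds: "sim l s0 s \<Longrightarrow> holds l R s0 \<Longrightarrow> holds l R s"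
  unfolding sim_def by (erule conjE, rule holds_frame) auto

lemma sim_set_reg: "sim l s0 s \<Longrightarrow> 4 \<le> k \<and> k \<le> 19 \<or> rSave l \<le> k \<Longrightarrow> sim l s0 (set_reg k v s)"
  unfolding sim_def clean_def std_regs_def frame_def using level_regs_ge(11)[of 0 l] level_regs_ge(11)[of 2 l]
    level_regs_ge(11)[of 3 l] by auto

lemma sim_trans:
  assumes "sim l s0 s" "sim m s s'" "l \<le> m"
  shows "sim l s0 s'"
proof -
  have "rSave l \<le> rSave m" using assms(3) by (simp add: rSave_def)
  then have "lframe l s0 s'"
    using assms by (intro frame_trans[of _ _ s0 s _ _ s']) (auto simp: sim_def)
  then show ?thesis using assms by (simp add: sim_def)
qed

lemma run_sim:
  assumes h: "holds m R s" and s: "sim l s0 s" and d: "reg s rDir = d" and l': "l' = Suc l \<or> l' = Suc (Suc l)"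
    and G: "card R - card (nxt d R) \<le> G"
  shows "bx (do_run False m l') s (run_time * (G + 1))
    (\<lambda>_ s'. holds l' (nxt d R) s' \<and> sim l s0 s' \<and> frame ({5..16} \<union> {rSize l', rRead l'}) {0, Suc l'} s s')"
proof (rule bexec_weaken[OF do_run_correct[OF h _ d G]])
  show "clean s" using s by (simp add: sim_def)
  fix s'
  assume s': "holds l' (nxt d R) s' \<and> clean s' \<and> frame ({5..16} \<union> {rSize l', rRead l'}) {0, Suc l'} s s' \<and>
    (\<exists>ps. feas R ps \<and> sorted_wrt (le d) ps \<and> nxt d R = R - set ps \<and> out s' = out s @ (if False then ps else []))"
  then have "frame ({5..16} \<union> {rSize l', rRead l'}) {0, Suc l'} s s'" by blast
  then have "lframe l s0 s'"
    using s l' by (intro frame_trans[of _ _ s0 s _ _ s']) (auto simp: sim_def)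
  then show "holds l' (nxt d R) s' \<and> sim l s0 s' \<and> frame ({5..16} \<union> {rSize l', rRead l'}) {0, Suc l'} s s'"
    using s' s by (auto simp: sim_def)
qed simp

section \<open>Progress as a time budget\<close>

lemma Val_ge: "finite R \<Longrightarrow> N - card R \<le> Val j R"
proof (induction j arbitrary: R)
  case (Suc j)
  have "N - card R \<le> N - card (nxt 0 R)" using card_mono[OF Suc.prems nxt_le[OF Suc.prems]] by (simp add: diff_le_mono2)
  also have "\<dots> \<le> Val j (nxt 0 R)" using Suc finite_nxt by simp
  finally show ?case by auto
qed simp

lemma Val_nxt: "R \<noteq> {} \<Longrightarrow> Val j (nxt d R) \<le> Val (Suc j) R"
  using nxt_cong[of d "if d = 0 then 0 else 1" R] by (auto split: if_splits)

definition gain :: "nat \<Rightarrow> nat set \<Rightarrow> nat" where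
  "gain j R = min N (Val j R) - (N - card R)"

lemma gain_mono: "Val i S \<le> Val j R \<Longrightarrow> card S \<le> card R \<Longrightarrow> gain i S \<le> gain j R"
  unfolding gain_def by (intro diff_le_mono2 order_trans[OF diff_le_mono, of "min N (Val i S)" "min N (Val j R)"]) auto

lemma progress_le_gain: "reachable R \<Longrightarrow> N - card S \<le> Val j R \<Longrightarrow> card R - card S \<le> gain j R"
  using reachable_card_N[of R] unfolding gain_def by auto

lemma run_gain: "reachable R \<Longrightarrow> R \<noteq> {} \<Longrightarrow> card R - card (nxt d R) \<le> gain (Suc j) R"
  using Val_ge[of "nxt d R" j] Val_nxt[of R j d] finite_nxt reachable_finite[of R]
  by (intro progress_le_gain) auto

section \<open>Correctness of search and commitment\<close>

lemma probe_correct: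
  assumes h: "holds l R s0" and s: "sim l s0 s" and G: "\<And>d. card R - card (nxt d R) \<le> G"
  shows "bx (probe l) s (2 * (run_time * (G + 1)) + 6)
    (\<lambda>_ s'. sim l s0 s' \<and> reg s' (rLong l) \<le> 1 \<and>
      card (nxt (reg s' (rLong l)) R) \<le> card (nxt (1 - reg s' (rLong l)) R))"
proof -
  have hs: "holds l R s'" if "sim l s0 s'" for s' using sim_holds that h by blast
  have R: "reachable R" using h holds_reachable by blast
  have cN: "card (nxt d R) \<le> N" for d using reachable_card_N[OF reachable_nxt[OF R]] .
  have sd: "sim l s0 (set_reg rDir v s')" if "sim l s0 s'" for s' v
    by (rule sim_set_reg[OF that]) simp
  have std: "reg s' rOne = 1" "reg s' rZero = 0" if "sim l s0 s'" for s'
    using that by (simp_all add: sim_def clean_def std_regs_def)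
  have run: "bx (do_run False l (Suc l)) (set_reg rDir d s') (run_time * (G + 1))
      (\<lambda>_ s''. holds (Suc l) (nxt d R) s'' \<and> sim l s0 s'' \<and>
        frame ({5..16} \<union> {rSize (Suc l), rRead (Suc l)}) {0, Suc (Suc l)} (set_reg rDir d s') s'')"
    if "sim l s0 s'" for s' d
    by (rule run_sim[OF hs sd]) (use sd that G in auto)
  let ?X = "run_time * (G + 1)"
  show ?thesis
    unfolding probe_def block.simps
    apply (rule bexec_Seq, rule bexec_Copy)
    subgoal by simp
    apply (rule bexec_call[OF run[OF s, of 1]])
    subgoal using std[OF s] by simp
    subgoal by simp
    subgoal premises u1 for T1 s1
      apply (rule bexec_Seq, rule bexec_Sub)
      subgoal by simp
      apply (rule bexec_Seq, rule bexec_Copy)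
      subgoal by simp
      apply (rule bexec_call[OF run[of "set_reg rDown (reg s1 (rRead (Suc l)) - reg s1 (rSize (Suc l))) s1" 0]])
      subgoal using u1 by (intro sim_set_reg) auto
      subgoal using std[of s1] u1 by simp
      subgoal by simp
      subgoal premises u2 for T2 s2
      proof -
        have dn: "reg s2 rDown = N - card (nxt 1 R)"
          using u2 holds_value[of "Suc l" "nxt 1 R" s1] u1 by (auto simp: frame_def)
        have up: "reg s2 (rRead (Suc l)) - reg s2 (rSize (Suc l)) = N - card (nxt 0 R)"
          using holds_value u2 by blast
        have c: "reg s2 rOne = 1" "reg s2 rZero = 0" using std u2 by blast+
        have sm: "sim l s0 (set_reg (rLong l) v (set_reg rUp w s2))" for v w
          using u2 by (intro sim_set_reg) auto
        show ?thesis
          apply (intro bexec_Seq bexec_Sub bexec_Cond bexec_Copy)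
          using up dn c sm[of "Suc 0" "N - card (nxt 0 R)"] sm[of 0 "N - card (nxt 0 R)"]
            cN[of 0] cN[of "Suc 0"]
          by auto
      qed
      done
    done
qed

text \<open>Both subsearches start from positions of no larger gain. The gain at \<open>R\<close>
  therefore bounds every run in the search tree, and the time is a number of runs times one common
  budget.\<close>

lemma explore_correct:
  assumes "holds l R s" "clean s" "j \<le> D"
  shows "bx (explore j l) s (explore_cost j * (run_time * (gain j R + 1)))
    (\<lambda>_ s'. sim l s s' \<and> reg s' rVal = Val j R)"
  using assms
proof (induction j l arbitrary: R s rule: explore.induct)
  case (1 l)
  have "1 \<le> run_time * (gain 0 R + 1)" by (simp add: run_time_def)
  moreover have "sim l s (set_reg rVal v s)" for v using 1 by (intro sim_set_reg sim_refl) auto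
  ultimately show ?case using holds_value[OF 1(1)]
    by (auto intro!: bexec_Sub)
next
  case (2 l)
  let ?X = "run_time * (gain (Suc 0) R + 1)"
  have X: "30 \<le> ?X" by (simp add: run_time_def)
  have R: "reachable R" "finite R" using "2.prems" holds_reachable reachable_finite by auto
  have sr: "reg s rN = N" "reg s rZero = 0" using "2.prems" by (auto simp: clean_def std_regs_def)
  have s0: "sim l s s" using "2.prems" by (intro sim_refl)
  show ?case
  proof (cases "R = {}")
    case True
    then show ?thesis using holds_size[OF "2.prems"(1)] sr X W_bound sim_set_reg[OF sim_set_reg[OF s0]]
      by (auto intro!: bexec_Cond bexec_Seq bexec_Const bexec_Add simp del: One_nat_def) 
  next
    case False
    have G: "card R - card (nxt d R) \<le> gain (Suc 0) R" for d by (rule run_gain[OF R(1) False])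
    show ?thesis
      unfolding explore.simps block.simps
      apply (rule bexec_Cond)
      subgoal by simp
      subgoal using X by simp
      subgoal using False holds_size[OF "2.prems"(1)] sr by simp
      apply (rule bexec_call[OF probe_correct[OF "2.prems"(1) s0 G] refl])
      subgoal using X by simp
      subgoal premises u1 for T1 s1
        apply (rule bexec_Seq, rule bexec_Copy)
        subgoal using X by simp
        apply (rule bexec_call[OF run_sim[where m = l and R = R and l = l and ?s0.0 = s and d = "reg s1 (rLong l)" and G = "gain (Suc 0) R", OF _ _ _ disjI1[OF refl] G] refl])
        subgoal by (rule sim_holds[OF sim_set_reg "2.prems"(1)]) (use u1 in auto)
        subgoal using u1 by (intro sim_set_reg) auto
        subgoal by simp
        subgoal using X by simp
        subgoal premises u2 for T2 s2
        proof -
          have d: "reg s1 (rLong l) = 0 \<and> 1 - reg s1 (rLong l) = 1 \<or>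
            reg s1 (rLong l) = 1 \<and> 1 - reg s1 (rLong l) = 0" using u1 by auto
          have "Val (Suc 0) R = Val 0 (nxt (reg s1 (rLong l)) R)"
            by (rule Val_longer_1[OF R(2) False]) (use u1 d in auto)
          moreover have "reg s2 (rRead (Suc l)) - reg s2 (rSize (Suc l)) = N - card (nxt (reg s1 (rLong l)) R)"
            using u2 holds_value by blast
          moreover have "sim l s (set_reg rVal v s2)" for v using u2 by (intro sim_set_reg) auto
          ultimately show ?thesis using X by (intro bexec_Sub) auto
        qed
        done
      done
  qed
next
  case (3 j l)
  let ?J = "Suc (Suc j)"
  let ?G = "gain ?J R"
  define X where "X = run_time * (?G + 1)"
  define a where "a = explore_cost (Suc j) * X"
  define b where "b = explore_cost j * X"
  have X: "30 \<le> X" by (simp add: run_time_def X_def)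
  have T: "explore_cost ?J * (run_time * (?G + 1)) = a + b + 6 * X"
    unfolding X_def[symmetric] a_def b_def by (simp add: algebra_simps)
  have R: "reachable R" "finite R" using 3 holds_reachable reachable_finite by auto
  have sr: "reg s rN = N" "reg s rZero = 0" using 3 by (auto simp: clean_def std_regs_def)
  have s0: "sim l s s" using 3 by (intro sim_refl)
  show ?case
  proof (cases "R = {}")
    case True
    then show ?thesis unfolding T using holds_size[OF 3(3)] sr X W_bound 3(5) sim_set_reg[OF sim_set_reg[OF s0]]
      by (auto intro!: bexec_Cond bexec_Seq bexec_Const bexec_Add simp: True)
  next
    case False
    have G: "card R - card (nxt d R) \<le> ?G" for d by (rule run_gain[OF R(1) False])
    note probe = probe_correct[OF 3(3) s0 G, folded X_def]
    note run = run_sim[where G = ?G and l = l and ?s0.0 = s, folded X_def]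
    show ?thesis
      unfolding explore.simps block.simps T
      apply (rule bexec_Cond)
      subgoal by simp
      subgoal using X by simp
      subgoal using False holds_size[OF 3(3)] sr by simp
      apply (rule bexec_call[OF probe refl])
      subgoal using X by simp
      subgoal premises u1 for T1 s1
      proof -
        define d where "d = reg s1 (rLong l)"
        define d' where "d' = 1 - d"
        have d: "d = 0 \<and> d' = 1 \<or> d = 1 \<and> d' = 0" using u1 by (auto simp: d_def d'_def)
        have V: "Val ?J R = max (Val (Suc j) (nxt d R)) (Val j (nxt d' (nxt d' R)))"
          by (rule Val_longer[OF R(2) False]) (use u1 d in \<open>auto simp: d_def d'_def\<close>)
        have R': "reachable (nxt e R)" "finite (nxt e R)" "card (nxt e R) \<le> card R" for e
          using reachable_nxt[OF R(1)] reachable_finite card_mono[OF R(2) nxt_le[OF R(2)]] by auto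
        have R'': "finite (nxt d' (nxt d' R))" "card (nxt d' (nxt d' R)) \<le> card R"
          using R'[of d'] finite_nxt card_mono[OF R'(2) nxt_le[OF R'(2)], of d' d'] by auto
        \<comment> \<open>The position after the doubled shorter run enters the maximum in
          \<open>V\<close>, so its progress is bounded by the gain at \<open>R\<close>. This also
          pays for the second of the two runs.\<close>
        have "N - card (nxt d' (nxt d' R)) \<le> Val ?J R"
          unfolding V using Val_ge[OF R''(1), of j] by (rule max.coboundedI2)
        then have "card R - card (nxt d' (nxt d' R)) \<le> ?G" by (rule progress_le_gain[OF R(1)])
        then have G2: "card (nxt d' R) - card (nxt d' (nxt d' R)) \<le> ?G" using R'(3)[of d'] by linarith
        have ga: "gain (Suc j) (nxt d R) \<le> ?G" "gain j (nxt d' (nxt d' R)) \<le> ?G"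
          using V R'(3) R''(2) by (auto intro!: gain_mono)
        have Ka: "explore_cost (Suc j) * (run_time * (gain (Suc j) (nxt d R) + 1)) \<le> a"
          "explore_cost j * (run_time * (gain j (nxt d' (nxt d' R)) + 1)) \<le> b"
          unfolding a_def b_def X_def using ga by (intro mult_le_mono2, simp)+
        show ?thesis
          apply (rule bexec_Seq, rule bexec_Copy)
          subgoal using X by simp
          apply (rule bexec_call[OF run[where m = l and R = R and d = d and l' = "Suc l"] refl])
          subgoal by (rule sim_holds[OF sim_set_reg 3(3)]) (use u1 in auto)
          subgoal using u1 by (intro sim_set_reg) auto
          subgoal by (simp add: d_def)
          subgoal by simp
          subgoal by (rule G)
          subgoal using X by simp
          subgoal premises u2 for T2 s2
            apply (rule bexec_call[OF bexec_weaken[OF "3.IH"(1)[where R = "nxt d R" and s = s2] Ka(1)] refl])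
            subgoal using u2 by simp
            subgoal using u2 by (simp add: sim_def)
            subgoal using 3(5) by simp
            apply assumption
            subgoal using X by simp
            subgoal premises u3 for T3 s3
            proof -
              have s3: "sim l s s3" using u2 u3 sim_trans[of l s s2 "Suc l" s3] by simp
              have l3: "reg s3 (rLong l) = d"
                using u2 u3 by (simp add: sim_def frame_def d_def)
              have one: "reg s3 rOne = 1" using s3 by (simp add: sim_def clean_def std_regs_def)
              let ?s4 = "set_reg rDir d' (set_reg (rSave l) (Val (Suc j) (nxt d R)) s3)"
              have s4: "sim l s ?s4" using s3 by (intro sim_set_reg) auto
              show ?thesis
                apply (rule bexec_Seq, rule bexec_Copy)
                subgoal using X by simp
                apply (rule bexec_Seq, rule bexec_Sub)
                subgoal using X by simp
                apply (rule bexec_call[OF run[where m = l and R = R and d = d' and l' = "Suc l" and s = ?s4]])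
                subgoal by (rule sim_holds[OF s4 3(3)])
                subgoal by (rule s4)
                subgoal by simp
                subgoal by simp
                subgoal by (rule G)
                subgoal using u3 l3 one by (simp add: d'_def)
                subgoal using X by simp
                subgoal premises u5 for T5 s5
                  apply (rule bexec_call[OF run[where m = "Suc l" and R = "nxt d' R" and d = d' and l' = "Suc (Suc l)"] refl])
                  subgoal using u5 by simp
                  subgoal using u5 by simp
                  subgoal using u5 by (auto simp: frame_def)
                  subgoal by simp
                  subgoal by (rule G2)
                  subgoal using X by simp
                  subgoal premises u6 for T6 s6
                    apply (rule bexec_call[OF bexec_weaken[OF "3.IH"(2)[where R = "nxt d' (nxt d' R)" and s = s6] Ka(2)] refl])
                    subgoal using u6 by simp
                    subgoal using u6 by (simp add: sim_def)
                    subgoal using 3(5) by simp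
                    apply assumption
                    subgoal using X by simp
                    subgoal premises u7 for T7 s7
                    proof -
                      have s7: "sim l s s7" using u6 u7 sim_trans[of l s s6 "Suc (Suc l)" s7] by simp
                      have "reg s7 (rSave l) = reg s6 (rSave l)" using u7 by (simp add: sim_def frame_def)
                      also have "\<dots> = reg s5 (rSave l)" using u6 by (simp add: frame_def)
                      also have "\<dots> = reg ?s4 (rSave l)" using u5 by (elim conjE) (erule frame_reg, simp)
                      finally have save: "reg s7 (rSave l) = Val (Suc j) (nxt d R)" by simp
                      have "sim l s (set_reg rVal v s7)" for v using s7 by (intro sim_set_reg) auto
                      then show ?thesis
                        using X s7 save u7 V by (intro bexec_Cond bexec_Copy bexec_Skip) auto
                    qed
                    done
                  done
                done
            qed
            done
          done
      qed
      done
  qed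
qed

text \<open>The committed runs realise the value that the search predicted. If they empty the
  position, the bonus turns this into a statement about their number; otherwise all \<open>j\<close>
  runs are used and the number of written elements is the best possible.\<close>

lemma commit_correct:
  assumes "holds 0 R s" "clean s" "j \<le> D"
  shows "bx (commit j) s (commit_cost j * (run_time * (gain j R + 1)))
    (\<lambda>_ s'. \<exists>rs R'. plays R rs R' \<and> out s' = out s @ concat rs \<and> holds 0 R' s' \<and> clean s' \<and> length rs \<le> j \<and>
      (if R' = {} then Val j R + length rs = N + j else length rs = j \<and> Val j R = N - card R'))"
  using assms
proof (induction j arbitrary: R s)
  case 0
  have "1 \<le> run_time * (gain 0 R + 1)" by (simp add: run_time_def)
  then show ?case using 0
    by (auto intro!: bexec_Skip exI[of _ "[]"] exI[of _ R] plays_Nil)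
next
  case (Suc j)
  let ?G = "gain (Suc j) R"
  define X where "X = run_time * (?G + 1)"
  define a where "a = explore_cost j * X"
  define b where "b = commit_cost j * X"
  have X: "30 \<le> X" by (simp add: run_time_def X_def)
  have T: "commit_cost (Suc j) * (run_time * (?G + 1)) = 2 * a + b + 4 * X"
    unfolding X_def[symmetric] a_def b_def by (simp add: algebra_simps)
  have R: "reachable R" "finite R" using Suc holds_reachable reachable_finite by auto
  have sr: "reg s rZero = 0" using Suc by (auto simp: clean_def std_regs_def)
  show ?case
  proof (cases "R = {}")
    case True
    then show ?thesis unfolding T commit.simps using holds_size[OF Suc.prems(1)] sr X Suc.prems
      by (intro bexec_Cond bexec_Skip exI[of _ "[]"] exI[of _ R]) (auto intro: plays_Nil)
  next
    case False
    have G: "card R - card (nxt d R) \<le> ?G" for d by (rule run_gain[OF R(1) False])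
    have R': "card (nxt e R) \<le> card R" for e using card_mono[OF R(2) nxt_le[OF R(2)]] .
    have ga: "gain j (nxt d R) \<le> ?G" for d using Val_nxt[OF False] R' by (intro gain_mono)
    have Ka: "explore_cost j * (run_time * (gain j (nxt d R) + 1)) \<le> a"
      "commit_cost j * (run_time * (gain j (nxt d R) + 1)) \<le> b" for d
      unfolding a_def b_def X_def using ga[of d] by (intro mult_le_mono2, simp)+
    have run: "bx (do_run False 0 1) (set_reg rDir d s') X
      (\<lambda>_ s''. holds 1 (nxt d R) s'' \<and> sim 0 s s'' \<and>
        frame ({5..16} \<union> {rSize 1, rRead 1}) {0, 2} (set_reg rDir d s') s'')"
      if "sim 0 s s'" for s' d
    proof -
      have "sim 0 s (set_reg rDir d s')" using that by (intro sim_set_reg) auto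
      from run_sim[OF sim_holds[OF this Suc.prems(1)] this, of d "Suc 0" ?G] G
      show ?thesis by (simp add: X_def numeral_2_eq_2)
    qed
    have exp: "bx (explore j 1) s' a (\<lambda>_ s''. sim 0 s s'' \<and> reg s'' rVal = Val j (nxt d R) \<and> reg s'' (rSave 0) = reg s' (rSave 0))"
      if "sim 0 s s'" "holds 1 (nxt d R) s'" for s' d
    proof (rule bexec_weaken[OF explore_correct[OF that(2)] Ka(1)])
      show "clean s'" using that by (simp add: sim_def)
      show "j \<le> D" using Suc.prems by simp
      fix s'' assume s'': "sim 1 s' s'' \<and> reg s'' rVal = Val j (nxt d R)"
      then have "sim 0 s s''" using sim_trans[OF that(1), of 1 s''] by simp
      moreover have "reg s'' (rSave 0) = reg s' (rSave 0)"
        using s'' frame_reg[of _ _ s' s'' "rSave 0"] by (auto simp: sim_def)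
      ultimately show "sim 0 s s'' \<and> reg s'' rVal = Val j (nxt d R) \<and> reg s'' (rSave 0) = reg s' (rSave 0)"
        using s'' by simp
    qed
    let ?Q = "\<lambda>T (s' :: state). \<exists>rs R'. plays R rs R' \<and> out s' = out s @ concat rs \<and> holds 0 R' s' \<and> clean s' \<and>
      length rs \<le> Suc j \<and>
      (if R' = {} then Val (Suc j) R + length rs = N + Suc j else length rs = Suc j \<and> Val (Suc j) R = N - card R')"
    have final: "bx (Seq (do_run True 0 0) (commit j)) s' T ?Q"
      if s': "sim 0 s s'" "Val (Suc j) R = Val j (nxt (reg s' rDir) R)" "X + b \<le> T" for s' T
    proof (rule bexec_call[OF do_run_correct[OF sim_holds[OF s'(1) Suc.prems(1)] _ refl G, folded X_def] refl])
      let ?d = "reg s' rDir"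
      show "clean s'" using s' by (simp add: sim_def)
      show "X \<le> T" using s' by simp
      fix s1
      assume s1: "holds 0 (nxt ?d R) s1 \<and> clean s1 \<and>
         frame ({5..16} \<union> {rSize 0, rRead 0}) {0, Suc 0} s' s1 \<and>
         (\<exists>ps. feas R ps \<and> sorted_wrt (le ?d) ps \<and> nxt ?d R = R - set ps \<and>
               out s1 = out s' @ (if True then ps else []))"
      then obtain ps where ps: "feas R ps" "sorted_wrt (le ?d) ps" "nxt ?d R = R - set ps" "out s1 = out s @ ps"
        using s'(1) by (auto simp: sim_def)
      show "bx (commit j) s1 (T - X) ?Q"
      proof (rule bexec_weaken[OF Suc.IH])
        show "holds 0 (nxt ?d R) s1" "clean s1" "j \<le> D" using s1 Suc.prems by auto
        show "commit_cost j * (run_time * (gain j (nxt ?d R) + 1)) \<le> T - X" using Ka(2)[of ?d] s' by simp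
        fix s2
        assume "\<exists>rs R'. plays (nxt ?d R) rs R' \<and> out s2 = out s1 @ concat rs \<and> holds 0 R' s2 \<and> clean s2 \<and>
          length rs \<le> j \<and> (if R' = {} then Val j (nxt ?d R) + length rs = N + j
            else length rs = j \<and> Val j (nxt ?d R) = N - card R')"
        then obtain rs R' where "plays (nxt ?d R) rs R'" "out s2 = out s1 @ concat rs" "holds 0 R' s2" "clean s2"
          "length rs \<le> j" "if R' = {} then Val j (nxt ?d R) + length rs = N + j
            else length rs = j \<and> Val j (nxt ?d R) = N - card R'" by blast
        then show "?Q 0 s2" using ps s'(2) plays_Cons[OF ps(1,2)]
          by (intro exI[of _ "ps # rs"] exI[of _ R']) (auto split: if_splits)
      qed
    qed
    have std: "reg s' rOne = 1" "reg s' rZero = 0" if "sim 0 s s'" for s'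
      using that by (simp_all add: sim_def clean_def std_regs_def)
    have s0: "sim 0 s s" using Suc.prems by (intro sim_refl)
    show ?thesis
      unfolding commit.simps block.simps T
      apply (rule bexec_Cond)
      subgoal by simp
      subgoal using X by simp
      subgoal using False holds_size[OF Suc.prems(1)] sr by simp
      apply (rule bexec_Seq, rule bexec_Copy)
      subgoal using X by simp
      apply (rule bexec_call[OF run[OF s0, of 1]])
      subgoal using std[OF s0] by simp
      subgoal using X by simp
      subgoal premises u1 for T1 s1
        apply (rule bexec_call[OF exp[of s1 1] refl])
        subgoal using u1 by simp
        subgoal using u1 by simp
        subgoal using X by simp
        subgoal premises u2 for T2 s2
          apply (rule bexec_Seq, rule bexec_Copy)
          subgoal using X by simp
          apply (rule bexec_Seq, rule bexec_Copy)
          subgoal using X by simp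
          apply (rule bexec_call[OF run[of "set_reg (rSave 0) (Val j (nxt 1 R)) s2" 0]])
          subgoal using u2 by (intro sim_set_reg) auto
          subgoal using u2 std[of s2] by simp
          subgoal using X by simp
          subgoal premises u3 for T3 s3
            apply (rule bexec_call[OF exp[of s3 0] refl])
            subgoal using u3 by simp
            subgoal using u3 by simp
            subgoal using X by simp
            subgoal premises u4 for T4 s4
            proof -
              have sv: "reg s4 (rSave 0) = Val j (nxt 1 R)" "reg s4 rVal = Val j (nxt 0 R)"
                using u4 u3 frame_reg[of _ _ _ s3 "rSave 0"] by auto
              have c: "reg s4 rOne = 1" "reg s4 rZero = 0" using std u4 by blast+
              have sm: "sim 0 s (set_reg rDir v s4)" for v using u4 by (intro sim_set_reg) auto
              show ?thesis
                apply (rule bexec_Seq)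
                apply (intro bexec_Cond bexec_Copy)
                subgoal by simp
                subgoal using X by simp
                subgoal using X by simp
                subgoal using sv c False X by (intro final[OF sm]) auto
                subgoal using X by simp
                subgoal using sv c False X by (intro final[OF sm]) auto
                done
            qed
            done
          done
        done
      done
  qed
qed

end

section \<open>Phases and running time\<close>

context machine
begin

definition phase_time :: nat where "phase_time = 2 * run_time * (commit_cost D + 2)"

text \<open>A phase writes at least one element, so \<open>g + 1 \<le> 2 * g\<close> and
  \<open>k + 1 \<le> g + k\<close> absorb the overhead of runs that write little.\<close>

lemma phase_time_bound:
  assumes "1 \<le> g"
  shows "commit_cost D * (run_time * (g + 1)) + run_time * (k + 1) + 2 \<le> phase_time * (g + k)"
proof -
  obtain h where g: "g = Suc h" using assms by (cases g) auto
  have "2 \<le> run_time" by (simp add: run_time_def)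
  moreover have "phase_time * (g + k) = 2 * (commit_cost D * run_time) + 2 * (commit_cost D * run_time * h) +
      2 * (commit_cost D * run_time * k) + 4 * run_time + 4 * (run_time * h) + 4 * (run_time * k)"
    by (simp add: phase_time_def g algebra_simps)
  moreover have "commit_cost D * (run_time * (g + 1)) + run_time * (k + 1) =
      2 * (commit_cost D * run_time) + commit_cost D * run_time * h + run_time * k + run_time"
    by (simp add: g algebra_simps)
  ultimately show ?thesis by linarith
qed

text \<open>A phase that does not finish spends \<open>D + 1\<close> runs and, by
  \<open>commit_catch_up\<close>, leaves a position solvable with \<open>m - D\<close> runs. The
  number \<open>m\<close> is quantified inside because it shrinks from phase to phase, and the ratio
  is multiplied out to stay within \<open>nat\<close>. Time is charged to written elements, which is
  why it is linear in \<open>card R\<close>.\<close>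

lemma phases_correct:
  assumes "1 \<le> D" "holds 0 R s" "clean s"
  shows "bx (phases D) s (phase_time * card R + 1)
    (\<lambda>_ s'. \<exists>rs. plays R rs {} \<and> out s' = out s @ concat rs \<and>
      (\<forall>m. solvable m R \<longrightarrow> D * length rs \<le> (D + 1) * m))"
  using assms(2,3)
proof (induction "card R" arbitrary: R s rule: less_induct)
  case less
  have R: "reachable R" "finite R" using less.prems holds_reachable reachable_finite by auto
  have sr: "reg s rZero = 0" using less.prems by (simp add: clean_def std_regs_def)
  let ?Q = "\<lambda>(T :: nat) (s' :: state). \<exists>rs. plays R rs {} \<and> out s' = out s @ concat rs \<and>
      (\<forall>m. solvable m R \<longrightarrow> D * length rs \<le> (D + 1) * m)"
  show ?case
  proof (cases "R = {}")
    case True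
    then show ?thesis unfolding phases_def using holds_size[OF less.prems(1)] sr
      by (intro bexec_While_false exI[of _ "[]"]) (auto intro: plays_Nil)
  next
    case False
    let ?T = "phase_time * card R"
    have nz: "card (nxt 0 R) < card R"
    proof -
      have "win R \<noteq> {}" using win_empty[OF R(2)] False by simp
      then have "nxt 0 R \<subset> R" using nxt_subset[OF R(2), of 0] first_subset[of R M] by blast
      then show "card (nxt 0 R) < card R" by (rule psubset_card_mono[OF R(2)])
    qed
    obtain D' where D': "D = Suc D'" using assms(1) by (cases D) auto
    have cR: "0 < card R" "card R \<le> N" using False R reachable_card_N by (auto simp: card_gt_0_iff)
    have V: "N - card (nxt 0 R) \<le> Val D R"
      using Val_ge[OF finite_nxt[OF R(2)], of 0 D'] Val_nxt[OF False, of D' 0] D' by simp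
    show ?thesis
      unfolding phases_def block.simps
      apply (rule bexec_While_true)
      subgoal by simp
      subgoal using holds_size[OF less.prems(1)] sr False by simp
      subgoal by simp
      apply (rule bexec_start[where K = ?T])
      prefer 2 apply (rule refl)
      prefer 2 subgoal by simp
    proof (rule bexec_call[OF commit_correct[OF less.prems order_refl] refl])
      have "1 \<le> gain D R" using progress_le_gain[OF R(1) V] nz by simp
      have g1: "card R - card (nxt 0 R) \<le> gain D R" by (rule progress_le_gain[OF R(1) V])
      have gle: "gain D R \<le> card R" using cR unfolding gain_def by linarith
      show "commit_cost D * (run_time * (gain D R + 1)) \<le> ?T"
        using phase_time_bound[OF \<open>1 \<le> gain D R\<close>, of 0, unfolded add_0_right]
          mult_le_mono2[OF gle, of phase_time] by linarith
      fix s1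
      assume "\<exists>rs R'. plays R rs R' \<and> out s1 = out s @ concat rs \<and> holds 0 R' s1 \<and> clean s1 \<and> length rs \<le> D \<and>
        (if R' = {} then Val D R + length rs = N + D else length rs = D \<and> Val D R = N - card R')"
      then obtain rs R' where c: "plays R rs R'" "out s1 = out s @ concat rs" "holds 0 R' s1" "clean s1" "length rs \<le> D"
        "if R' = {} then Val D R + length rs = N + D else length rs = D \<and> Val D R = N - card R'" by blast
      have R': "reachable R'" "finite R'" "R' \<subseteq> R"
        using c(3) holds_reachable reachable_finite plays_feas[OF c(1)] by auto
      \<comment> \<open>The predicted progress has really been made, so the time spent on searching
        is charged to elements that are now written.\<close>
      have gain: "gain D R = card R - card R'"
        using c(5,6) cR reachable_card_N[OF R'(1)] card_mono[OF R(2) R'(3)] by (auto simp: gain_def split: if_splits)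
      let ?k = "card R' - card (nxt 0 R')"
      have sub: "nxt 0 R' \<subseteq> R'" by (rule nxt_le[OF R'(2)])
      have less: "card (nxt 0 R') < card R"
        using gain g1 nz card_mono[OF R'(2) sub] card_mono[OF R(2) R'(3)] by linarith
      have total: "gain D R + ?k = card R - card (nxt 0 R')"
        using gain card_mono[OF R'(2) sub] card_mono[OF R(2) R'(3)] by linarith
      have T: "?T = phase_time * (gain D R + ?k) + phase_time * card (nxt 0 R')"
        unfolding total using less by (simp add: diff_mult_distrib2)
      note time = phase_time_bound[OF \<open>1 \<le> gain D R\<close>, of ?k]
      let ?T1 = "?T - commit_cost D * (run_time * (gain D R + 1))"
      have T1: "run_time * (?k + 1) + 2 + phase_time * card (nxt 0 R') \<le> ?T1" using T time by linarith
      let ?s1 = "set_reg rDir 0 s1"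
      have f: "frame {4} {} s1 ?s1" by (simp add: frame_def)
      have h1: "holds 0 R' ?s1" by (rule holds_frame[OF c(3) f]) auto
      have c1: "clean ?s1" using c(4) by (simp add: clean_def std_regs_def)
      have z: "reg s1 rZero = 0" using c(4) by (simp add: clean_def std_regs_def)
      show "bx (Seq (Copy rDir rZero) (do_run True 0 0)) s1 ?T1
        (\<lambda>T' s'. bx (While (Less rZero (rSize 0)) (Seq (commit D) (Seq (Copy rDir rZero) (do_run True 0 0)))) s' T' ?Q)"
        apply (rule bexec_Seq, rule bexec_Copy)
        subgoal using T1 by simp
        apply (rule bexec_use[OF do_run_correct[OF h1 c1, of 0 ?k]])
        subgoal by simp
        subgoal by simp
        subgoal by (simp add: z)
        subgoal using T1 by simp
        subgoal premises u for T2 s2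
        proof -
          obtain ps where ps: "feas R' ps" "sorted_wrt (le 0) ps" "nxt 0 R' = R' - set ps" "out s2 = out s1 @ ps"
            using u by auto
          have s2: "holds 0 (nxt 0 R') s2" "clean s2" using u by auto
          show ?thesis
          proof (rule bexec_weaken[OF less.hyps[OF less s2, unfolded phases_def block.simps]])
            show "phase_time * card (nxt 0 R') + 1 \<le> ?T1 - 1 - run_time * (?k + 1)" using T1 by linarith
            fix s3 :: state
            assume "\<exists>rs. plays (nxt 0 R') rs {} \<and> out s3 = out s2 @ concat rs \<and>
              (\<forall>m. solvable m (nxt 0 R') \<longrightarrow> D * length rs \<le> (D + 1) * m)"
            then obtain rs' where rs': "plays (nxt 0 R') rs' {}" "out s3 = out s2 @ concat rs'"
              "\<And>m. solvable m (nxt 0 R') \<Longrightarrow> D * length rs' \<le> (D + 1) * m" by blast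
            show "?Q 0 s3"
            proof (cases "R' = {}")
              case True
              \<comment> \<open>In the last phase the extra run is empty and is not counted.\<close>
              have "ps = []" using ps(1) True feas_subset[OF ps(1)] by simp
              moreover have "concat rs' = []" using plays_feas[OF rs'(1)] True feas_subset[of "{}" "concat rs'"] by auto
              ultimately have o: "out s3 = out s @ concat rs" using rs'(2) ps(4) c(2) by simp
              \<comment> \<open>The bonus makes the last phase exact: for \<open>m \<le> D\<close>
                at most \<open>m\<close> runs were used, and otherwise at most
                \<open>D < m\<close>.\<close>
              have "D * length rs \<le> (D + 1) * m" if m: "solvable m R" for m
              proof (cases "m \<le> D")
                case True
                then have "length rs \<le> m" using solvable_Val[OF m True] c(6) \<open>R' = {}\<close> by simp
                then show ?thesis by (intro mult_le_mono) auto
              next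
                case False
                then show ?thesis using c(5) by (intro mult_le_mono) auto
              qed
              then show ?thesis using c(1) True o by blast
            next
              case False
              have cR': "0 < card R'" "card R' \<le> N" using False R' reachable_card_N by (auto simp: card_gt_0_iff)
              have v: "length rs = D" "Val D R = N - card R'" using c(6) False by auto
              have "plays R (rs @ ps # rs') {}"
                using plays_append[OF c(1)] plays_Cons[OF ps(1,2)] rs'(1) ps(3) by simp
              moreover have "out s3 = out s @ concat (rs @ ps # rs')" using rs'(2) ps(4) c(2) by simp
              moreover have "D * length (rs @ ps # rs') \<le> (D + 1) * m" if m: "solvable m R" for m
              proof -
                \<comment> \<open>With fewer than \<open>D\<close> runs the bonus would lift
                  \<open>Val D R\<close> above \<open>N\<close>, but elements are left over.\<close>
                have mD: "D \<le> m"
                proof (rule ccontr)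
                  assume "\<not> D \<le> m"
                  then show False using solvable_Val[OF m, of D] v(2) cR' by simp
                qed
                have "solvable (m - D) (nxt 0 R')"
                  by (rule commit_catch_up[OF R(1) m mD R'(1) v(2)])
                from rs'(3)[OF this] have "D * (D + 1 + length rs') \<le> D * (D + 1) + (D + 1) * (m - D)"
                  by (simp add: algebra_simps)
                also have "\<dots> = (D + 1) * (D + (m - D))" by (simp only: distrib_left mult.commute)
                also have "\<dots> = (D + 1) * m" using mD by simp
                finally show ?thesis using v(1) by simp
              qed
              ultimately show ?thesis by blast
            qed
          qed
        qed
        done
    qed
  qed
qed

section \<open>Initial buffer and the whole program\<close>

lemma fill_buffer_correct:
  assumes "std_regs s" "reg s (rSize 0) = b" "b \<le> N" "reg s rJ \<le> b" "\<forall>j<reg s rJ. arr s 1 j = j"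
  shows "bx fill_buffer s (3 * (b - reg s rJ) + 1)
    (\<lambda>_ s'. frame {rJ} {1} s s' \<and> out s' = out s \<and> (\<forall>j<b. arr s' 1 j = j))"
  using assms
proof (induction "b - reg s rJ" arbitrary: s)
  case 0
  then show ?case unfolding fill_buffer_def by (intro bexec_While_false) (auto simp: frame_refl)
next
  case (Suc n)
  let ?j = "reg s rJ"
  note H = Suc.prems
  let ?s = "set_reg rJ (Suc ?j) (set_arr 1 ?j ?j s)"
  have IH: "bx fill_buffer ?s (3 * (b - reg ?s rJ) + 1)
    (\<lambda>_ s'. frame {rJ} {1} ?s s' \<and> out s' = out ?s \<and> (\<forall>j<b. arr s' 1 j = j))"
    by (rule Suc.hyps(1)) (use Suc.hyps(2) H in \<open>auto simp: std_regs_def less_Suc_eq\<close>)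
  have T: "3 * (b - ?j) + 1 = 3 * n + 4" "3 * (b - reg ?s rJ) + 1 = 3 * n + 1" using Suc.hyps(2) by auto
  show ?case
    unfolding fill_buffer_def block.simps T
    apply (rule bexec_While_true)
    subgoal by simp
    subgoal using H Suc.hyps(2) by simp
    subgoal by simp
    apply (intro bexec_Seq bexec_Store bexec_Add)
    subgoal by simp
    subgoal using H W_bound by (simp add: std_regs_def)
    subgoal by simp
    apply (rule bexec_use[OF IH[unfolded fill_buffer_def block.simps T]])
    subgoal using H by (simp add: std_regs_def)
    subgoal by simp
    subgoal by (auto simp: frame_def)
    done
qed

lemma program_correct:
  assumes "1 \<le> D"
  shows "bx (program D) (init_state N M) (phase_time * N + 3 * N + 10)
    (\<lambda>_ s'. \<exists>rs. plays {..<N} rs {} \<and> out s' = concat rs \<and>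
      (\<forall>m. solvable m {..<N} \<longrightarrow> D * length rs \<le> (D + 1) * m))"
proof -
  let ?b = "min M N"
  let ?init = "init_state N M"
  have init: "reg ?init 0 = N" "reg ?init 1 = M" "k \<noteq> 0 \<Longrightarrow> k \<noteq> 1 \<Longrightarrow> reg ?init k = 0" "arr ?init a = (\<lambda>_. 0)" "out ?init = []" for k a
    by (simp_all add: init_state_def)
  let ?s = "set_reg rJ 0 (set_reg (rRead 0) ?b (set_reg (rSize 0) ?b (set_reg rOne 1 ?init)))"
  have fill: "bx fill_buffer ?s (3 * (?b - reg ?s rJ) + 1)
    (\<lambda>_ s'. frame {rJ} {1} ?s s' \<and> out s' = out ?s \<and> (\<forall>j<?b. arr s' 1 j = j))"
    by (rule fill_buffer_correct) (simp_all add: std_regs_def init)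
  have rest: "bx (Seq (Copy (rRead 0) (rSize 0)) (Seq (Copy rJ rZero) (Seq fill_buffer (phases D))))
      (set_reg (rSize 0) ?b (set_reg rOne 1 ?init)) T
      (\<lambda>_ s'. \<exists>rs. plays {..<N} rs {} \<and> out s' = concat rs \<and>
        (\<forall>m. solvable m {..<N} \<longrightarrow> D * length rs \<le> (D + 1) * m))"
    if T: "phase_time * N + 3 * N + 6 \<le> T" for T
    apply (rule bexec_Seq, rule bexec_Copy)
    subgoal using T by simp
    apply (rule bexec_Seq, rule bexec_Copy)
    subgoal using T by simp
    apply (rule bexec_call[OF fill])
    subgoal by (simp add: init)
    subgoal using T by simp
    subgoal premises u for T1 s1
    proof -
      have f: "frame {rJ} {1} ?s s1" using u by simp
      have "reg s1 k = reg ?s k" if "k \<noteq> 15" for k using frame_reg[OF f] that by simp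
      then have r: "reg s1 0 = N" "reg s1 2 = 0" "reg s1 3 = 1" "reg s1 (rSize 0) = ?b" "reg s1 (rRead 0) = ?b"
        by (simp_all add: init)
      have "arr s1 0 = (\<lambda>_. 0)" using frame_arr[OF f, of 0] by (simp add: init)
      then have c: "clean s1" using r by (simp add: clean_def std_regs_def)
      have "stored 0 [0..<?b] s1" using u r by (simp add: stored_def)
      then have h: "holds 0 {..<N} s1" unfolding holds_def using reachable_initial(2) r
        by (auto simp: win_initial intro!: exI[of _ "[0..<?b]"])
      show ?thesis
        by (rule bexec_weaken[OF phases_correct[OF assms h c]]) (use T u init in auto)
    qed
    done
  show ?thesis
    unfolding program_def block.simps
    apply (rule bexec_Seq, rule bexec_Const)
    subgoal using W_bound by simp
    subgoal by simp
    apply (rule bexec_Seq, rule bexec_Cond)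
    subgoal by simp
    subgoal by simp
    subgoal premises t
      apply (rule bexec_Copy)
      subgoal by simp
      apply (rule bexec_start[OF rest[OF order_refl]])
      using t by (simp_all add: init_state_def min_def)
    subgoal premises t
      apply (rule bexec_Copy)
      subgoal by simp
      apply (rule bexec_start[OF rest[OF order_refl]])
      using t by (simp_all add: init_state_def min_def)
    done
qed

end

section \<open>Numerical bounds\<close>

lemma golden_ratio_bounds: "golden_ratio * golden_ratio = golden_ratio + 1" "1.617 \<le> golden_ratio" "golden_ratio \<le> 2"
proof -
  have s: "sqrt 5 * sqrt 5 = 5" by simp
  show "golden_ratio * golden_ratio = golden_ratio + 1"
    unfolding golden_ratio_def using s by (simp add: field_simps)
  have "2.234 \<le> sqrt 5" by (rule real_le_rsqrt) (simp add: power2_eq_square)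
  then show "1.617 \<le> golden_ratio" by (simp add: golden_ratio_def)
  have "sqrt 5 \<le> 3" by (rule real_le_lsqrt) auto
  then show "golden_ratio \<le> 2" by (simp add: golden_ratio_def)
qed

text \<open>Adding 6 makes the cost recurrence homogeneous, and powers of the golden ratio obey the
  same recurrence. The shifted initial values are 7 and 11.\<close>

lemma explore_cost_bound: "real (explore_cost j) + 6 \<le> 7 * golden_ratio ^ j"
proof (induction j rule: explore_cost.induct)
  case 2
  then show ?case using golden_ratio_bounds(2) by simp
next
  case (3 j)
  have "golden_ratio ^ Suc (Suc j) = golden_ratio ^ Suc j + golden_ratio ^ j"
    using golden_ratio_bounds(1) by (simp add: algebra_simps flip: mult.assoc)
  then show ?case using 3 by simp
qed simp

text \<open>The two searches contribute 14, so the induction needs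
  \<open>14 + 23 \<le> 23 * golden_ratio\<close>; 23 is the least integer for which such an
  inequality holds.\<close>

lemma commit_cost_bound: "real (commit_cost j) \<le> 23 * golden_ratio ^ j"
proof (induction j)
  case (Suc j)
  have "37 * golden_ratio ^ j \<le> (23 * golden_ratio) * golden_ratio ^ j"
    using golden_ratio_bounds(2) by (intro mult_right_mono) auto
  moreover have "real (commit_cost (Suc j)) = 2 * real (explore_cost j) + real (commit_cost j) + 4"
    "23 * golden_ratio ^ Suc j = (23 * golden_ratio) * golden_ratio ^ j" by simp_all
  ultimately show ?case using Suc explore_cost_bound[of j] by linarith
qed simp

lemma log2_ge_1: "2 \<le> n \<Longrightarrow> 1 \<le> log 2 (real n)"
  by (simp add: le_log_iff)

lemma log2_double: "2 \<le> n \<Longrightarrow> log 2 (real (2 * n)) = 1 + log 2 (real n)"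
  by (simp add: log_mult)

lemma height_bound: "1 \<le> n \<Longrightarrow> real (height n) \<le> log 2 (real n)"
proof -
  have "1 \<le> n \<Longrightarrow> 2 ^ height n \<le> n"
  proof (induction n rule: less_induct)
    case (less n)
    show ?case
    proof (cases "n = 1")
      case False
      then have "2 ^ height (n div 2) \<le> n div 2" using less.prems by (intro less.IH) auto
      then show ?thesis using False less.prems height.simps[of n] by simp
    qed (simp add: height.simps)
  qed
  moreover assume "1 \<le> n"
  ultimately have "(2::real) ^ height n \<le> real n" by (metis of_nat_le_iff of_nat_numeral of_nat_power)
  then show ?thesis using \<open>1 \<le> n\<close> by (simp add: le_log_iff powr_realpow)
qed

context machine
begin

text \<open>Here \<open>e\<close> stands for \<open>1 / \<epsilon>\<close>. Rounding up costs one
  factor \<open>golden_ratio \<le> 2\<close>, which turns \<open>23 + 2\<close> into 50. Then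
  \<open>2 * 135 * 50 = 13500\<close>, and the rest of 14000 covers initialisation.\<close>

lemma total_time_bound:
  assumes N: "2 \<le> N" and D: "real D \<le> e + 1"
  shows "real (phase_time * N + 3 * N + 10) \<le> 14000 * (golden_ratio powr e * real N * log 2 (real N))"
proof -
  let ?L = "log 2 (real N)" and ?P = "golden_ratio powr e"
  have L: "1 \<le> ?L" using N by (rule log2_ge_1)
  have "real (height (2 * N)) \<le> log 2 (real (2 * N))" using N by (intro height_bound) auto
  also have "\<dots> = 1 + ?L" using N by (rule log2_double)
  \<comment> \<open>A logarithm of at least 1 absorbs the constants:
    \<open>48 + 87 = 135\<close>.\<close>
  finally have run: "real run_time \<le> 135 * ?L"
    using L by (simp add: run_time_def update_time_def)
  have g: "0 < golden_ratio" "1 \<le> golden_ratio" using golden_ratio_bounds(2) by auto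
  have D1: "golden_ratio ^ D = golden_ratio powr (real D)" using g by (simp add: powr_realpow)
  also have "\<dots> \<le> golden_ratio powr (e + 1)" using D g by (intro powr_mono) auto
  also have "\<dots> = ?P * golden_ratio" using g by (simp add: powr_add)
  also have "\<dots> \<le> ?P * 2" using golden_ratio_bounds(3) by (intro mult_left_mono) auto
  finally have P: "golden_ratio ^ D \<le> 2 * ?P" by simp
  have "1 \<le> golden_ratio ^ D" using g by simp
  then have P2: "1 \<le> 2 * ?P" and H: "real (commit_cost D + 2) \<le> 25 * golden_ratio ^ D"
    using P commit_cost_bound[of D] by simp_all
  then have H: "real (commit_cost D + 2) \<le> 50 * ?P" using P by linarith
  have "real phase_time \<le> 2 * (135 * ?L) * (50 * ?P)"
    unfolding phase_time_def of_nat_mult using run H L by (intro mult_mono) auto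
  then have "real phase_time * real N \<le> 13500 * (?P * real N * ?L)"
    using mult_right_mono[of "real phase_time" "2 * (135 * ?L) * (50 * ?P)" "real N"] by (simp add: algebra_simps)
  moreover have "real N \<le> 2 * (?P * real N * ?L)"
  proof -
    have "1 * real N * 1 \<le> (2 * ?P) * real N * ?L" using P2 L by (intro mult_mono) auto
    then show ?thesis by simp
  qed
  ultimately show ?thesis using N by simp
qed

end

theorem theorem12:
  "\<exists>(C::real) > 0. \<exists>k::nat. \<forall>(\<epsilon>::real) > 0. \<exists>A::cmd. \<forall>M::nat \<ge> 1. \<forall>I :: 'a::linorder list.
     \<exists>t ps.
       computes (word_limit k (length I) M \<epsilon>) A M I t ps \<and>
       ps \<in> strategies M (length I) \<and>
       real (num_runs (output_of I ps)) \<le> (1 + \<epsilon>) * real (OPT M I) \<and>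
       (length I \<ge> 2 \<longrightarrow>
          real t \<le> C * (golden_ratio powr (1 / \<epsilon>) * real (length I) * log 2 (real (length I))))"
proof (rule exI[of _ 14000], intro conjI exI[of _ 2] allI impI)
  fix \<epsilon> :: real
  assume \<epsilon>: "0 < \<epsilon>"
  \<comment> \<open>Rounding up gives \<open>1 / D \<le> \<epsilon>\<close> for the ratio and
    \<open>D \<le> 1 / \<epsilon> + 1\<close> for the time. The program text may depend on
    \<open>\<epsilon>\<close>, so \<open>D\<close> can be built into it.\<close>
  define D where "D = nat \<lceil>1 / \<epsilon>\<rceil>"
  have "0 < 1 / \<epsilon>" using \<epsilon> by simp
  then have D: "1 \<le> D" "1 / \<epsilon> \<le> real D" "real D \<le> 1 / \<epsilon> + 1"
    unfolding D_def by linarith+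
  show "\<exists>A::cmd. \<forall>M::nat \<ge> 1. \<forall>I :: 'a::linorder list.
     \<exists>t ps.
       computes (word_limit 2 (length I) M \<epsilon>) A M I t ps \<and>
       ps \<in> strategies M (length I) \<and>
       real (num_runs (output_of I ps)) \<le> (1 + \<epsilon>) * real (OPT M I) \<and>
       (length I \<ge> 2 \<longrightarrow>
          real t \<le> 14000 * (golden_ratio powr (1 / \<epsilon>) * real (length I) * log 2 (real (length I))))"
  proof (rule exI[of _ "program D"], intro allI impI)
    fix M :: nat and I :: "'a list"
    assume M: "1 \<le> M"
    let ?W = "word_limit 2 (length I) M \<epsilon>" and ?X = "length I + M + D + 2"
    \<comment> \<open>Since \<open>?X \<ge> 4\<close>, the exponent 2 in the word limit suffices for
      the factor 2 in \<open>W_bound\<close>.\<close>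
    have "4 * ?X \<le> ?X * ?X" using M D by (intro mult_le_mono1) simp
    then have W: "2 * length I + D + 4 \<le> ?W"
      unfolding word_limit_def D_def[symmetric] by (simp add: power2_eq_square)
    interpret machine I M ?W D by unfold_locales (use M W in auto)
    obtain t s' rs where t: "exec ?W I (program D) (init_state N M) t s'" "t \<le> phase_time * N + 3 * N + 10"
      and rs: "plays {..<N} rs {}" "out s' = concat rs" "\<And>m. solvable m {..<N} \<Longrightarrow> D * length rs \<le> (D + 1) * m"
      using program_correct[OF D(1)] unfolding bexec_def by (metis add_leD1)
    have strat: "concat rs \<in> strategies M N"
      unfolding strategies_feas using plays_feas[OF rs(1)] feas_subset by blast
    \<comment> \<open>The computed strategy itself witnesses that strategies exist, as
      \<open>solvable_OPT\<close> requires.\<close>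
    then have "D * length rs \<le> (D + 1) * OPT M I" by (intro rs(3) solvable_OPT) auto
    then have "D * num_runs (output_of I (concat rs)) \<le> (D + 1) * OPT M I"
      using num_runs_plays[OF rs(1)] by (meson mult_le_mono2 order_trans)
    then have "real D * real (num_runs (output_of I (concat rs))) \<le> (real D + 1) * real (OPT M I)"
      by (metis of_nat_1 of_nat_add of_nat_le_iff of_nat_mult)
    also have "\<dots> \<le> (real D * (1 + \<epsilon>)) * real (OPT M I)"
      using D(2) \<epsilon> by (intro mult_right_mono) (auto simp: field_simps)
    finally have "real D * real (num_runs (output_of I (concat rs))) \<le> real D * ((1 + \<epsilon>) * real (OPT M I))"
      by (simp only: mult.assoc)
    then have runs: "real (num_runs (output_of I (concat rs))) \<le> (1 + \<epsilon>) * real (OPT M I)"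
      using D(1) by simp
    have "real t \<le> 14000 * (golden_ratio powr (1 / \<epsilon>) * real N * log 2 (real N))" if "2 \<le> N"
      using total_time_bound[OF that D(3)] t(2) by linarith
    moreover have "computes ?W (program D) M I t (concat rs)"
      unfolding computes_def using t(1) rs(2) by blast
    ultimately show "\<exists>t ps. computes ?W (program D) M I t ps \<and> ps \<in> strategies M N \<and>
       real (num_runs (output_of I ps)) \<le> (1 + \<epsilon>) * real (OPT M I) \<and>
       (N \<ge> 2 \<longrightarrow> real t \<le> 14000 * (golden_ratio powr (1 / \<epsilon>) * real N * log 2 (real N)))"
      using strat runs by blast
  qed
qed simp

end
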